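(* Let $k\in\mathbb{Z}_{\ge0}^{S}$ have exactly one nonzero entry, $k_\sigma=k=dq$ with $1\le d<\frac{q}{2}$. Let $a\in\mathcal{O}_{C}$ with $0<v_{F}(a)\le1$, and let $N\in\mathbb{Z}_{>0}$. Then there exists $\epsilon\in\mathbb{Z}_{\ge0}$ depending only on $N,k,a$ such that for all $n\in\mathbb{Z}_{\ge0}$ and all $f\in\mathrm{ind}_{KZ}^{G}V_{k}^{0}$: \[(T-a)(f)\in B_{N}+\varpi^{n}\,\mathrm{ind}_{KZ}^{G}V_{k}^{0}\ \Longrightarrow\ f\in B_{N-1}+\varpi^{n-\epsilon}\,\mathrm{ind}_{KZ}^{G}V_{k}^{0}.\]
   Context: $p$ is a prime; $F$ is a finite extension of $\mathbb{Q}_{p}$ with ring of integers $\mathcal{O}_{F}$, fixed uniformizer $\varpi$, residue field $\kappa_F$ of cardinality $q$. $C$ is a finite extension of $\mathbb{Q}_{p}$ such that $S=\mathrm{Hom}_{\mathbb{Q}_p\text{-alg}}(F,C)$ has $[F:\mathbb{Q}_{p}]$ elements and $C$ contains a fixed square root of $\sigma(\varpi)$ for each $\sigma\in S$. $v_F$ is the valuation on $\overline{\mathbb{Q}}_p$ with $v_F(\varpi)=1$. In statements about $\mathcal{O}_C$-modules, $\varpi^{n}$ ($n\in\mathbb{Z}$) means $\sigma(\varpi)^{n}$ for a fixed $\sigma\in S$. $G=GL_{2}(F)$, $K=GL_{2}(\mathcal{O}_{F})$, $Z$ the center, $\alpha=\mathrm{diag}(1,\varpi)$, $\chi(g)=\varpi^{-v_{F}(\det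 g)}$. For $k\in\mathbb{Z}_{\ge0}^{S}$, $V_{k}=\bigotimes_{\sigma\in S}V^{\sigma}_{k_\sigma}$ with $V^{\sigma}_{k_\sigma}$ the homogeneous polynomials of degree $k_\sigma$ in $x_\sigma,y_\sigma$ over $C$, where $g=\begin{pmatrix}a&b\\c&d\end{pmatrix}$ acts by $x_\sigma^{k_\sigma-i}y_\sigma^{i}\mapsto \sigma(\chi(g))^{k_\sigma/2}(\sigma(a)x_\sigma+\sigma(c)y_\sigma)^{k_\sigma-i}(\sigma(b)x_\sigma+\sigma(d)y_\sigma)^{i}$, diagonally (representation $\rho_k$); $V_k^0$ is the $\mathcal{O}_C$-span of tensor products of monomials. $U_k$ multiplies $\bigotimes_\sigma x_\sigma^{k_\sigma-i_\sigma}y_\sigma^{i_\sigma}$ by $\prod_\sigma\sigma(\varpi)^{k_\sigma-i_\sigma}$; $\psi$ is the unique function $G\to\mathrm{End}_C(V_k)$ supported on $KZ\alpha^{-1}KZ$ with $\psi(\kappa_1\alpha^{-1}\kappa_2)=\rho_k(\kappa_1)U_k\rho_k(\kappa_2)$ ($\kappa_i\in KZ$). $\mathrm{ind}_{KZ}^{G}W$ ($W=V_k$ or $V_k^0$) consists of $f:G\to W$ with $f(\kappa g)=\rho_k(\kappa)f(g)$ ($\kappa\in KZ$), supported on finitely many cosets $KZg$; $[g,v]$ is supported on $KZg^{-1}$ with value $v$ at $g^{-1}$. $T([g,v])=\sum_{xKZ\in G/KZ}[gx,\psi(x^{-1})v]$; $T$ preserves $\mathrm{ind}_{KZ}^GV_k^0$.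 Supports: $I_0=\{0\}$, $I_{n}=\{\sum_{i=0}^{n-1}\varpi^{i}[\mu_{i}]:\mu_i\in\kappa_F\}$; $g_{n,\mu}^{0}=\begin{pmatrix}\varpi^{n}&\mu\\0&1\end{pmatrix}$, $g_{n,\mu}^{1}=\begin{pmatrix}1&0\\\varpi\mu&\varpi^{n+1}\end{pmatrix}$. Every $f$ is uniquely a finite sum $\sum_{n,\mu}([g^0_{n,\mu},v^0_{n,\mu}]+[g^1_{n,\mu},v^1_{n,\mu}])$; $f\in B_N$ means $v^0_{n,\mu}=0$ for $n>N$ and $v^1_{n,\mu}=0$ for $n>N-1$. *)

theory Defs
  imports
    "HOL-Analysis.Analysis"
    "HOL-Computational_Algebra.Fraction_Field"
    "HOL-Library.Poly_Mapping"
    "Berlekamp_Zassenhaus.Finite_Field"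
begin

section \<open>The $p$-adic numbers\<close>

text \<open>The prime is $p$ = \<^term>\<open>CARD('p)\<close> for a type of sort \<^class>\<open>prime_card\<close>. A $p$-adic integer is
  a compatible sequence of residues modulo $p^n$, and $\mathbb{Q}_p$ is the fraction field.\<close>

typedef (overloaded) 'p padic_int =
  "{x :: nat \<Rightarrow> int. \<forall>n. 0 \<le> x n \<and> x n < int CARD('p::prime_card) ^ n
      \<and> x (Suc n) mod int CARD('p) ^ n = x n}"
  morphisms residue Abs_padic_int
  by (rule exI[of _ "\<lambda>_. 0"]) (auto intro: zero_less_power prime_gt_0_nat[OF prime_card])

setup_lifting type_definition_padic_int

lemma CARD_prime_pos: "0 < int CARD('p::prime_card)"
  using prime_gt_0_nat[OF prime_card, where 'a1 = 'p] by simp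

lemma residue_mod:
  "residue (x::'p::prime_card padic_int) n mod int CARD('p) ^ n = residue x n"
  using residue[of x] by (auto intro: mod_pos_pos_trivial)

lemma residue_Suc_mod:
  "residue (x::'p::prime_card padic_int) (Suc n) mod int CARD('p) ^ n = residue x n"
  using residue[of x] by auto

lemma residue_add_mod:
  "residue (x::'p::prime_card padic_int) (n + m) mod int CARD('p) ^ n = residue x n"
proof (induction m)
  case 0
  show ?case by (simp add: residue_mod)
next
  case (Suc m)
  have "residue x (n + Suc m) mod int CARD('p) ^ n
      = residue x (Suc (n + m)) mod int CARD('p) ^ (n + m) mod int CARD('p) ^ n"
    by (simp add: mod_mod_cancel le_imp_power_dvd)
  then show ?case
    by (simp only: residue_Suc_mod Suc.IH)
qed

lemma mod_Suc_cancel: "a mod (P::int) ^ Suc n mod P ^ n = a mod P ^ n"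
  by (rule mod_mod_cancel) (simp add: le_imp_power_dvd)

instantiation padic_int :: (prime_card) comm_ring_1
begin

lift_definition zero_padic_int :: "'a padic_int" is "\<lambda>_. 0"
  using CARD_prime_pos[where 'p = 'a] by simp

lift_definition one_padic_int :: "'a padic_int" is "\<lambda>n. 1 mod int CARD('a) ^ n"
  using CARD_prime_pos[where 'p = 'a] by (simp only: mod_Suc_cancel) simp

lift_definition plus_padic_int :: "'a padic_int \<Rightarrow> 'a padic_int \<Rightarrow> 'a padic_int"
  is "\<lambda>x y n. (x n + y n) mod int CARD('a) ^ n"
  using CARD_prime_pos[where 'p = 'a]
  by (simp only: mod_Suc_cancel) (metis mod_add_eq pos_mod_bound pos_mod_sign zero_less_power)

lift_definition times_padic_int :: "'a padic_int \<Rightarrow> 'a padic_int \<Rightarrow> 'a padic_int"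
  is "\<lambda>x y n. (x n * y n) mod int CARD('a) ^ n"
  using CARD_prime_pos[where 'p = 'a]
  by (simp only: mod_Suc_cancel) (metis mod_mult_eq pos_mod_bound pos_mod_sign zero_less_power)

lift_definition uminus_padic_int :: "'a padic_int \<Rightarrow> 'a padic_int"
  is "\<lambda>x n. (- x n) mod int CARD('a) ^ n"
  using CARD_prime_pos[where 'p = 'a]
  by (simp only: mod_Suc_cancel) (metis mod_minus_eq pos_mod_bound pos_mod_sign zero_less_power)

lift_definition minus_padic_int :: "'a padic_int \<Rightarrow> 'a padic_int \<Rightarrow> 'a padic_int"
  is "\<lambda>x y n. (x n - y n) mod int CARD('a) ^ n"
  using CARD_prime_pos[where 'p = 'a]
  by (simp only: mod_Suc_cancel) (metis mod_diff_eq pos_mod_bound pos_mod_sign zero_less_power)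

instance
proof
  fix a b c :: "'a padic_int"
  note ext_res = residue_inject[THEN iffD1, OF ext]
  note reps = plus_padic_int.rep_eq times_padic_int.rep_eq uminus_padic_int.rep_eq
    minus_padic_int.rep_eq zero_padic_int.rep_eq one_padic_int.rep_eq
  show "a + b + c = a + (b + c)"
    by (rule ext_res) (simp add: reps mod_simps algebra_simps)
  show "a + b = b + a"
    by (rule ext_res) (simp add: reps algebra_simps)
  show "0 + a = a"
    by (rule ext_res) (simp add: reps residue_mod)
  show "- a + a = 0"
    by (rule ext_res) (simp add: reps mod_simps)
  show "a - b = a + - b"
    by (rule ext_res) (simp add: reps mod_simps)
  show "a * b * c = a * (b * c)"
    by (rule ext_res) (simp add: reps mod_simps algebra_simps)
  show "a * b = b * a"
    by (rule ext_res) (simp add: reps algebra_simps)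
  show "1 * a = a"
    by (rule ext_res) (simp add: reps mod_simps residue_mod)
  show "(a + b) * c = a * c + b * c"
    by (rule ext_res) (simp add: reps mod_simps algebra_simps)
  have "residue (0 :: 'a padic_int) 1 \<noteq> residue 1 1"
    using prime_gt_1_nat[OF prime_card, where 'a1 = 'a] by (simp add: reps)
  then show "(0 :: 'a padic_int) \<noteq> 1"
    by metis
qed

end

definition padic_ord :: "'p::prime_card padic_int \<Rightarrow> nat" where
  "padic_ord x = (LEAST n. residue x (Suc n) \<noteq> 0)"

lemma residue_0: "residue (x::'p::prime_card padic_int) 0 = 0"
  using residue_mod[of x 0] by simp

lemma multiplicity_residue:
  assumes "(x::'p::prime_card padic_int) \<noteq> 0" "padic_ord x < N"
  shows "residue x N \<noteq> 0" "multiplicity (int CARD('p)) (residue x N) = padic_ord x"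
proof -
  let ?p = "int CARD('p)" and ?m = "padic_ord x"
  have "\<exists>n. residue x n \<noteq> 0"
    using assms(1) residue_inject[of x 0] by (auto simp: zero_padic_int.rep_eq)
  then have ex: "\<exists>n. residue x (Suc n) \<noteq> 0"
    using residue_0[of x] by (metis not0_implies_Suc)
  then have ne: "residue x (Suc ?m) \<noteq> 0"
    unfolding padic_ord_def by (rule LeastI_ex)
  have z: "residue x ?m = 0"
  proof (cases ?m)
    case 0
    then show ?thesis by (simp add: residue_0)
  next
    case (Suc j)
    then show ?thesis
      using not_less_Least[of j "\<lambda>n. residue x (Suc n) \<noteq> 0"] unfolding padic_ord_def by auto
  qed
  have "residue x N mod ?p ^ ?m = 0"
    using residue_add_mod[of x ?m "N - ?m"] assms(2) z by simp
  then have d: "?p ^ ?m dvd residue x N" by auto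
  have "residue x N mod ?p ^ Suc ?m \<noteq> 0"
    using residue_add_mod[of x "Suc ?m" "N - Suc ?m"] assms(2) ne by simp
  then have nd: "\<not> ?p ^ Suc ?m dvd residue x N" by auto
  then show "residue x N \<noteq> 0" by auto
  show "multiplicity ?p (residue x N) = ?m"
    using d nd by (intro multiplicity_eqI) auto
qed

lemma prime_int_CARD: "prime (int CARD('p::prime_card))"
  using prime_card[where 'a = 'p] by simp

lemma padic_mult_nonzero:
  assumes "(x::'p::prime_card padic_int) \<noteq> 0" "y \<noteq> 0"
  shows "x * y \<noteq> 0" "padic_ord (x * y) = padic_ord x + padic_ord y"
proof -
  let ?p = "int CARD('p)" and ?s = "padic_ord x + padic_ord y"
  have p: "prime_elem ?p" using prime_int_CARD[where 'p = 'p] by simp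
  have key: "residue (x * y) N \<noteq> 0" "multiplicity ?p (residue x N * residue y N) = ?s"
    if "?s < N" for N
  proof -
    note X = multiplicity_residue[OF assms(1), of N] and Y = multiplicity_residue[OF assms(2), of N]
    show m: "multiplicity ?p (residue x N * residue y N) = ?s"
      using X Y that p by (simp add: prime_elem_multiplicity_mult_distrib)
    have "\<not> ?p ^ N dvd residue x N * residue y N"
      using X Y that m p
      by (metis add_lessD1 add.commute mult_eq_0_iff multiplicity_geI not_less
          not_prime_elem_zero prime_elem_def prime_elem_not_unit)
    then show "residue (x * y) N \<noteq> 0"
      by (auto simp: times_padic_int.rep_eq)
  qed
  show nz: "x * y \<noteq> 0"
    using key(1)[of "Suc ?s"] by (auto simp: zero_padic_int.rep_eq)
  show "padic_ord (x * y) = ?s"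
  proof (rule ccontr)
    assume ne: "padic_ord (x * y) \<noteq> ?s"
    define N where "N = Suc (padic_ord (x * y) + ?s)"
    have *: "multiplicity ?p (residue (x * y) N) = padic_ord (x * y)"
      by (rule multiplicity_residue(2)[OF nz]) (simp add: N_def)
    have r: "residue (x * y) N = (residue x N * residue y N) mod ?p ^ N"
      by (simp add: times_padic_int.rep_eq)
    have m: "multiplicity ?p (residue x N * residue y N) = ?s"
      by (rule key(2)) (simp add: N_def)
    have dvd_iff: "?p ^ j dvd residue (x * y) N \<longleftrightarrow> ?p ^ j dvd residue x N * residue y N"
      if "j \<le> N" for j
      unfolding r by (rule dvd_mod_iff) (simp add: le_imp_power_dvd that)
    have nz1: "residue (x * y) N \<noteq> 0" by (rule key(1)) (simp add: N_def)
    then have nz2: "residue x N * residue y N \<noteq> 0" using r by auto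
    have nu: "\<not> is_unit ?p" using p by (rule prime_elem_not_unit)
    have "?p ^ ?s dvd residue (x * y) N"
      using dvd_iff[of ?s] m multiplicity_dvd[of ?p "residue x N * residue y N"]
      by (simp add: N_def)
    then have 1: "?s \<le> padic_ord (x * y)"
      using * nz1 nu multiplicity_geI by metis
    have "?p ^ padic_ord (x * y) dvd residue x N * residue y N"
      using dvd_iff[of "padic_ord (x * y)"] * multiplicity_dvd[of ?p "residue (x * y) N"]
      by (simp add: N_def)
    then have "padic_ord (x * y) \<le> ?s"
      using m nz2 nu multiplicity_geI by metis
    with 1 ne show False by simp
  qed
qed

instance padic_int :: (prime_card) idom
  by standard (rule padic_mult_nonzero)

type_synonym 'p padic = "'p padic_int fract"

definition padic_val :: "'p::prime_card padic \<Rightarrow> int" where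
  "padic_val x = (THE n. \<exists>a b. a \<noteq> 0 \<and> b \<noteq> 0 \<and> x = Fraction_Field.Fract a b
      \<and> n = int (padic_ord a) - int (padic_ord b))"

lemma padic_val_Fract:
  assumes "a \<noteq> 0" "b \<noteq> 0"
  shows "padic_val (Fraction_Field.Fract a b) = int (padic_ord a) - int (padic_ord b)"
  unfolding padic_val_def
proof (rule the_equality)
  fix n
  assume "\<exists>a' b'. a' \<noteq> 0 \<and> b' \<noteq> 0 \<and> Fraction_Field.Fract a b = Fraction_Field.Fract a' b'
      \<and> n = int (padic_ord a') - int (padic_ord b')"
  then obtain a' b' where *: "a' \<noteq> 0" "b' \<noteq> 0" "a * b' = a' * b"
    "n = int (padic_ord a') - int (padic_ord b')"
    using assms by (auto simp: eq_fract)
  then have "padic_ord a + padic_ord b' = padic_ord a' + padic_ord b"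
    using assms padic_mult_nonzero(2) by metis
  with * show "n = int (padic_ord a) - int (padic_ord b)" by simp
qed (use assms in blast)


section \<open>Field extensions and valuations\<close>

text \<open>\<^term>\<open>j\<close> is the structure map of the extension.\<close>

definition finite_extension :: "('k::field \<Rightarrow> 'l::field) \<Rightarrow> bool" where
  "finite_extension j \<longleftrightarrow> comm_ring_hom j
     \<and> (\<exists>B. finite_dimensional_vector_space (\<lambda>a x. j a * x) B)"

definition ext_degree :: "('k::field \<Rightarrow> 'l::field) \<Rightarrow> nat" where
  "ext_degree j = vector_space.dim (\<lambda>a x. j a * x) UNIV"

text \<open>A valuation is a function on nonzero elements; its value at \<^term>\<open>0\<close> (morally $\infty$) is
  irrelevant.\<close>

definition valuation :: "('k::field \<Rightarrow> 'g::linordered_ab_group_add) \<Rightarrow> bool" where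
  "valuation v \<longleftrightarrow>
     (\<forall>x y. x \<noteq> 0 \<longrightarrow> y \<noteq> 0 \<longrightarrow> v (x * y) = v x + v y) \<and>
     (\<forall>x y. x \<noteq> 0 \<longrightarrow> y \<noteq> 0 \<longrightarrow> x + y \<noteq> 0 \<longrightarrow> min (v x) (v y) \<le> v (x + y))"

definition val_ring :: "('k::field \<Rightarrow> 'g::linordered_ab_group_add) \<Rightarrow> 'k set" where
  "val_ring v = {x. x = 0 \<or> 0 \<le> v x}"

definition val_ideal :: "('k::field \<Rightarrow> 'g::linordered_ab_group_add) \<Rightarrow> 'k set" where
  "val_ideal v = {x. x = 0 \<or> 0 < v x}"

text \<open>\<open>val_F\<close> and \<open>val_C\<close> are the restrictions to $F$ and $C$ of the valuation $v_F$ on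
  $\overline{\mathbb{Q}}_p$; \<open>sqrt_unif D \<sigma>\<close> is the chosen square root of $\sigma(\varpi)$.\<close>

record ('p, 'f, 'c) padic_data =
  emb_F :: "'p padic_int fract \<Rightarrow> 'f"
  emb_C :: "'p padic_int fract \<Rightarrow> 'c"
  val_F :: "'f \<Rightarrow> int"
  val_C :: "'c \<Rightarrow> real"
  unif :: 'f
  sqrt_unif :: "('f \<Rightarrow> 'c) \<Rightarrow> 'c"

definition Emb :: "('p::prime_card, 'f::field, 'c::field) padic_data \<Rightarrow> ('f \<Rightarrow> 'c) set" where
  "Emb D = {\<sigma>. comm_ring_hom \<sigma> \<and> (\<forall>x. \<sigma> (emb_F D x) = emb_C D x)}"

text \<open>The integer \<open>e\<close> is the ramification index of $F$: the valuation normalised by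
  $v_F(\varpi) = 1$ restricts to \<open>e\<close> times the $p$-adic valuation on $\mathbb{Q}_p$. As the extension
  of a valuation from $\mathbb{Q}_p$ to a finite extension is unique, the clauses determine
  \<open>val_F\<close> and \<open>val_C\<close> on nonzero elements; an integer-valued \<open>val_F\<close> with value 1 at
  $\varpi$ makes $\varpi$ a uniformizer.\<close>

definition padic_setting :: "('p::prime_card, 'f::field, 'c::field) padic_data \<Rightarrow> bool" where
  "padic_setting D \<longleftrightarrow>
     finite_extension (emb_F D) \<and> finite_extension (emb_C D) \<and>
     valuation (val_F D) \<and> valuation (val_C D) \<and>
     (\<exists>e>0. \<forall>x. x \<noteq> 0 \<longrightarrow> val_F D (emb_F D x) = e * padic_val x
                       \<and> val_C D (emb_C D x) = real_of_int (e * padic_val x)) \<and>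
     unif D \<noteq> 0 \<and> val_F D (unif D) = 1 \<and>
     card (Emb D) = ext_degree (emb_F D) \<and>
     (\<forall>\<sigma>\<in>Emb D. sqrt_unif D \<sigma> ^ 2 = \<sigma> (unif D))"

abbreviation O_F :: "('p::prime_card, 'f::field, 'c::field) padic_data \<Rightarrow> 'f set" where
  "O_F D \<equiv> val_ring (val_F D)"

abbreviation O_C :: "('p::prime_card, 'f::field, 'c::field) padic_data \<Rightarrow> 'c set" where
  "O_C D \<equiv> val_ring (val_C D)"

definition residue_field :: "('p::prime_card, 'f::field, 'c::field) padic_data \<Rightarrow> 'f set set" where
  "residue_field D = (\<lambda>x. {y. y - x \<in> val_ideal (val_F D)}) ` O_F D"

definition residue_card :: "('p::prime_card, 'f::field, 'c::field) padic_data \<Rightarrow> nat" where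
  "residue_card D = card (residue_field D)"

text \<open>The Teichmueller representative $[\mu]$ of a residue class.\<close>

definition teich :: "('p::prime_card, 'f::field, 'c::field) padic_data \<Rightarrow> 'f set \<Rightarrow> 'f" where
  "teich D \<mu> = (THE t. t \<in> \<mu> \<and> t ^ residue_card D = t)"


section \<open>The groups\<close>

definition mat2 :: "'a \<Rightarrow> 'a \<Rightarrow> 'a \<Rightarrow> 'a \<Rightarrow> 'a::zero ^ 2 ^ 2" where
  "mat2 a b c d = vector [vector [a, b], vector [c, d]]"

definition GL2 :: "('f::field ^ 2 ^ 2) set" where
  "GL2 = {g. invertible g}"

definition GL2_int :: "('p::prime_card, 'f::field, 'c::field) padic_data \<Rightarrow> ('f ^ 2 ^ 2) set" where
  "GL2_int D = {g \<in> GL2. (\<forall>i j. g $ i $ j \<in> O_F D) \<and> (\<forall>i j. matrix_inv g $ i $ j \<in> O_F D)}"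

definition KZ :: "('p::prime_card, 'f::field, 'c::field) padic_data \<Rightarrow> ('f ^ 2 ^ 2) set" where
  "KZ D = {g ** mat z | g z. g \<in> GL2_int D \<and> z \<noteq> 0}"

definition alpha :: "('p::prime_card, 'f::field, 'c::field) padic_data \<Rightarrow> 'f ^ 2 ^ 2" where
  "alpha D = mat2 1 0 0 (unif D)"


section \<open>The representation $V_k$\<close>

text \<open>$\bigotimes_{\sigma} V^\sigma_{k_\sigma}$ is realised inside the polynomial ring over $C$ in
  all the variables $x_\sigma, y_\sigma$, a pure tensor being the product of its factors.\<close>

datatype 's var = XVar 's | YVar 's

type_synonym ('s, 'c) mpoly = "('s var \<Rightarrow>\<^sub>0 nat) \<Rightarrow>\<^sub>0 'c"

definition Const :: "'c \<Rightarrow> ('s, 'c::comm_ring_1) mpoly" where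
  "Const c = Poly_Mapping.single 0 c"

definition Var :: "'s var \<Rightarrow> ('s, 'c::comm_ring_1) mpoly" where
  "Var x = Poly_Mapping.single (Poly_Mapping.single x 1) 1"

definition mpoly_subst :: "('s var \<Rightarrow> ('s, 'c::comm_ring_1) mpoly) \<Rightarrow> ('s, 'c) mpoly \<Rightarrow> ('s, 'c) mpoly" where
  "mpoly_subst \<theta> P = (\<Sum>m\<in>Poly_Mapping.keys P. Const (Poly_Mapping.lookup P m) *
      (\<Prod>x\<in>Poly_Mapping.keys m. \<theta> x ^ Poly_Mapping.lookup m x))"

definition tensor_monom :: "('p::prime_card, 'f::field, 'c::field) padic_data \<Rightarrow>
    (('f \<Rightarrow> 'c) \<Rightarrow> nat) \<Rightarrow> (('f \<Rightarrow> 'c) \<Rightarrow> nat) \<Rightarrow> ('f \<Rightarrow> 'c, 'c) mpoly" where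
  "tensor_monom D k i = (\<Prod>\<sigma>\<in>Emb D. Var (XVar \<sigma>) ^ (k \<sigma> - i \<sigma>) * Var (YVar \<sigma>) ^ i \<sigma>)"

definition monom_span :: "('p::prime_card, 'f::field, 'c::field) padic_data \<Rightarrow>
    (('f \<Rightarrow> 'c) \<Rightarrow> nat) \<Rightarrow> 'c set \<Rightarrow> ('f \<Rightarrow> 'c, 'c) mpoly set" where
  "monom_span D k R =
     {\<Sum>i\<in>(\<Pi>\<^sub>E \<sigma>\<in>Emb D. {..k \<sigma>}). Const (c i) * tensor_monom D k i | c. \<forall>i. c i \<in> R}"

definition Vk :: "('p::prime_card, 'f::field, 'c::field) padic_data \<Rightarrow>
    (('f \<Rightarrow> 'c) \<Rightarrow> nat) \<Rightarrow> ('f \<Rightarrow> 'c, 'c) mpoly set" where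
  "Vk D k = monom_span D k UNIV"

definition Vk0 :: "('p::prime_card, 'f::field, 'c::field) padic_data \<Rightarrow>
    (('f \<Rightarrow> 'c) \<Rightarrow> nat) \<Rightarrow> ('f \<Rightarrow> 'c, 'c) mpoly set" where
  "Vk0 D k = monom_span D k (O_C D)"

text \<open>$\sigma(\chi(g))^{k_\sigma/2} = \sigma(\varpi)^{-v_F(\det g) k_\sigma/2}$ is formed with the
  chosen square root of $\sigma(\varpi)$.\<close>

definition rho :: "('p::prime_card, 'f::field, 'c::field) padic_data \<Rightarrow> (('f \<Rightarrow> 'c) \<Rightarrow> nat) \<Rightarrow>
    'f ^ 2 ^ 2 \<Rightarrow> ('f \<Rightarrow> 'c, 'c) mpoly \<Rightarrow> ('f \<Rightarrow> 'c, 'c) mpoly" where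
  "rho D k g P =
     Const (\<Prod>\<sigma>\<in>Emb D. sqrt_unif D \<sigma> powi (- val_F D (det g) * int (k \<sigma>))) *
     mpoly_subst (\<lambda>x. case x of
         XVar \<sigma> \<Rightarrow> Const (\<sigma> (g $ 1 $ 1)) * Var (XVar \<sigma>) + Const (\<sigma> (g $ 2 $ 1)) * Var (YVar \<sigma>)
       | YVar \<sigma> \<Rightarrow> Const (\<sigma> (g $ 1 $ 2)) * Var (XVar \<sigma>) + Const (\<sigma> (g $ 2 $ 2)) * Var (YVar \<sigma>)) P"

definition Uk :: "('p::prime_card, 'f::field, 'c::field) padic_data \<Rightarrow>
    ('f \<Rightarrow> 'c, 'c) mpoly \<Rightarrow> ('f \<Rightarrow> 'c, 'c) mpoly" where
  "Uk D P = (\<Sum>m\<in>Poly_Mapping.keys P. Poly_Mapping.single m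
      (Poly_Mapping.lookup P m * (\<Prod>\<sigma>\<in>Emb D. \<sigma> (unif D) ^ Poly_Mapping.lookup m (XVar \<sigma>))))"

definition psi :: "('p::prime_card, 'f::field, 'c::field) padic_data \<Rightarrow> (('f \<Rightarrow> 'c) \<Rightarrow> nat) \<Rightarrow>
    'f ^ 2 ^ 2 \<Rightarrow> ('f \<Rightarrow> 'c, 'c) mpoly \<Rightarrow> ('f \<Rightarrow> 'c, 'c) mpoly" where
  "psi D k g P =
     (if \<exists>\<kappa>1\<in>KZ D. \<exists>\<kappa>2\<in>KZ D. g = \<kappa>1 ** matrix_inv (alpha D) ** \<kappa>2
      then THE Q. \<exists>\<kappa>1\<in>KZ D. \<exists>\<kappa>2\<in>KZ D. g = \<kappa>1 ** matrix_inv (alpha D) ** \<kappa>2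
                    \<and> Q = rho D k \<kappa>1 (Uk D (rho D k \<kappa>2 P))
      else 0)"


section \<open>Compact induction and the Hecke operator\<close>

text \<open>Functions on $GL_2(F)$ are extended by \<^term>\<open>0\<close> to all matrices.\<close>

type_synonym ('f, 'c) ind_fun = "'f ^ 2 ^ 2 \<Rightarrow> ('f \<Rightarrow> 'c, 'c) mpoly"

definition cind :: "('p::prime_card, 'f::field, 'c::field) padic_data \<Rightarrow> (('f \<Rightarrow> 'c) \<Rightarrow> nat) \<Rightarrow>
    ('f \<Rightarrow> 'c, 'c) mpoly set \<Rightarrow> ('f, 'c) ind_fun set" where
  "cind D k W = {f.
     (\<forall>g. g \<notin> GL2 \<longrightarrow> f g = 0) \<and> (\<forall>g\<in>GL2. f g \<in> W) \<and>
     (\<forall>\<kappa>\<in>KZ D. \<forall>g\<in>GL2. f (\<kappa> ** g) = rho D k \<kappa> (f g)) \<and>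
     finite ((\<lambda>g. (\<lambda>\<kappa>. \<kappa> ** g) ` KZ D) ` {g \<in> GL2. f g \<noteq> 0})}"

definition elem :: "('p::prime_card, 'f::field, 'c::field) padic_data \<Rightarrow> (('f \<Rightarrow> 'c) \<Rightarrow> nat) \<Rightarrow>
    'f ^ 2 ^ 2 \<Rightarrow> ('f \<Rightarrow> 'c, 'c) mpoly \<Rightarrow> ('f, 'c) ind_fun" where
  "elem D k g v = (\<lambda>h. if h ** g \<in> KZ D then rho D k (h ** g) v else 0)"

text \<open>Sum of a family with finitely many nonzero terms.\<close>

definition fsum :: "'i set \<Rightarrow> ('i \<Rightarrow> 'a::comm_monoid_add) \<Rightarrow> 'a" where
  "fsum A t = (\<Sum>i\<in>{i \<in> A. t i \<noteq> 0}. t i)"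

definition cosets :: "('p::prime_card, 'f::field, 'c::field) padic_data \<Rightarrow> ('f ^ 2 ^ 2) set set" where
  "cosets D = (\<lambda>x. (\<lambda>\<kappa>. x ** \<kappa>) ` KZ D) ` GL2"

definition coset_rep :: "'a set \<Rightarrow> 'a" where
  "coset_rep c = (SOME x. x \<in> c)"

definition hecke_elem :: "('p::prime_card, 'f::field, 'c::field) padic_data \<Rightarrow>
    (('f \<Rightarrow> 'c) \<Rightarrow> nat) \<Rightarrow> 'f ^ 2 ^ 2 \<Rightarrow> ('f \<Rightarrow> 'c, 'c) mpoly \<Rightarrow> ('f, 'c) ind_fun" where
  "hecke_elem D k g v =
     (\<lambda>h. fsum (cosets D) (\<lambda>c. elem D k (g ** coset_rep c) (psi D k (matrix_inv (coset_rep c)) v) h))"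

text \<open>The linear extension of $[g, v] \mapsto$ \<^term>\<open>hecke_elem D k g v\<close>, using
  $f = \sum_{gKZ \in G/KZ} [g, f(g^{-1})]$.\<close>

definition hecke :: "('p::prime_card, 'f::field, 'c::field) padic_data \<Rightarrow>
    (('f \<Rightarrow> 'c) \<Rightarrow> nat) \<Rightarrow> ('f, 'c) ind_fun \<Rightarrow> ('f, 'c) ind_fun" where
  "hecke D k f = (\<lambda>h. fsum (cosets D) (\<lambda>c. hecke_elem D k (coset_rep c) (f (matrix_inv (coset_rep c))) h))"


section \<open>Supports\<close>

definition digits :: "('p::prime_card, 'f::field, 'c::field) padic_data \<Rightarrow> nat \<Rightarrow> 'f set" where
  "digits D n = {\<Sum>i<n. unif D ^ i * teich D (\<mu> i) | \<mu>. \<forall>i<n. \<mu> i \<in> residue_field D}"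

definition g0 :: "('p::prime_card, 'f::field, 'c::field) padic_data \<Rightarrow> nat \<Rightarrow> 'f \<Rightarrow> 'f ^ 2 ^ 2" where
  "g0 D n \<mu> = mat2 (unif D ^ n) \<mu> 0 1"

definition g1 :: "('p::prime_card, 'f::field, 'c::field) padic_data \<Rightarrow> nat \<Rightarrow> 'f \<Rightarrow> 'f ^ 2 ^ 2" where
  "g1 D n \<mu> = mat2 1 0 (unif D * \<mu>) (unif D ^ (n + 1))"

definition expansion :: "('p::prime_card, 'f::field, 'c::field) padic_data \<Rightarrow>
    (('f \<Rightarrow> 'c) \<Rightarrow> nat) \<Rightarrow> ('f, 'c) ind_fun \<Rightarrow>
    (nat \<times> 'f \<Rightarrow> ('f \<Rightarrow> 'c, 'c) mpoly) \<Rightarrow> (nat \<times> 'f \<Rightarrow> ('f \<Rightarrow> 'c, 'c) mpoly) \<Rightarrow> bool" where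
  "expansion D k f v0 v1 \<longleftrightarrow>
     (let J = (SIGMA n:UNIV. digits D n) in
        (\<forall>x\<in>J. v0 x \<in> Vk D k \<and> v1 x \<in> Vk D k) \<and>
        finite {x \<in> J. v0 x \<noteq> 0} \<and> finite {x \<in> J. v1 x \<noteq> 0} \<and>
        (\<forall>h. f h = fsum J (\<lambda>(n, \<mu>). elem D k (g0 D n \<mu>) (v0 (n, \<mu>)) h)
                 + fsum J (\<lambda>(n, \<mu>). elem D k (g1 D n \<mu>) (v1 (n, \<mu>)) h)))"

definition B_supp :: "('p::prime_card, 'f::field, 'c::field) padic_data \<Rightarrow>
    (('f \<Rightarrow> 'c) \<Rightarrow> nat) \<Rightarrow> int \<Rightarrow> ('f, 'c) ind_fun set" where
  "B_supp D k N = {f \<in> cind D k (Vk D k). \<exists>v0 v1. expansion D k f v0 v1 \<and>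
     (\<forall>n. \<forall>\<mu>\<in>digits D n. (int n > N \<longrightarrow> v0 (n, \<mu>) = 0) \<and> (int n > N - 1 \<longrightarrow> v1 (n, \<mu>) = 0))}"

text \<open>$B_N + \varpi^m\, \mathrm{ind}_{KZ}^G V_k^0$, where $\varpi^m$ acts through the embedding \<open>\<tau>\<close>.\<close>

definition B_plus :: "('p::prime_card, 'f::field, 'c::field) padic_data \<Rightarrow>
    (('f \<Rightarrow> 'c) \<Rightarrow> nat) \<Rightarrow> ('f \<Rightarrow> 'c) \<Rightarrow> int \<Rightarrow> int \<Rightarrow> ('f, 'c) ind_fun set" where
  "B_plus D k \<tau> N m =
     {\<lambda>g. b g + Const (\<tau> (unif D) powi m) * h g | b h. b \<in> B_supp D k N \<and> h \<in> cind D k (Vk0 D k)}"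

end

theory Submission
  imports Defs
begin

text \<open>On its support $\psi(g)$ is a constant multiple of $\rho_k(g)$, so $T$ is a sum over the neighbours
  of a vertex of the tree $G/KZ$. On the vertices below a given one, functions become families of
  polynomials $w$ of degree at most $k = dq$ in $z = y/x$, and $(T - a) f = 0$ reads
  $w_{\mathrm{parent}}(\varpi z - \lambda) = a w - \sum_{\lambda'} \varpi^k w_{\lambda'}((z + \lambda')/\varpi)$.
  One descends from the outer end of the support, working modulo $\varpi^n$.

  If all $w(\varpi z - \lambda)$ are integral, Hermite interpolation at the $q$ residues writes $w$ in powers of
  $(z^q - z)/\varpi$ and bounds the loss by $\varpi^{-d}$. That the loss does not accumulate rests on two
  points. The sum over the children only sees their leading coefficients $S_\lambda$, up to integral terms.
  In the recursion all coefficients of degree at least $2d$ on the left are integral, hence the rest has degree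
  less than $q$ (here $2d < q$ enters) and is determined by its values at the residues, where the recursion one
  level further out controls it. This bounds $w(\varpi z - \lambda)$ by $a^{-1}$ again, provided that the
  $S_\lambda$ are congruent to each other modulo $a^{-1}$; that congruence follows by comparing the coefficient of
  degree $d$ with the leading coefficient, and for $d = 1$, $v(a) = v(q) = 1$ by comparing the
  coefficients in between.\<close>

text \<open>The depth of the support of f is not bounded in terms of N, k and a, so a loss at every
  step of the descent, however small, is fatal: the bounds at a vertex must come out exactly as they
  were assumed further out. The invariant therefore carries, besides the bounds, a scalar g common
  to a whole level: modulo a^{-1}, the leading coefficient of a child is g \<pi>^d / a times that of
  its parent. Replacing the leading coefficients of siblings by this common value leaves errors of
  size a^{-1} only. Eliminating these errors between the degrees d and k of the recursion gives g =
  - (-1)^d / (1 - \<theta> g') with g' the scalar one level further out, a backward continued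
  fraction. The number \<theta> compares the sum of the (z + \<lambda>)^k with its interpolation
  polynomial at the residues; its valuation is positive except in the one case treated through power
  moments. The exponent is d + 1: d from Hermite interpolation and 1 as a bound for v(a), paid once
  at the vertex that is finally bounded and not along the way.\<close>

hide_const (open) up_ring.coeff up_ring.monom module.smult

section \<open>Balls of a valuation\<close>

text \<open>Values are real because C contains a square root of the image of \<varpi>, and because
  bounds by v(a), an arbitrary number in (0, 1], have to be mixed with powers of \<pi>. The same
  calculus serves Q_p, F and C.\<close>

locale valued_field =
  fixes v :: "'c::field \<Rightarrow> real"
  assumes valuation: "valuation v"
begin

definition vball :: "real \<Rightarrow> 'c set" where
  "vball t = {x. x = 0 \<or> t \<le> v x}"

definition pball :: "real \<Rightarrow> 'c poly set" where
  "pball t = {p. \<forall>i. coeff p i \<in> vball t}"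

lemma v_mult: "x \<noteq> 0 \<Longrightarrow> y \<noteq> 0 \<Longrightarrow> v (x * y) = v x + v y"
  using valuation by (simp add: valuation_def)

lemma v_add: "x \<noteq> 0 \<Longrightarrow> y \<noteq> 0 \<Longrightarrow> x + y \<noteq> 0 \<Longrightarrow> min (v x) (v y) \<le> v (x + y)"
  using valuation by (simp add: valuation_def)

lemma v_one: "v 1 = 0"
  using v_mult[of 1 1] by simp

lemma v_minus: "v (- x) = v x"
proof (cases "x = 0")
  case False
  have "v (- 1) + v (- 1) = 0"
    using v_mult[of "- 1" "- 1"] v_one by simp
  then have "v (- 1) = 0" by simp
  then show ?thesis using v_mult[of "- 1" x] False by simp
qed simp

lemma v_inverse: "x \<noteq> 0 \<Longrightarrow> v (inverse x) = - v x"
  using v_mult[of x "inverse x"] v_one by simp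

lemma v_divide: "x \<noteq> 0 \<Longrightarrow> y \<noteq> 0 \<Longrightarrow> v (x / y) = v x - v y"
  using v_mult[of x "inverse y"] v_inverse[of y] by (simp add: divide_inverse)

lemma v_power: "x \<noteq> 0 \<Longrightarrow> v (x ^ n) = real n * v x"
  by (induction n) (auto simp: v_one v_mult algebra_simps)

lemma ball_iff: "x \<noteq> 0 \<Longrightarrow> x \<in> vball t \<longleftrightarrow> t \<le> v x"
  by (simp add: vball_def)

lemma ballI: "t \<le> v x \<Longrightarrow> x \<in> vball t"
  by (simp add: vball_def)

lemma ball_zero [simp, intro]: "0 \<in> vball t"
  by (simp add: vball_def)

lemma ball_one [simp, intro]: "1 \<in> vball 0"
  by (simp add: vball_def v_one)

lemma ball_mono: "x \<in> vball s \<Longrightarrow> t \<le> s \<Longrightarrow> x \<in> vball t"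
  by (auto simp: vball_def)

lemma ball_add: "x \<in> vball t \<Longrightarrow> y \<in> vball t \<Longrightarrow> x + y \<in> vball t"
  using v_add[of x y] by (cases "x = 0"; cases "y = 0"; cases "x + y = 0") (auto simp: vball_def)

lemma ball_uminus_iff [simp]: "- x \<in> vball t \<longleftrightarrow> x \<in> vball t"
  by (simp add: vball_def v_minus)

lemma ball_diff: "x \<in> vball t \<Longrightarrow> y \<in> vball t \<Longrightarrow> x - y \<in> vball t"
  using ball_add[of x t "- y"] by simp

lemma ball_minus_commute: "x - y \<in> vball t \<longleftrightarrow> y - x \<in> vball t"
  using ball_uminus_iff[of "x - y" t] by simp

lemma ball_cong_diff: "x - y \<in> vball t \<Longrightarrow> x \<in> vball t \<longleftrightarrow> y \<in> vball t"
  using ball_add[of "x - y" t y] ball_diff[of x t "x - y"] by auto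

lemma ball_mult: "x \<in> vball s \<Longrightarrow> y \<in> vball t \<Longrightarrow> x * y \<in> vball (s + t)"
  by (cases "x = 0"; cases "y = 0") (auto simp: vball_def v_mult)

lemma ball_mult_le: "x \<in> vball s \<Longrightarrow> y \<in> vball t \<Longrightarrow> u \<le> s + t \<Longrightarrow> x * y \<in> vball u"
  using ball_mult ball_mono by blast

lemma ball_mult_cancel: "x \<noteq> 0 \<Longrightarrow> x * y \<in> vball (v x + t) \<longleftrightarrow> y \<in> vball t"
  by (cases "y = 0") (auto simp: vball_def v_mult)

lemma ball_mult_cancel': "x \<noteq> 0 \<Longrightarrow> x * y \<in> vball t \<longleftrightarrow> y \<in> vball (t - v x)"
  using ball_mult_cancel[of x y "t - v x"] by simp

lemma ball_divide: "x \<in> vball s \<Longrightarrow> y \<noteq> 0 \<Longrightarrow> x / y \<in> vball (s - v y)"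
  by (cases "x = 0") (auto simp: vball_def v_divide)

lemma ball_sum: "(\<And>i. i \<in> I \<Longrightarrow> f i \<in> vball t) \<Longrightarrow> sum f I \<in> vball t"
  by (induction I rule: infinite_finite_induct) (auto intro: ball_add)

lemma ball_prod: "(\<And>i. i \<in> I \<Longrightarrow> f i \<in> vball 0) \<Longrightarrow> prod f I \<in> vball 0"
  by (induction I rule: infinite_finite_induct) (auto intro: ball_mult_le[of _ 0 _ 0])

lemma ball_power: "x \<in> vball t \<Longrightarrow> x ^ n \<in> vball (real n * t)"
  by (cases "x = 0"; cases "n = 0") (auto simp: vball_def v_power v_one mult_left_mono zero_power)

lemma ball_power0: "x \<in> vball 0 \<Longrightarrow> x ^ n \<in> vball 0"
  using ball_power[of x 0 n] by simp

lemma ball_of_nat [simp]: "of_nat n \<in> vball 0"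
  by (induction n) (auto intro: ball_add)

lemma ball_eq_zero: "(\<And>n. x \<in> vball (real n)) \<Longrightarrow> x = 0"
  by (rule ccontr) (metis ball_iff linorder_not_le reals_Archimedean2)

text \<open>Ultrametric principle: a perturbation smaller than x changes neither its non-vanishing
  nor its valuation. It turns congruences with a unit into the statement of being a unit.\<close>

lemma v_eq_if_diff:
  assumes "x \<noteq> 0" "x - y \<in> vball t" "v x < t"
  shows "y \<noteq> 0 \<and> v y = v x"
proof -
  have y: "y \<noteq> 0" using assms by (auto simp: vball_def)
  have "y \<in> vball (v x)"
    using ball_diff[of x "v x" "x - y"] ball_mono[OF assms(2), of "v x"] assms(1,3)
    by (simp add: vball_def)
  moreover have False if "v x < v y"
  proof -
    have "x \<in> vball (min t (v y))"
      using ball_add[of "x - y" "min t (v y)" y] ball_mono[OF assms(2), of "min t (v y)"] by (simp add: vball_def)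
    then show False using assms that by (simp add: vball_def)
  qed
  ultimately show ?thesis using y by (force simp: vball_def)
qed

lemma power_cong_ball:
  assumes "x \<in> vball 0" "y \<in> vball 0" "x - y \<in> vball t"
  shows "x ^ n - y ^ n \<in> vball t"
proof (induction n)
  case (Suc n)
  have "x ^ Suc n - y ^ Suc n = x * (x ^ n - y ^ n) + (x - y) * y ^ n" by (simp add: algebra_simps)
  moreover have "x * (x ^ n - y ^ n) \<in> vball t" by (rule ball_mult_le[OF assms(1) Suc.IH]) simp
  moreover have "(x - y) * y ^ n \<in> vball t" by (rule ball_mult_le[OF assms(3) ball_power0[OF assms(2)]]) simp
  ultimately show ?case by (simp add: ball_add)
qed simp

lemma mult_cong_ball:
  assumes "x \<in> vball 0" "y' \<in> vball 0" "x - x' \<in> vball t" "y - y' \<in> vball t"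
  shows "x * y - x' * y' \<in> vball t"
proof -
  have "x * y - x' * y' = x * (y - y') + (x - x') * y'" by (simp add: algebra_simps)
  moreover have "x * (y - y') \<in> vball t" "(x - x') * y' \<in> vball t"
    using ball_mult_le[OF assms(1,4)] ball_mult_le[OF assms(3,2)] by auto
  ultimately show ?thesis by (simp add: ball_add)
qed

lemma prod_cong_ball:
  assumes "\<And>i. i \<in> I \<Longrightarrow> f i \<in> vball 0" "\<And>i. i \<in> I \<Longrightarrow> g i \<in> vball 0"
    "\<And>i. i \<in> I \<Longrightarrow> f i - g i \<in> vball t"
  shows "prod f I - prod g I \<in> vball t"
  using assms
proof (induction I rule: infinite_finite_induct)
  case (insert i I)
  show ?case
    unfolding prod.insert[OF insert.hyps]
    by (rule mult_cong_ball) (use insert in \<open>auto intro!: ball_prod\<close>)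
qed auto

lemma pballD: "p \<in> pball t \<Longrightarrow> coeff p i \<in> vball t"
  by (simp add: pball_def)

lemma pballI: "(\<And>i. coeff p i \<in> vball t) \<Longrightarrow> p \<in> pball t"
  by (simp add: pball_def)

lemma pball_zero [simp, intro]: "0 \<in> pball t"
  by (simp add: pball_def)

lemma pball_one [simp, intro]: "1 \<in> pball 0"
  by (auto simp: pball_def coeff_1)

lemma pball_mono: "p \<in> pball s \<Longrightarrow> t \<le> s \<Longrightarrow> p \<in> pball t"
  unfolding pball_def using ball_mono by blast

lemma pball_add: "p \<in> pball t \<Longrightarrow> r \<in> pball t \<Longrightarrow> p + r \<in> pball t"
  by (simp add: pball_def ball_add)

lemma pball_diff: "p \<in> pball t \<Longrightarrow> r \<in> pball t \<Longrightarrow> p - r \<in> pball t"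
  by (simp add: pball_def ball_diff)

lemma pball_cong_diff: "p - r \<in> pball t \<Longrightarrow> p \<in> pball t \<longleftrightarrow> r \<in> pball t"
  using pball_add[of "p - r" t r] pball_diff[of p t "p - r"] by auto

lemma pball_sum: "(\<And>i. i \<in> I \<Longrightarrow> f i \<in> pball t) \<Longrightarrow> sum f I \<in> pball t"
  by (induction I rule: infinite_finite_induct) (auto intro: pball_add)

lemma pball_smult: "c \<in> vball s \<Longrightarrow> p \<in> pball t \<Longrightarrow> u \<le> s + t \<Longrightarrow> smult c p \<in> pball u"
  by (auto simp: pball_def intro: ball_mult_le)

lemma pball_mult:
  assumes "p \<in> pball s" "r \<in> pball t" "u \<le> s + t"
  shows "p * r \<in> pball u"
  unfolding pball_def coeff_mult mem_Collect_eq
  by (intro allI ball_sum ball_mult_le[OF _ _ assms(3)]) (use assms in \<open>auto simp: pball_def\<close>)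

lemma pball_power: "p \<in> pball 0 \<Longrightarrow> p ^ n \<in> pball 0"
  by (induction n) (auto intro: pball_mult[of _ 0 _ 0])

lemma pball_prod: "(\<And>i. i \<in> I \<Longrightarrow> f i \<in> pball 0) \<Longrightarrow> prod f I \<in> pball 0"
  by (induction I rule: infinite_finite_induct) (auto intro: pball_mult[of _ 0 _ 0])

lemma pball_pCons [simp]: "pCons c p \<in> pball t \<longleftrightarrow> c \<in> vball t \<and> p \<in> pball t"
  unfolding pball_def by (auto simp: coeff_pCons split: nat.splits)

lemma pball_power_cong:
  assumes "p \<in> pball 0" "r \<in> pball 0" "p - r \<in> pball t"
  shows "p ^ n - r ^ n \<in> pball t"
proof (induction n)
  case (Suc n)
  have "p ^ Suc n - r ^ Suc n = p * (p ^ n - r ^ n) + (p - r) * r ^ n" by (simp add: algebra_simps)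
  moreover have "p * (p ^ n - r ^ n) \<in> pball t" by (rule pball_mult[OF assms(1) Suc.IH]) simp
  moreover have "(p - r) * r ^ n \<in> pball t" by (rule pball_mult[OF assms(3) pball_power[OF assms(2)]]) simp
  ultimately show ?case by (simp add: pball_add)
qed simp

lemma pball_pcompose:
  assumes "p \<in> pball t" "r \<in> pball 0"
  shows "pcompose p r \<in> pball t"
  using assms
proof (induction p)
  case (pCons c p)
  then show ?case by (auto simp: pcompose_pCons intro!: pball_add pball_mult[of r 0 _ t])
qed simp

lemma poly_ball:
  assumes "p \<in> pball t" "x \<in> vball 0"
  shows "poly p x \<in> vball t"
  unfolding poly_altdef
  by (intro ball_sum ball_mult_le[of _ t _ 0]) (use assms in \<open>auto simp: pball_def ball_power0\<close>)

lemma coeff_pcompose_scale: "coeff (pcompose (p :: 'c poly) [:0, c:]) i = c ^ i * coeff p i"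
  by (induction p arbitrary: i) (auto simp: pcompose_pCons coeff_pCons algebra_simps split: nat.splits)

lemma pcompose_shift_scale: "pcompose (p :: 'c poly) [:x, c:] = pcompose (pcompose p [:x, 1:]) [:0, c:]"
  by (simp add: pcompose_assoc[symmetric] pcompose_pCons)

text \<open>Translation by an integral x preserves the bound, and scaling by c multiplies the
  coefficient of degree i by c^i. This gain growing with the degree is what makes the high
  coefficients of the recursion integral.\<close>

lemma coeff_pcompose_linear_ball:
  assumes "p \<in> pball t" "x \<in> vball 0" "c \<in> vball 1"
  shows "coeff (pcompose p [:x, c:]) i \<in> vball (t + real i)"
proof -
  have "pcompose p [:x, 1:] \<in> pball t" by (rule pball_pcompose) (use assms in auto)
  then have "c ^ i * coeff (pcompose p [:x, 1:]) i \<in> vball (t + real i)"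
    using ball_power[OF assms(3), of i] by (intro ball_mult_le[of _ "real i * 1" _ t]) (auto simp: pball_def)
  then show ?thesis by (simp add: pcompose_shift_scale[of p x c] coeff_pcompose_scale)
qed

text \<open>Newton interpolation: with p = p(a) + (z - a) r, the values of r at the remaining nodes
  are divided differences with unit denominators, so no precision is lost while the degree
  drops.\<close>

lemma pball_interpolation:
  assumes "finite X" "X \<subseteq> vball 0" "\<And>x y. x \<in> X \<Longrightarrow> y \<in> X \<Longrightarrow> x \<noteq> y \<Longrightarrow> v (x - y) = 0"
    and "degree p < card X" "\<And>x. x \<in> X \<Longrightarrow> poly p x \<in> vball t"
  shows "p \<in> pball t"
  using assms
proof (induction X arbitrary: p rule: finite_induct)
  case (insert a X)
  define r where "r = synthetic_div p a"
  have p: "p = [:poly p a:] + [:- a, 1:] * r"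
    using synthetic_div_correct'[of a p] unfolding r_def by (metis add.commute)
  have pa: "poly p a \<in> vball t" and a: "a \<in> vball 0" using insert.prems by auto
  have r: "r \<in> pball t"
  proof (cases "r = 0")
    case False
    then have "degree p = Suc (degree r)"
      using p by (metis add.commute degree_0 degree_pCons_eq_if degree_synthetic_div r_def synthetic_div_eq_0_iff Suc_pred gr0I diff_Suc_1)
    then have d: "degree r < card X" using insert by simp
    show ?thesis
    proof (rule insert.IH)
      fix x assume x: "x \<in> X"
      then have ne: "x - a \<noteq> 0" using insert.hyps by auto
      have v: "v (x - a) = 0" using insert.prems(2)[of x a] x insert.hyps by auto
      have "(x - a) * poly r x = poly p x - poly p a"
        using arg_cong[OF p, of "\<lambda>p. poly p x"] by (simp add: algebra_simps)
      then have "(x - a) * poly r x \<in> vball t"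
        using x insert.prems by (simp add: ball_diff)
      then show "poly r x \<in> vball t" using ball_mult_cancel'[OF ne] v by simp
    qed (use d insert.prems in auto)
  qed simp
  have "[:- a, 1:] * r \<in> pball t" by (rule pball_mult[of _ 0 _ t]) (use a r in auto)
  then show ?case using pa by (subst p) (auto intro!: pball_add)
qed simp

end

lemma coeff_mult_top:
  fixes p r :: "'a::comm_semiring_1 poly"
  assumes "degree p \<le> m" "degree r \<le> n"
  shows "coeff (p * r) (m + n) = coeff p m * coeff r n"
proof -
  have "coeff (p * r) (m + n) = (\<Sum>i\<le>m + n. if i = m then coeff p m * coeff r n else 0)"
    unfolding coeff_mult
  proof (rule sum.cong[OF refl])
    fix i assume i: "i \<in> {..m + n}"
    show "coeff p i * coeff r (m + n - i) = (if i = m then coeff p m * coeff r n else 0)"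
    proof (cases i m rule: linorder_cases)
      case less
      then have "coeff r (m + n - i) = 0" using assms by (intro coeff_eq_0) auto
      then show ?thesis using less by simp
    next
      case greater
      then have "coeff p i = 0" using assms by (intro coeff_eq_0) auto
      then show ?thesis using greater by simp
    qed simp
  qed
  then show ?thesis by simp
qed

lemma degree_ltI: "0 < n \<Longrightarrow> (\<And>i. n \<le> i \<Longrightarrow> coeff p i = 0) \<Longrightarrow> degree p < n"
  by (rule degree_lessI) auto

lemma coeff_linear_poly_power':
  fixes a b :: "'a::comm_ring_1"
  shows "coeff ([:a, b:] ^ n) i = of_nat (n choose i) * b ^ i * a ^ (n - i)"
proof (cases "i \<le> n")
  case False
  have "degree ([:a, b:] ^ n) \<le> 1 * n"
    by (rule order.trans[OF degree_power_le]) simp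
  then show ?thesis using False by (simp add: coeff_eq_0 binomial_eq_0)
qed (rule coeff_linear_poly_power)

section \<open>Residue systems\<close>

text \<open>\<open>A\<close> plays the ring of integers of F inside the ambient field. It is kept
  apart from the whole valuation ring \<open>vball 0\<close>, because C may have a larger residue
  field and fractional valuations: only elements of \<open>A\<close> have a representative in
  \<open>\<Lambda>\<close>. The representatives are arbitrary, so the locale is available before
  Teichmueller representatives are known to exist.\<close>

locale residue_system = valued_field v for v :: "'c::field \<Rightarrow> real" +
  fixes \<pi> :: 'c and A :: "'c set" and \<Lambda> :: "'c set"
  assumes pi_nonzero: "\<pi> \<noteq> 0" and v_pi: "v \<pi> = 1"
    and A_one: "1 \<in> A" and A_add: "\<And>x y. x \<in> A \<Longrightarrow> y \<in> A \<Longrightarrow> x + y \<in> A"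
    and A_uminus: "\<And>x. x \<in> A \<Longrightarrow> - x \<in> A"
    and A_mult: "\<And>x y. x \<in> A \<Longrightarrow> y \<in> A \<Longrightarrow> x * y \<in> A"
    and A_integral: "A \<subseteq> vball 0"
    and A_discrete: "\<And>x. x \<in> A \<Longrightarrow> x \<noteq> 0 \<Longrightarrow> v x \<in> \<int>"
    and reps_finite: "finite \<Lambda>" and reps_sub: "\<Lambda> \<subseteq> A"
    and reps_cover: "\<And>x. x \<in> A \<Longrightarrow> \<exists>l\<in>\<Lambda>. x - l \<in> vball 1"
    and reps_distinct: "\<And>l l'. l \<in> \<Lambda> \<Longrightarrow> l' \<in> \<Lambda> \<Longrightarrow> l - l' \<in> vball 1 \<Longrightarrow> l = l'"
    and card_reps_ge: "3 \<le> card \<Lambda>"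
begin

abbreviation q :: nat where "q \<equiv> card \<Lambda>"

lemma pi_ball [simp]: "\<pi> \<in> vball 1"
  by (simp add: vball_def v_pi)

lemma pi_ball0 [simp]: "\<pi> \<in> vball 0"
  by (simp add: vball_def v_pi)

lemma pi_mult_ball: "\<pi> * x \<in> vball t \<longleftrightarrow> x \<in> vball (t - 1)"
  using ball_mult_cancel'[OF pi_nonzero] v_pi by simp

lemma pi_power_mult_ball: "\<pi> ^ n * x \<in> vball t \<longleftrightarrow> x \<in> vball (t - real n)"
  using ball_mult_cancel'[of "\<pi> ^ n"] v_power[OF pi_nonzero] v_pi pi_nonzero by simp

lemma A_ball: "x \<in> A \<Longrightarrow> x \<in> vball 0"
  using A_integral by auto

lemma A_diff: "x \<in> A \<Longrightarrow> y \<in> A \<Longrightarrow> x - y \<in> A"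
  using A_add[of x "- y"] A_uminus by simp

lemma A_power: "x \<in> A \<Longrightarrow> x ^ n \<in> A"
  by (induction n) (auto simp: A_one A_mult)

lemma A_of_nat: "of_nat n \<in> A"
  by (induction n) (use A_diff[OF A_one A_one] in \<open>auto simp: A_one A_add\<close>)

lemma rep_A: "l \<in> \<Lambda> \<Longrightarrow> l \<in> A"
  using reps_sub by auto

lemma rep_ball: "l \<in> \<Lambda> \<Longrightarrow> l \<in> vball 0"
  using A_ball rep_A by auto

lemma A_unit:
  assumes "x \<in> A" "x \<notin> vball 1"
  shows "x \<noteq> 0 \<and> v x = 0"
proof -
  have nz: "x \<noteq> 0" using assms(2) by auto
  have "0 \<le> v x" using A_ball[OF assms(1)] nz by (simp add: vball_def)
  moreover obtain z where "v x = of_int z" using A_discrete[OF assms(1) nz] by (auto elim: Ints_cases)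
  moreover have "v x < 1" using assms(2) by (simp add: vball_def)
  ultimately show ?thesis using nz by simp
qed

lemma reps_diff_unit: "l \<in> \<Lambda> \<Longrightarrow> l' \<in> \<Lambda> \<Longrightarrow> l \<noteq> l' \<Longrightarrow> v (l - l') = 0"
  using A_unit[OF A_diff[OF rep_A rep_A]] reps_distinct by blast

lemma interpolation:
  assumes "degree p < q" "\<And>l. l \<in> \<Lambda> \<Longrightarrow> poly p (- l) \<in> vball t"
  shows "p \<in> pball t"
proof (rule pball_interpolation[of "uminus ` \<Lambda>"])
  have inj: "inj_on uminus \<Lambda>" by (simp add: inj_on_def)
  show "degree p < card (uminus ` \<Lambda>)" using assms(1) by (simp add: card_image[OF inj])
  show "v (x - y) = 0" if "x \<in> uminus ` \<Lambda>" "y \<in> uminus ` \<Lambda>" "x \<noteq> y" for x y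
    using that reps_diff_unit by auto
qed (use assms rep_ball reps_finite in auto)

lemma interpolation_reps:
  assumes "degree p < q" "\<And>l. l \<in> \<Lambda> \<Longrightarrow> poly p l \<in> vball t"
  shows "p \<in> pball t"
  by (rule pball_interpolation[of \<Lambda>]) (use assms rep_ball reps_finite reps_diff_unit in auto)

section \<open>Congruences modulo the maximal ideal: Fermat, binomial coefficients, power
  sums\<close>

lemma unit_permutes:
  assumes "u \<in> A" "u \<notin> vball 1"
  obtains s where "bij_betw s \<Lambda> \<Lambda>" "\<And>l. l \<in> \<Lambda> \<Longrightarrow> u * l - s l \<in> vball 1"
proof -
  have "\<forall>l\<in>\<Lambda>. \<exists>l'\<in>\<Lambda>. u * l - l' \<in> vball 1" using assms rep_A A_mult reps_cover by blast
  then obtain s where s: "\<And>l. l \<in> \<Lambda> \<Longrightarrow> s l \<in> \<Lambda> \<and> u * l - s l \<in> vball 1" by metis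
  have "inj_on s \<Lambda>"
  proof (rule inj_onI)
    fix l l' assume l: "l \<in> \<Lambda>" "l' \<in> \<Lambda>" "s l = s l'"
    have "(u * l - s l) - (u * l' - s l') \<in> vball 1" using s l ball_diff by blast
    then have "u * (l - l') \<in> vball 1" using l by (simp add: algebra_simps)
    then have "l - l' \<in> vball 1" using A_unit[OF assms] ball_mult_cancel'[of u] by simp
    then show "l = l'" using l reps_distinct by simp
  qed
  then have "bij_betw s \<Lambda> \<Lambda>"
    using s endo_inj_surj[OF reps_finite, of s] by (simp add: bij_betw_def image_subset_iff)
  then show ?thesis using s that by blast
qed

text \<open>Fermat's argument: u permutes the nonzero classes, so their product P, a unit, satisfies
  u^(q - 1) P = P modulo \<pi>. Working with representatives avoids making the residue classes into
  a field.\<close>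

lemma unit_power:
  assumes u: "u \<in> A" "u \<notin> vball 1"
  shows "u ^ (q - 1) - 1 \<in> vball 1"
proof -
  obtain s where s: "bij_betw s \<Lambda> \<Lambda>" "\<And>l. l \<in> \<Lambda> \<Longrightarrow> u * l - s l \<in> vball 1"
    using unit_permutes[OF u] by blast
  obtain z where z: "z \<in> \<Lambda>" "z \<in> vball 1"
    using reps_cover[of 0] A_diff[OF A_one A_one] by auto
  have zu: "l = z" if "l \<in> \<Lambda>" "l \<in> vball 1" for l
    using reps_distinct[of l z] ball_diff that z by blast
  let ?U = "\<Lambda> - {z}"
  have sz: "s z = z"
  proof (rule zu)
    show "s z \<in> \<Lambda>" using s z by (auto simp: bij_betw_def)
    have "u * z \<in> vball 1" using ball_mult[OF A_ball[OF u(1)] z(2)] by simp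
    then show "s z \<in> vball 1" using s(2)[OF z(1)] ball_cong_diff by blast
  qed
  have bij: "bij_betw s ?U ?U"
    using bij_betw_DiffI[OF s(1), of "{z}" "{z}"] z sz by (simp add: bij_betw_def)
  let ?P = "prod (\<lambda>l. l) ?U"
  have "(\<Prod>l\<in>?U. u * l) - (\<Prod>l\<in>?U. s l) \<in> vball 1"
  proof (rule prod_cong_ball)
    fix l assume l: "l \<in> ?U"
    show "u * l \<in> vball 0" using A_ball A_mult u rep_A l by auto
    show "s l \<in> vball 0" using bij l rep_ball by (auto simp: bij_betw_def)
    show "u * l - s l \<in> vball 1" using s l by auto
  qed
  moreover have "(\<Prod>l\<in>?U. s l) = ?P" by (rule prod.reindex_bij_betw[OF bij])
  moreover have "(\<Prod>l\<in>?U. u * l) = u ^ (q - 1) * ?P"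
    using z by (simp add: prod.distrib reps_finite)
  ultimately have "?P * (u ^ (q - 1) - 1) \<in> vball 1" by (simp add: algebra_simps)
  moreover have "?P \<noteq> 0 \<and> v ?P = 0"
  proof -
    have "prod (\<lambda>l. l) U \<noteq> 0 \<and> v (prod (\<lambda>l. l) U) = 0" if "finite U" "\<forall>l\<in>U. l \<noteq> 0 \<and> v l = 0" for U
      using that by (induction U rule: finite_induct) (auto simp: v_one v_mult)
    moreover have "\<forall>l\<in>?U. l \<noteq> 0 \<and> v l = 0" using A_unit rep_A zu by blast
    ultimately show ?thesis using reps_finite by blast
  qed
  ultimately show ?thesis using ball_mult_cancel'[of ?P] by simp
qed

lemma frobenius:
  assumes "x \<in> A"
  shows "x ^ q - x \<in> vball 1"
proof -
  have e: "x ^ q - x = x * (x ^ (q - 1) - 1)"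
    using card_reps_ge by (cases q) (auto simp: algebra_simps)
  show ?thesis
  proof (cases "x \<in> vball 1")
    case True
    have "x ^ (q - 1) - 1 \<in> vball 0" by (intro ball_diff ball_power0 A_ball assms ball_one)
    then show ?thesis unfolding e by (rule ball_mult_le[OF True]) simp
  next
    case False
    show ?thesis unfolding e using ball_mult[OF A_ball[OF assms] unit_power[OF assms False]] by simp
  qed
qed

lemma frobenius_power:
  assumes "x \<in> A"
  shows "x ^ (d * q) - x ^ d \<in> vball 1"
proof -
  have "(x ^ q) ^ d - x ^ d \<in> vball 1"
    by (intro power_cong_ball frobenius assms ball_power0 A_ball)
  then show ?thesis by (simp add: power_mult[symmetric] mult.commute)
qed

text \<open>Both sides agree at all residues by \<open>frobenius\<close> and their leading terms
  cancel, so interpolation compares the coefficients. The divisibility of the binomial coefficients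
  follows without knowing that q is a prime power.\<close>

lemma linear_power_cong: "[:1, 1:] ^ q - (monom 1 q + 1) \<in> pball 1"
proof (rule interpolation_reps)
  show "degree ([:1, 1:] ^ q - (monom 1 q + 1) :: 'c poly) < q"
  proof (rule degree_ltI)
    fix i assume "q \<le> i"
    then show "coeff ([:1, 1:] ^ q - (monom 1 q + 1) :: 'c poly) i = 0"
      using card_reps_ge by (cases "i = q") (auto simp: coeff_linear_power coeff_eq_0 degree_linear_power)
  qed (use card_reps_ge in simp)
  fix l assume l: "l \<in> \<Lambda>"
  have "((l + 1) ^ q - (l + 1)) - (l ^ q - l) \<in> vball 1"
    by (intro ball_diff frobenius A_add rep_A l A_one)
  then show "poly ([:1, 1:] ^ q - (monom 1 q + 1)) l \<in> vball 1"
    by (simp add: poly_monom algebra_simps)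
qed

lemma binomial_ball: "0 < i \<Longrightarrow> i < q \<Longrightarrow> of_nat (q choose i) \<in> vball 1"
  using pballD[OF linear_power_cong, of i] by (auto simp: coeff_linear_poly_power)

lemma q_ball: "of_nat q \<in> vball 1"
  using binomial_ball[of 1] card_reps_ge by simp

text \<open>Modulo \<pi> the polynomial (1 + z)^(d q) is (1 + z^q)^d, in which only multiples of q
  occur as exponents.\<close>

lemma binomial_multiple_ball:
  assumes "\<not> q dvd i"
  shows "of_nat ((d * q) choose i) \<in> vball 1"
proof -
  have z: "coeff ((monom 1 q + 1) ^ d :: 'c poly) i = 0" if "\<not> q dvd i" for i
    using that
  proof (induction d arbitrary: i)
    case (Suc d)
    have "(monom 1 q + 1) ^ Suc d = monom 1 q * (monom 1 q + 1) ^ d + (monom 1 q + 1 :: 'c poly) ^ d"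
      by (simp add: algebra_simps)
    moreover have "\<not> q dvd (i - q)" if "q \<le> i" using Suc.prems that by (simp add: dvd_minus_self)
    ultimately show ?case using Suc by (auto simp: coeff_monom_mult simp del: power_Suc)
  qed (auto simp: coeff_1 intro: gr0I)
  have "([:1, 1:] ^ q) ^ d - (monom 1 q + 1) ^ d \<in> pball 1"
  proof (rule pball_power_cong)
    show "[:1, 1:] ^ q \<in> pball 0" by (rule pball_power) simp
    show "monom 1 q + 1 \<in> pball 0" by (rule pball_add) (auto simp: pball_def)
  qed (rule linear_power_cong)
  from pballD[OF this, of i] have "coeff ([:1, 1:] ^ (d * q)) i \<in> vball 1"
    using z[OF assms] by (simp add: power_mult[symmetric] mult.commute)
  then show ?thesis
    by (cases "i \<le> d * q") (auto simp: coeff_linear_poly_power binomial_eq_0)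
qed

text \<open>For i > 0, choose u with u^i - 1 a unit; multiplication by u permutes the summands, so
  the sum is killed by u^i - 1 modulo \<pi>.\<close>

lemma power_sum_ball:
  assumes "i \<le> q - 2"
  shows "(\<Sum>l\<in>\<Lambda>. l ^ i) \<in> vball 1"
proof (cases "i = 0")
  case True
  then show ?thesis using q_ball by simp
next
  case False
  \<comment> \<open>Otherwise z^(i + 1) - z would vanish modulo \<pi> at all q residues although its
    degree is below q, so its leading coefficient 1 would lie in the maximal ideal.\<close>
  have "\<exists>u\<in>\<Lambda>. u \<notin> vball 1 \<and> u ^ i - 1 \<notin> vball 1"
  proof (rule ccontr)
    assume "\<not> ?thesis"
    then have *: "u \<in> vball 1 \<or> u ^ i - 1 \<in> vball 1" if "u \<in> \<Lambda>" for u using that by blast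
    have "monom 1 (Suc i) - monom 1 1 \<in> pball 1"
    proof (rule interpolation_reps)
      show "degree (monom 1 (Suc i) - monom 1 1 :: 'c poly) < q"
        by (rule degree_ltI) (use assms card_reps_ge in auto)
      fix u assume u: "u \<in> \<Lambda>"
      have "u * (u ^ i - 1) \<in> vball 1"
        using *[OF u]
      proof
        assume "u \<in> vball 1"
        then show ?thesis by (rule ball_mult_le[of _ 1 _ 0]) (auto intro!: ball_diff ball_power0 rep_ball[OF u])
      next
        assume "u ^ i - 1 \<in> vball 1"
        then show ?thesis by (rule ball_mult_le[OF rep_ball[OF u]]) simp
      qed
      then show "poly (monom 1 (Suc i) - monom 1 1) u \<in> vball 1"
        by (simp add: poly_monom algebra_simps)
    qed
    from pballD[OF this, of "Suc i"] have "1 \<in> vball 1" using False by simp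
    then show False by (simp add: vball_def v_one)
  qed
  then obtain u where u: "u \<in> \<Lambda>" "u \<notin> vball 1" "u ^ i - 1 \<notin> vball 1" by blast
  obtain s where s: "bij_betw s \<Lambda> \<Lambda>" "\<And>l. l \<in> \<Lambda> \<Longrightarrow> u * l - s l \<in> vball 1"
    using unit_permutes[OF rep_A[OF u(1)] u(2)] by blast
  have "(\<Sum>l\<in>\<Lambda>. (u * l) ^ i - (s l) ^ i) \<in> vball 1"
  proof (intro ball_sum power_cong_ball s(2))
    fix l assume l: "l \<in> \<Lambda>"
    show "u * l \<in> vball 0" using A_ball A_mult rep_A u l by blast
    show "s l \<in> vball 0" using s l rep_ball by (auto simp: bij_betw_def)
  qed auto
  moreover have "(\<Sum>l\<in>\<Lambda>. (s l) ^ i) = (\<Sum>l\<in>\<Lambda>. l ^ i)"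
    by (rule sum.reindex_bij_betw[OF s(1), of "\<lambda>l. l ^ i"])
  ultimately have "(u ^ i - 1) * (\<Sum>l\<in>\<Lambda>. l ^ i) \<in> vball 1"
    by (simp add: sum_subtractf power_mult_distrib sum_distrib_left algebra_simps)
  then show ?thesis
    using A_unit[OF A_diff[OF A_power[OF rep_A[OF u(1)]] A_one] u(3)] ball_mult_cancel'[of "u ^ i - 1"] by simp
qed

section \<open>Hermite interpolation\<close>

definition down :: "'c \<Rightarrow> 'c poly \<Rightarrow> 'c poly" where
  "down l p = pcompose p [:- l, \<pi>:]"

definition \<phi> :: "'c poly" where
  "\<phi> = (\<Prod>l\<in>\<Lambda>. [:l, 1:])"

text \<open>This is \<phi>(\<pi> z - l) / \<pi>: the factor of index l becomes \<pi> z and gives up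
  its \<pi>.\<close>

definition \<phi>_down :: "'c \<Rightarrow> 'c poly" where
  "\<phi>_down l = [:0, 1:] * (\<Prod>l'\<in>\<Lambda> - {l}. [:l' - l, \<pi>:])"

lemma down_add: "down l (p + r) = down l p + down l r"
  and down_diff: "down l (p - r) = down l p - down l r"
  and down_mult: "down l (p * r) = down l p * down l r"
  and down_smult: "down l (smult c p) = smult c (down l p)"
  by (auto simp: down_def pcompose_add pcompose_diff pcompose_mult pcompose_smult)

lemma coeff_down_0: "coeff (down l p) 0 = poly p (- l)"
  by (simp add: down_def flip: poly_0_coeff_0) (simp add: poly_pcompose)

lemma coeff_down_ball:
  assumes "p \<in> pball t" "l \<in> \<Lambda>"
  shows "coeff (down l p) i \<in> vball (t + real i)"
  unfolding down_def by (rule coeff_pcompose_linear_ball) (use assms rep_ball in auto)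

lemma degree_\<phi>: "degree \<phi> = q"
  unfolding \<phi>_def by (subst degree_prod_eq_sum_degree) auto

lemma lead_coeff_\<phi>: "coeff \<phi> q = 1"
proof -
  have "lead_coeff \<phi> = 1" unfolding \<phi>_def lead_coeff_prod by simp
  then show ?thesis by (simp add: degree_\<phi>)
qed

lemma \<phi>_nonzero: "\<phi> \<noteq> 0"
  using lead_coeff_\<phi> by auto

lemma poly_\<phi>: "l \<in> \<Lambda> \<Longrightarrow> poly \<phi> (- l) = 0"
  using reps_finite by (auto simp: \<phi>_def poly_prod intro!: prod_zero)

lemma \<phi>_integral: "\<phi> \<in> pball 0"
  unfolding \<phi>_def by (rule pball_prod) (auto simp: rep_ball)

lemma \<phi>_cong: "\<phi> - (monom 1 q - monom 1 1) \<in> pball 1"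
proof (rule interpolation)
  show "degree (\<phi> - (monom 1 q - monom 1 1)) < q"
  proof (rule degree_ltI)
    fix i assume "q \<le> i"
    then show "coeff (\<phi> - (monom 1 q - monom 1 1)) i = 0"
      using card_reps_ge by (cases "i = q") (auto simp: lead_coeff_\<phi> degree_\<phi> coeff_eq_0)
  qed (use card_reps_ge in simp)
  fix l assume "l \<in> \<Lambda>"
  then show "poly (\<phi> - (monom 1 q - monom 1 1)) (- l) \<in> vball 1"
    using frobenius[OF A_uminus[OF rep_A]] ball_uminus_iff[of "(- l) ^ q - (- l)" 1]
    by (simp add: poly_\<phi> poly_monom del: ball_uminus_iff)
qed

lemma coeff_\<phi>_ball: "i \<noteq> 1 \<Longrightarrow> i \<noteq> q \<Longrightarrow> coeff \<phi> i \<in> vball 1"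
  using pballD[OF \<phi>_cong, of i] by simp

lemma down_\<phi>: "l \<in> \<Lambda> \<Longrightarrow> down l \<phi> = smult \<pi> (\<phi>_down l)"
  unfolding down_def \<phi>_def \<phi>_down_def pcompose_prod
  using reps_finite by (subst prod.remove[of \<Lambda> l]) (auto simp: pcompose_pCons)

lemma \<phi>_down_0: "coeff (\<phi>_down l) 0 = 0"
  by (simp add: \<phi>_down_def)

text \<open>Expanding the product alone gives \<pi>^(i - 1) in degree i, one factor short for i = 2.
  Comparison of \<phi> with z^q - z produces the extra factor \<open>q choose i\<close>; its linear
  term gives the analogue of Wilson's theorem, that the product of the l' - l over l' \<noteq> l is
  -1 modulo \<pi>.\<close>

lemma coeff_\<phi>_down:
  assumes l: "l \<in> \<Lambda>"
  shows "coeff (\<phi>_down l) 1 + 1 \<in> vball 1" and "2 \<le> i \<Longrightarrow> coeff (\<phi>_down l) i \<in> vball 2"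
proof -
  let ?r = "\<phi> - (monom 1 q - monom 1 1)"
  have e: "\<pi> * coeff (\<phi>_down l) i = of_nat (q choose i) * \<pi> ^ i * (- l) ^ (q - i)
      - coeff [:- l, \<pi>:] i + coeff (down l ?r) i" for i
  proof -
    have "\<phi> = monom 1 q - monom 1 1 + ?r" by simp
    then have "down l \<phi> = down l (monom 1 q) - down l (monom 1 1) + down l ?r"
      by (metis down_add down_diff)
    moreover have "down l (monom 1 q) = [:- l, \<pi>:] ^ q" "down l (monom 1 1) = [:- l, \<pi>:]"
      by (auto simp: down_def monom_altdef pcompose_smult pcompose_pCons pcompose_hom.hom_power)
    ultimately show ?thesis
      by (simp add: down_\<phi>[OF l] coeff_linear_poly_power' coeff_diff[symmetric] flip: coeff_smult)
  qed
  have r: "coeff (down l ?r) i \<in> vball (1 + real i)" for i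
    by (rule coeff_down_ball[OF \<phi>_cong l])
  have lp: "(- l) ^ n \<in> vball 0" for n by (intro ball_power0) (simp add: rep_ball l)
  show "coeff (\<phi>_down l) 1 + 1 \<in> vball 1"
  proof -
    have "\<pi> * (coeff (\<phi>_down l) 1 + 1) = of_nat q * \<pi> * (- l) ^ (q - 1) + coeff (down l ?r) 1"
      using e[of 1] by (simp add: algebra_simps)
    moreover have "of_nat q * \<pi> * (- l) ^ (q - 1) \<in> vball 2"
      by (rule ball_mult_le[OF ball_mult[OF q_ball pi_ball] lp]) simp
    ultimately have "\<pi> * (coeff (\<phi>_down l) 1 + 1) \<in> vball 2"
      using r[of 1] by (simp add: ball_add)
    then show ?thesis by (simp add: pi_mult_ball)
  qed
  show "coeff (\<phi>_down l) i \<in> vball 2" if i: "2 \<le> i"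
  proof -
    have p: "\<pi> ^ i \<in> vball (real i)" using ball_power[OF pi_ball, of i] by simp
    have "of_nat (q choose i) * \<pi> ^ i * (- l) ^ (q - i) \<in> vball 3"
    proof (cases i q rule: linorder_cases)
      case less
      then show ?thesis
        using i by (intro ball_mult_le[OF ball_mult[OF binomial_ball p] lp]) auto
    next
      case equal
      then show ?thesis using ball_mono[OF p, of 3] card_reps_ge by simp
    qed (simp add: binomial_eq_0)
    moreover have "coeff [:- l, \<pi>:] i = 0" using i by (simp add: coeff_pCons split: nat.splits)
    ultimately have "\<pi> * coeff (\<phi>_down l) i \<in> vball 3"
      using e[of i] ball_mono[OF r, of 3 i] i by (simp add: ball_add)
    then show ?thesis by (simp add: pi_mult_ball)
  qed
qed

lemma \<phi>_down_1_unit: "l \<in> \<Lambda> \<Longrightarrow> coeff (\<phi>_down l) 1 \<noteq> 0 \<and> v (coeff (\<phi>_down l) 1) = 0"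
  using v_eq_if_diff[of "- 1" "coeff (\<phi>_down l) 1" 1] coeff_\<phi>_down(1)[of l]
    ball_uminus_iff[of "coeff (\<phi>_down l) 1 + 1" 1]
  by (simp add: v_minus v_one algebra_simps del: ball_uminus_iff)

lemma coeff_\<phi>_down_mult_Suc:
  "coeff (\<phi>_down l * Q) (Suc i) = coeff (\<phi>_down l) 1 * coeff Q i
     + (\<Sum>j\<in>{2..Suc i}. coeff (\<phi>_down l) j * coeff Q (Suc i - j))"
proof -
  have "{..Suc i} = insert 0 (insert 1 {2..Suc i})" by auto
  then show ?thesis by (simp add: coeff_mult \<phi>_down_0)
qed

lemma \<phi>_division:
  obtains p1 r where "p = p1 * \<phi> + r" "degree r < q" "degree p1 \<le> degree p - q" "r = p mod \<phi>"
proof -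
  have r: "degree (p mod \<phi>) < q"
    using degree_mod_less[OF \<phi>_nonzero, of p] card_reps_ge by (auto simp: degree_\<phi>)
  have "degree (p div \<phi>) \<le> degree p - q"
  proof (cases "p div \<phi> = 0")
    case False
    then have d: "degree (p div \<phi> * \<phi>) = degree (p div \<phi>) + q"
      by (simp add: degree_mult_eq \<phi>_nonzero degree_\<phi>)
    have "degree (p div \<phi> * \<phi> + p mod \<phi>) = degree (p div \<phi> * \<phi>)"
      by (rule degree_add_eq_left) (use r d in simp)
    then show ?thesis using d by simp
  qed simp
  with r show ?thesis using that[of "p div \<phi>" "p mod \<phi>"] by simp
qed

text \<open>Induction by division by \<phi>. The remainder is controlled by the values at the
  residues, and the quotient inherits the hypothesis after multiplication by \<pi>, so each division
  costs one factor \<pi>. In the second claim each division contributes a factor - \<pi>, because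
  \<open>\<phi>_down l\<close> has linear coefficient -1 modulo \<pi> and \<phi> is monic.\<close>

lemma hermite:
  assumes "degree p \<le> d * q" "\<And>l i. l \<in> \<Lambda> \<Longrightarrow> i \<le> d \<Longrightarrow> coeff (down l p) i \<in> vball t"
  shows "p \<in> pball (t - real d) \<and>
    (\<forall>l\<in>\<Lambda>. coeff (down l p) d - (- 1) ^ d * \<pi> ^ d * coeff p (d * q) \<in> vball (t + 1))"
  using assms
proof (induction d arbitrary: p)
  case 0
  then obtain c where p: "p = [:c:]" by (auto elim: degree_eq_zeroE)
  obtain l where l: "l \<in> \<Lambda>" using card_reps_ge by fastforce
  have "c \<in> vball t" using "0.prems"(2)[OF l, of 0] by (simp add: p down_def)
  then show ?case by (simp add: p down_def)
next
  case (Suc d)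
  obtain p1 r where p: "p = p1 * \<phi> + r" and r: "degree r < q" and d1: "degree p1 \<le> degree p - q"
    using \<phi>_division[of p] by metis
  have rb: "r \<in> pball t"
  proof (rule interpolation[OF r])
    fix l assume l: "l \<in> \<Lambda>"
    have "poly r (- l) = coeff (down l p) 0" by (simp add: coeff_down_0 p poly_\<phi> l)
    then show "poly r (- l) \<in> vball t" using Suc.prems(2)[OF l] by simp
  qed
  \<comment> \<open>The \<pi> that splits off from \<phi>(\<pi> z - l) is moved into the quotient,
    so that the induction hypothesis applies to it with the same t.\<close>
  let ?P = "smult \<pi> p1"
  have split: "down l p = \<phi>_down l * down l ?P + down l r" if "l \<in> \<Lambda>" for l
    by (simp add: p down_add down_mult down_\<phi>[OF that] down_smult mult.commute)
  have dr: "coeff (down l r) i \<in> vball (t + real i)" if "l \<in> \<Lambda>" for l i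
    by (rule coeff_down_ball[OF rb that])
  \<comment> \<open>A triangular system: degree i + 1 of the product contains the unknown of degree
    i with a unit and the earlier unknowns with coefficients in the maximal ideal.\<close>
  have Q: "coeff (down l ?P) i \<in> vball t" if l: "l \<in> \<Lambda>" and "i \<le> d" for l i
    using that(2)
  proof (induction i rule: less_induct)
    case (less i)
    have "coeff (\<phi>_down l * down l ?P) (Suc i) \<in> vball t"
      using ball_diff[OF Suc.prems(2)[OF l, of "Suc i"] ball_mono[OF dr[OF l, of "Suc i"]]] less.prems
      by (simp add: split[OF l])
    moreover have "(\<Sum>j\<in>{2..Suc i}. coeff (\<phi>_down l) j * coeff (down l ?P) (Suc i - j)) \<in> vball t"
      by (intro ball_sum ball_mult_le[OF coeff_\<phi>_down(2)[OF l] less.IH]) (use less.prems in auto)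
    ultimately have "coeff (\<phi>_down l) 1 * coeff (down l ?P) i \<in> vball t"
      unfolding coeff_\<phi>_down_mult_Suc by (metis ball_diff add_diff_cancel_right')
    then show ?case using \<phi>_down_1_unit[OF l] ball_mult_cancel'[of "coeff (\<phi>_down l) 1"] by simp
  qed
  have "degree ?P \<le> d * q" using d1 Suc.prems(1) pi_nonzero by simp
  note IH = Suc.IH[OF this Q]
  have p1: "p1 \<in> pball (t - real (Suc d))"
    using IH pi_mult_ball by (simp add: pball_def algebra_simps)
  have "p1 * \<phi> \<in> pball (t - real (Suc d))" by (rule pball_mult[OF p1 \<phi>_integral]) simp
  moreover have "r \<in> pball (t - real (Suc d))" by (rule pball_mono[OF rb]) simp
  ultimately have 1: "p \<in> pball (t - real (Suc d))" unfolding p by (rule pball_add)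
  have top: "coeff p (Suc d * q) = coeff p1 (d * q)"
  proof -
    have "coeff (p1 * \<phi>) (d * q + q) = coeff p1 (d * q)"
      using coeff_mult_top[of p1 "d * q" \<phi> q] d1 Suc.prems(1) by (simp add: degree_\<phi> lead_coeff_\<phi>)
    moreover have "coeff r (d * q + q) = 0" using r by (intro coeff_eq_0) simp
    ultimately show ?thesis by (simp add: p add.commute)
  qed
  have "coeff (down l p) (Suc d) - (- 1) ^ Suc d * \<pi> ^ Suc d * coeff p (Suc d * q) \<in> vball (t + 1)"
    if l: "l \<in> \<Lambda>" for l
  proof -
    let ?Q = "down l ?P" and ?u = "coeff (\<phi>_down l) 1"
    have eq: "coeff (down l p) (Suc d) - (- 1) ^ Suc d * \<pi> ^ Suc d * coeff p (Suc d * q)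
      = (?u + 1) * coeff ?Q d - (coeff ?Q d - (- 1) ^ d * \<pi> ^ d * coeff ?P (d * q))
        + (\<Sum>j\<in>{2..Suc d}. coeff (\<phi>_down l) j * coeff ?Q (Suc d - j)) + coeff (down l r) (Suc d)"
      unfolding split[OF l] coeff_add coeff_\<phi>_down_mult_Suc top by (simp add: algebra_simps)
    have f1: "(?u + 1) * coeff ?Q d \<in> vball (t + 1)"
      by (rule ball_mult_le[OF coeff_\<phi>_down(1)[OF l] Q[OF l]]) auto
    have f2: "coeff ?Q d - (- 1) ^ d * \<pi> ^ d * coeff ?P (d * q) \<in> vball (t + 1)"
      using IH l by blast
    have f3: "(\<Sum>j\<in>{2..Suc d}. coeff (\<phi>_down l) j * coeff ?Q (Suc d - j)) \<in> vball (t + 1)"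
      by (intro ball_sum ball_mult_le[OF coeff_\<phi>_down(2)[OF l] Q[OF l]]) auto
    have f4: "coeff (down l r) (Suc d) \<in> vball (t + 1)"
      by (rule ball_mono[OF dr[OF l]]) simp
    show ?thesis unfolding eq by (rule ball_add[OF ball_add[OF ball_diff[OF f1 f2] f3] f4])
  qed
  with 1 show ?case by blast
qed

end

section \<open>The Hecke recursion on a rooted tree\<close>

text \<open>The vertices below a fixed one are indexed by words over the residue system, the last step of the path coming
  first. In the coordinate $z = y/x$ the operator \<open>down l\<close> transports a polynomial to the child
  \<open>l\<close>, and \<open>up l\<close> transports it from the child \<open>l\<close> to its parent.\<close>

locale hecke_tree = residue_system v \<pi> A \<Lambda> for v :: "'c::field \<Rightarrow> real" and \<pi> A \<Lambda> +
  fixes d :: nat and a :: 'c and w :: "'c list \<Rightarrow> 'c poly" and up :: "'c \<Rightarrow> 'c poly \<Rightarrow> 'c poly" and M :: nat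
  assumes d_pos: "1 \<le> d" and d_small: "2 * d < q"
    and a_nonzero: "a \<noteq> 0" and a_pos: "0 < v a" and a_le: "v a \<le> 1"
    and up_eq: "\<And>l p. up l p = (\<Sum>j\<le>d * q. smult (coeff p j * \<pi> ^ (d * q - j)) ([:l, 1:] ^ j))"
    and degree_w: "\<And>xs. degree (w xs) \<le> d * q"
    and recursion: "\<And>xs l. xs \<in> lists \<Lambda> \<Longrightarrow> l \<in> \<Lambda> \<Longrightarrow>
      down l (w xs) - smult a (w (l # xs)) + (\<Sum>l'\<in>\<Lambda>. up l' (w (l' # l # xs))) \<in> pball 0"
    and vanish: "\<And>xs. xs \<in> lists \<Lambda> \<Longrightarrow> M \<le> length xs \<Longrightarrow> w xs = 0"
begin

abbreviation k :: nat where "k \<equiv> d * q"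

definition S :: "'c list \<Rightarrow> 'c" where "S xs = coeff (w xs) k"

text \<open>The contribution of the children of a vertex when all their leading coefficients are 1.
  As the leading coefficients of siblings are nearly equal, the actual contribution is close to a
  multiple of \<open>E\<close>.\<close>

definition E :: "'c poly" where "E = (\<Sum>l\<in>\<Lambda>. [:l, 1:] ^ k)"

lemma coeff_linear: "coeff ([:l, 1:] ^ n) j = of_nat (n choose j) * (l :: 'c) ^ (n - j)"
  by (simp add: coeff_linear_poly_power')

lemma linear_integral: "l \<in> \<Lambda> \<Longrightarrow> [:l, 1:] ^ n \<in> pball 0"
  by (rule pball_power) (simp add: rep_ball)

lemma k_ge: "3 * d \<le> k"
proof -
  have "3 * d \<le> q * d" using card_reps_ge by (intro mult_right_mono) auto
  then show ?thesis by (simp add: mult.commute)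
qed

lemma k_gt: "2 * d \<le> k - d"
  using k_ge by linarith

text \<open>In \<open>up\<close> the coefficient of degree j comes with \<pi>^(k - j), so a pole of
  order at most k - j is absorbed.\<close>

lemma up_cong:
  assumes "l \<in> \<Lambda>" "\<And>j. j < k \<Longrightarrow> coeff p j \<in> vball (real j - real k)"
  shows "up l p - smult (coeff p k) ([:l, 1:] ^ k) \<in> pball 0"
proof -
  have "up l p = (\<Sum>j<k. smult (coeff p j * \<pi> ^ (k - j)) ([:l, 1:] ^ j)) + smult (coeff p k) ([:l, 1:] ^ k)"
    unfolding up_eq by (simp flip: lessThan_Suc_atMost)
  moreover have "(\<Sum>j<k. smult (coeff p j * \<pi> ^ (k - j)) ([:l, 1:] ^ j)) \<in> pball 0"
  proof (rule pball_sum)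
    fix j assume j: "j \<in> {..<k}"
    have "coeff p j * \<pi> ^ (k - j) \<in> vball 0"
      using assms(2)[of j] j pi_power_mult_ball[of "k - j" "coeff p j" 0] by (simp add: of_nat_diff mult.commute)
    then show "smult (coeff p j * \<pi> ^ (k - j)) ([:l, 1:] ^ j) \<in> pball 0"
      by (rule pball_smult[OF _ linear_integral[OF assms(1)]]) simp
  qed
  ultimately show ?thesis by simp
qed

lemma recursion_top:
  assumes "ys \<in> lists \<Lambda>" "l \<in> \<Lambda>"
    and "\<And>l' j. l' \<in> \<Lambda> \<Longrightarrow> j < k \<Longrightarrow> coeff (w (l' # l # ys)) j \<in> vball (real j - real k)"
  shows "down l (w ys) - smult a (w (l # ys)) + (\<Sum>l'\<in>\<Lambda>. smult (S (l' # l # ys)) ([:l', 1:] ^ k)) \<in> pball 0"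
proof -
  have "(\<Sum>l'\<in>\<Lambda>. up l' (w (l' # l # ys)) - smult (S (l' # l # ys)) ([:l', 1:] ^ k)) \<in> pball 0"
    unfolding S_def by (intro pball_sum up_cong assms(3))
  from pball_diff[OF recursion[OF assms(1,2)] this] show ?thesis
    by (simp add: sum_subtractf algebra_simps)
qed

lemma coeff_E: "coeff E j = of_nat (k choose j) * (\<Sum>l\<in>\<Lambda>. l ^ (k - j))"
  by (simp add: E_def coeff_sum coeff_linear sum_distrib_left)

text \<open>If q does not divide j, the binomial coefficient is small. If it does, k - j is a
  multiple of q too, and Frobenius lowers the exponent of the power sum to at most d, which is below
  q - 1.\<close>

lemma E_ball: "E \<in> pball 1"
proof (rule pballI)
  fix j
  show "coeff E j \<in> vball 1"
  proof (cases "q dvd j \<and> j \<le> k")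
    case True
    then obtain t where t: "j = q * t" by blast
    have td: "t \<le> d" using True t card_reps_ge by (simp add: mult.commute)
    then have e: "k - j = (d - t) * q" by (simp add: t algebra_simps)
    have "(\<Sum>l\<in>\<Lambda>. l ^ (k - j) - l ^ (d - t)) \<in> vball 1"
      unfolding e by (intro ball_sum frobenius_power rep_A)
    moreover have "(\<Sum>l\<in>\<Lambda>. l ^ (d - t)) \<in> vball 1"
      by (rule power_sum_ball) (use d_small d_pos in linarith)
    ultimately have "(\<Sum>l\<in>\<Lambda>. l ^ (k - j)) \<in> vball 1"
      using ball_cong_diff by (simp add: sum_subtractf)
    then show ?thesis unfolding coeff_E using ball_mult[OF ball_of_nat] by fastforce
  next
    case False
    have s: "(\<Sum>l\<in>\<Lambda>. l ^ (k - j)) \<in> vball 0" by (intro ball_sum ball_power0 rep_ball)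
    have "of_nat (k choose j) \<in> vball 1"
      using False by (cases "j \<le> k") (auto intro: binomial_multiple_ball simp: binomial_eq_0)
    from ball_mult[OF this s] show ?thesis by (simp add: coeff_E)
  qed
qed

section \<open>The number \<theta> and the invariant that it controls\<close>

lemma poly_E_mod: "l \<in> \<Lambda> \<Longrightarrow> poly (E mod \<phi>) (- l) = poly E (- l)"
  using arg_cong[OF div_mult_mod_eq[of E \<phi>], of "\<lambda>p. poly p (- l)"] unfolding poly_add poly_mult by (simp add: poly_\<phi>)

lemma degree_E_mod: "degree (E mod \<phi>) < q"
  using degree_mod_less[OF \<phi>_nonzero, of E] card_reps_ge by (auto simp: degree_\<phi>)

lemma E_mod_ball: "E mod \<phi> \<in> pball 1"
  by (rule interpolation[OF degree_E_mod]) (auto simp: poly_E_mod rep_ball intro!: poly_ball E_ball)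

text \<open>The part with common leading coefficient is seen in degree k through the coefficient q
  of \<open>E\<close> and in degree d through its interpolation polynomial
  \<open>E mod \<phi>\<close>; their difference enters here. One factor \<pi>^d / a comes from the
  invariant, another 1 / a from solving for the leading coefficient of the child.\<close>

definition \<theta> :: 'c where
  "\<theta> = (of_nat q - coeff (E mod \<phi>) d) * \<pi> ^ d / a ^ 2"

lemma \<theta>_small:
  assumes "2 \<le> d \<or> v a < 1 \<or> of_nat q \<in> vball 2"
  obtains t where "0 < t" "\<theta> \<in> vball t"
proof -
  have "v (a ^ 2) = 2 * v a" using v_power[OF a_nonzero, of 2] by simp
  then have *: "\<theta> \<in> vball (s + real d - 2 * v a)" if "of_nat q - coeff (E mod \<phi>) d \<in> vball s" for s
    unfolding \<theta>_def using ball_divide[OF ball_mult[OF that ball_power[OF pi_ball, of d]], of "a ^ 2"] a_nonzero by simp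
  show thesis
  proof (cases "2 \<le> d \<or> v a < 1")
    case True
    have "\<theta> \<in> vball (1 + real d - 2 * v a)"
      by (intro * ball_diff q_ball pballD[OF E_mod_ball])
    moreover have "0 < 1 + real d - 2 * v a" using True d_pos a_le by auto
    ultimately show ?thesis using that by blast
  next
    case False
    \<comment> \<open>For d = 1 and v(a) = 1 the first estimate only shows that \<theta> is
      integral. Now k = q, hence \<open>E mod \<phi>\<close> is \<open>E\<close> minus q times
      \<phi>, and both q and the linear coefficient of this difference have valuation at least
      2.\<close>
    then have d: "d = 1" and q2: "of_nat q \<in> vball 2" using assms d_pos by auto
    have cE: "coeff E i = of_nat (q choose i) * (\<Sum>l\<in>\<Lambda>. l ^ (q - i))" for i
      using coeff_E[of i] unfolding d by simp
    let ?r = "E - smult (of_nat q) \<phi>"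
    have "degree ?r < q"
    proof (rule degree_ltI)
      fix i assume "q \<le> i"
      then show "coeff ?r i = 0"
        using lead_coeff_\<phi> by (cases "i = q") (auto simp: cE binomial_eq_0 degree_\<phi> coeff_eq_0)
    qed (use card_reps_ge in simp)
    moreover have "E mod \<phi> = ?r mod \<phi>"
      by (simp add: poly_mod_diff_left mod_smult_left)
    ultimately have r: "E mod \<phi> = ?r"
      by (simp add: mod_poly_less degree_\<phi>)
    have "(\<Sum>l\<in>\<Lambda>. l ^ (q - 1)) \<in> vball 0" by (intro ball_sum ball_power0 rep_ball)
    from ball_mult[OF q2 this] ball_mult[OF q2 pballD[OF \<phi>_integral, of 1]]
    have "coeff (E mod \<phi>) 1 \<in> vball 2"
      unfolding r by (simp add: cE ball_diff)
    then have "\<theta> \<in> vball (2 + real d - 2 * v a)"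
      using q2 d by (intro * ball_diff) auto
    then show ?thesis using that[of "2 + real d - 2 * v a"] d a_le by simp
  qed
qed

text \<open>The scalar g may not depend on the vertex: this uniformity is what makes the leading
  coefficients of siblings congruent. The clause on the degrees j < k is exactly what
  \<open>up_cong\<close> requires of a child.\<close>

definition inv_A :: "nat \<Rightarrow> 'c \<Rightarrow> bool" where
  "inv_A m g \<longleftrightarrow> g \<in> vball 0 \<and> (\<forall>xs\<in>lists \<Lambda>. length xs = m \<longrightarrow> (\<forall>l\<in>\<Lambda>.
     down l (w xs) \<in> pball (- v a) \<and>
     (\<forall>j<k. coeff (w (l # xs)) j \<in> vball (real j - real k)) \<and>
     S (l # xs) - g * \<pi> ^ d / a * S xs \<in> vball (- v a)))"

lemma inv_A_bound:
  assumes "inv_A m g" "xs \<in> lists \<Lambda>" "length xs = m"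
  shows "w xs \<in> pball (- v a - real d)"
proof -
  have "coeff (down l (w xs)) i \<in> vball (- v a)" if "l \<in> \<Lambda>" for l i
    using assms that by (auto simp: inv_A_def intro!: pballD)
  then show ?thesis using hermite[OF degree_w[of xs], of "- v a"] by blast
qed

lemma inv_A_step:
  assumes H: "inv_A (Suc m) g" and t: "0 < t" "\<theta> \<in> vball t"
  shows "inv_A m (- ((- 1) ^ d / (1 - \<theta> * g)))"
proof -
  \<comment> \<open>The new scalar has denominator \<open>?u\<close>, and this is where \<theta> has
    to be small: g is integral, so \<open>?u\<close> is a unit.\<close>
  let ?b = "v a" and ?u = "1 - \<theta> * g"
  have g: "g \<in> vball 0" using H by (simp add: inv_A_def)
  have u: "?u \<noteq> 0" "v ?u = 0"
    using v_eq_if_diff[of 1 ?u t] ball_mult[OF t(2) g] t(1) by (auto simp: v_one)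
  have bd: "?b \<le> real d" using a_le d_pos by linarith
  have b2: "of_nat (k choose j) * (\<Sum>l\<in>\<Lambda>. l ^ (k - j)) \<in> vball 2" "of_nat (k choose j) \<in> vball 1"
    if "j < k" "k - j \<le> d" for j
  proof -
    have "\<not> q dvd (k - j)" using that d_small by (auto dest: dvd_imp_le)
    then show 1: "of_nat (k choose j) \<in> vball 1"
      using binomial_multiple_ball[of "k - j" d] that by (simp add: binomial_symmetric[of j])
    have "(\<Sum>l\<in>\<Lambda>. l ^ (k - j)) \<in> vball 1"
      by (rule power_sum_ball) (use that d_small d_pos in linarith)
    from ball_mult[OF 1 this] show "of_nat (k choose j) * (\<Sum>l\<in>\<Lambda>. l ^ (k - j)) \<in> vball 2" by simp
  qed
  have main: "down l0 (w ys) \<in> pball (- ?b) \<and> (\<forall>j<k. coeff (w (l0 # ys)) j \<in> vball (real j - real k)) \<and>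
     S (l0 # ys) - (- ((- 1) ^ d / ?u)) * \<pi> ^ d / a * S ys \<in> vball (- ?b)"
    if ys: "ys \<in> lists \<Lambda>" "length ys = m" and l0: "l0 \<in> \<Lambda>" for ys l0
  proof -
    define xs where "xs l = l # ys" for l
    \<comment> \<open>\<open>\<alpha> l\<close> is the leading coefficient predicted by the
      invariant for all children of \<open>xs l\<close>, and \<open>e l l'\<close> below is the
      deviation of the child l' from it.\<close>
    define \<alpha> where "\<alpha> l = g * \<pi> ^ d / a * S (xs l)" for l
    define e where "e l l' = S (l' # xs l) - \<alpha> l" for l l'
    have xs: "xs l \<in> lists \<Lambda>" "length (xs l) = Suc m" if "l \<in> \<Lambda>" for l
      using ys that by (auto simp: xs_def)
    have w_xs: "w (xs l) \<in> pball (- ?b - real d)" if "l \<in> \<Lambda>" for l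
      by (rule inv_A_bound[OF H xs[OF that]])
    have \<alpha>: "\<alpha> l \<in> vball (- 2 * ?b)" if "l \<in> \<Lambda>" for l
    proof -
      have "\<pi> ^ d * S (xs l) \<in> vball (- ?b)"
        using pballD[OF w_xs[OF that]] by (simp add: pi_power_mult_ball S_def)
      from ball_divide[OF ball_mult[OF g this] a_nonzero] show ?thesis
        by (simp add: \<alpha>_def mult.assoc)
    qed
    have e: "e l l' \<in> vball (- ?b)" if "l \<in> \<Lambda>" "l' \<in> \<Lambda>" for l l'
      using H xs[OF that(1)] that(2) by (auto simp: inv_A_def e_def \<alpha>_def)
    define R where "R l = (\<Sum>l'\<in>\<Lambda>. smult (e l l') ([:l', 1:] ^ k))" for l
    define T where "T l = smult (\<alpha> l) E + R l" for l
    have T_eq: "T l = (\<Sum>l'\<in>\<Lambda>. smult (S (l' # xs l)) ([:l', 1:] ^ k))" for l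
      by (simp add: T_def R_def E_def e_def smult_sum2 flip: sum.distrib smult_add_left)
    have R: "R l \<in> pball (- ?b)" if "l \<in> \<Lambda>" for l
      unfolding R_def by (intro pball_sum pball_smult[OF e[OF that] linear_integral]) auto
    \<comment> \<open>\<open>\<alpha> l\<close> may have a pole of order 2 v(a), but
      \<open>E\<close> gains a factor \<pi> and v(a) \<le> 1, so the sum is no worse than the
      deviations.\<close>
    have T: "T l \<in> pball (- ?b)" if "l \<in> \<Lambda>" for l
      unfolding T_def by (intro pball_add R that pball_smult[OF \<alpha>[OF that] E_ball]) (use a_le in auto)
    have rec: "down l (w ys) - smult a (w (xs l)) + T l \<in> pball 0" if l: "l \<in> \<Lambda>" for l
      unfolding T_eq xs_def
      by (rule recursion_top[OF ys(1) l]) (use H xs[OF l] in \<open>auto simp: inv_A_def xs_def\<close>)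
    have aw: "smult a (w (xs l)) \<in> pball (- real d)" if "l \<in> \<Lambda>" for l
      by (rule pball_smult[OF _ w_xs[OF that], of _ ?b]) (auto intro: ballI)
    have "down l (w ys) \<in> pball (- real d)" if l: "l \<in> \<Lambda>" for l
    proof -
      have "down l (w ys) = (down l (w ys) - smult a (w (xs l)) + T l) + smult a (w (xs l)) - T l" by simp
      then show ?thesis
        using pball_diff[OF pball_add[OF pball_mono[OF rec[OF l]] aw[OF l]] pball_mono[OF T[OF l]]] bd by simp
    qed
    then have "coeff (down l (w ys)) i \<in> vball (- real d)" if "l \<in> \<Lambda>" for l i
      using that by (auto intro!: pballD)
    from hermite[OF degree_w[of ys] this] have w_ys: "w ys \<in> pball (- 2 * real d)" by simp
    \<comment> \<open>The crude bound has cost two Hermite losses d, and transport to a child gains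
      \<pi>^j in degree j; so from degree 2d on nothing is lost.\<close>
    have high: "coeff (down l (w ys)) j \<in> vball 0" if "l \<in> \<Lambda>" "2 * d \<le> j" for l j
      by (rule ball_mono[OF coeff_down_ball[OF w_ys that(1)]]) (use that(2) in linarith)
    \<comment> \<open>Only the d coefficients just below the leading one need an argument. There the
      recursion is solved for a times the coefficient: the transported parent is integral in these
      degrees, and the binomial coefficient and the power sum each give a factor \<pi> against the
      pole of \<open>\<alpha> l\<close>.\<close>
    have Q: "coeff (w (xs l)) j \<in> vball (real j - real k)" if l: "l \<in> \<Lambda>" and j: "j < k" for l j
    proof (cases "k - j \<le> d")
      case False
      show ?thesis
        by (rule ball_mono[OF pballD[OF w_xs[OF l]]]) (use False a_le in linarith)
    next
      case True
      have "coeff (T l) j = \<alpha> l * (of_nat (k choose j) * (\<Sum>l\<in>\<Lambda>. l ^ (k - j)))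
          + of_nat (k choose j) * (\<Sum>l'\<in>\<Lambda>. e l l' * l' ^ (k - j))"
        by (simp add: T_def R_def coeff_E coeff_sum coeff_linear sum_distrib_left algebra_simps)
      moreover have "\<alpha> l * (of_nat (k choose j) * (\<Sum>l\<in>\<Lambda>. l ^ (k - j))) \<in> vball 0"
        by (rule ball_mult_le[OF \<alpha>[OF l] b2(1)[OF j True]]) (use a_le in simp)
      moreover have "(\<Sum>l'\<in>\<Lambda>. e l l' * l' ^ (k - j)) \<in> vball (- ?b)"
        by (intro ball_sum ball_mult_le[OF e[OF l] ball_power0[OF rep_ball]]) auto
      then have "of_nat (k choose j) * (\<Sum>l'\<in>\<Lambda>. e l l' * l' ^ (k - j)) \<in> vball 0"
        by (rule ball_mult_le[OF b2(2)[OF j True]]) (use a_le in simp)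
      ultimately have Tj: "coeff (T l) j \<in> vball 0" by (simp add: ball_add)
      have "coeff (down l (w ys)) j \<in> vball 0" by (rule high[OF l]) (use True j k_gt in linarith)
      from ball_diff[OF ball_add[OF this Tj] pballD[OF rec[OF l], of j]]
      have "a * coeff (w (xs l)) j \<in> vball 0" by simp
      then have "coeff (w (xs l)) j \<in> vball (- ?b)" by (simp add: ball_mult_cancel'[OF a_nonzero])
      then show ?thesis by (rule ball_mono) (use j a_le in linarith)
    qed
    define low where "low l = poly_cutoff (2 * d) (down l (w ys))" for l
    \<comment> \<open>Reduction to degree below q: \<open>E mod \<phi>\<close> has the same values
      at the residues as \<open>E\<close>, and (z + l')^k may be replaced by (z + l')^d because the
      two agree there modulo \<pi> while the pole of \<open>e l l'\<close> has order v(a) \<le>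
      1.\<close>
    define P where "P l = low l + smult (\<alpha> l) (E mod \<phi>) + (\<Sum>l'\<in>\<Lambda>. smult (e l l') ([:l', 1:] ^ d))" for l
    have low: "down l (w ys) - low l \<in> pball 0" if l: "l \<in> \<Lambda>" for l
      using high[OF l] by (auto simp: pball_def low_def coeff_poly_cutoff)
    have P: "P l \<in> pball 0" if l: "l \<in> \<Lambda>" for l
    proof (rule interpolation)
      show "degree (P l) < q"
      proof (rule degree_ltI)
        fix i assume i: "q \<le> i"
        then have "coeff (E mod \<phi>) i = 0" "coeff (low l) i = 0" "d choose i = 0"
          using degree_E_mod d_small by (auto simp: coeff_eq_0 low_def coeff_poly_cutoff)
        then show "coeff (P l) i = 0" by (simp add: P_def coeff_sum coeff_linear binomial_eq_0)
      qed (use card_reps_ge in simp)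
      fix m assume m: "m \<in> \<Lambda>"
      have mb: "- m \<in> vball 0" using rep_ball[OF m] by simp
      have 1: "poly (low l) (- m) - poly (down l (w ys)) (- m) \<in> vball 0"
        using poly_ball[OF low[OF l] mb] by (simp add: ball_minus_commute)
      have 2: "poly (down l (w ys)) (- m) - a * poly (w (xs l)) (- m) + poly (T l) (- m) \<in> vball 0"
        using poly_ball[OF rec[OF l] mb] by simp
      \<comment> \<open>The bound one level further out enters in degree 0 only, where
        \<open>down m\<close> returns the value at - m.\<close>
      have "coeff (down m (w (xs l))) 0 \<in> vball (- ?b)"
        using H xs[OF l] m by (auto simp: inv_A_def intro!: pballD)
      then have 3: "a * poly (w (xs l)) (- m) \<in> vball 0"
        by (simp add: coeff_down_0 ball_mult_cancel'[OF a_nonzero])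
      have 4: "(\<Sum>l'\<in>\<Lambda>. e l l' * ((l' - m) ^ k - (l' - m) ^ d)) \<in> vball 0"
        by (intro ball_sum ball_mult_le[OF e[OF l] frobenius_power] A_diff rep_A m) (use a_le in auto)
      have "poly (T l) (- m) = \<alpha> l * poly E (- m) + (\<Sum>l'\<in>\<Lambda>. e l l' * (l' - m) ^ k)"
        by (simp add: T_def R_def poly_sum)
      then have "poly (P l) (- m) = (poly (low l) (- m) - poly (down l (w ys)) (- m))
          + (poly (down l (w ys)) (- m) - a * poly (w (xs l)) (- m) + poly (T l) (- m))
          + a * poly (w (xs l)) (- m) - (\<Sum>l'\<in>\<Lambda>. e l l' * ((l' - m) ^ k - (l' - m) ^ d))"
        by (simp add: P_def poly_sum poly_E_mod[OF m] sum_subtractf right_diff_distrib)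
      with ball_diff[OF ball_add[OF ball_add[OF 1 2] 3] 4] show "poly (P l) (- m) \<in> vball 0" by simp
    qed
    have down_ys: "down l (w ys) \<in> pball (- ?b)" if l: "l \<in> \<Lambda>" for l
    proof -
      have 1: "smult (\<alpha> l) (E mod \<phi>) \<in> pball (- ?b)"
        by (rule pball_smult[OF \<alpha>[OF l] E_mod_ball]) (use a_le in simp)
      have 2: "(\<Sum>l'\<in>\<Lambda>. smult (e l l') ([:l', 1:] ^ d)) \<in> pball (- ?b)"
        by (intro pball_sum pball_smult[OF e[OF l] linear_integral]) auto
      have 3: "P l \<in> pball (- ?b)" and 4: "down l (w ys) - low l \<in> pball (- ?b)"
        using pball_mono[OF P[OF l]] pball_mono[OF low[OF l]] a_pos by auto
      have "down l (w ys) = (down l (w ys) - low l) + (P l - smult (\<alpha> l) (E mod \<phi>)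
          - (\<Sum>l'\<in>\<Lambda>. smult (e l l') ([:l', 1:] ^ d)))"
        by (simp add: P_def)
      with pball_add[OF 4 pball_diff[OF pball_diff[OF 3 1] 2]] show ?thesis by simp
    qed
    then have "coeff (down l (w ys)) i \<in> vball (- ?b)" if "l \<in> \<Lambda>" for l i
      using that by (auto intro!: pballD)
    \<comment> \<open>Three relations now hold modulo integral elements: the Hermite congruence,
      degree d of \<open>P l0\<close>, and degree k of the recursion. The last two contain the same
      unknown sum of deviations; eliminating it leaves the leading coefficient of the child in terms
      of that of the parent.\<close>
    from hermite[OF degree_w[of ys] this]
    have "coeff (down l0 (w ys)) d - (- 1) ^ d * \<pi> ^ d * S ys \<in> vball (- ?b + 1)"
      using l0 by (simp add: S_def)
    then have 1: "coeff (down l0 (w ys)) d - (- 1) ^ d * \<pi> ^ d * S ys \<in> vball 0"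
      by (rule ball_mono) (use a_le in simp)
    have 2: "coeff (down l0 (w ys)) d + \<alpha> l0 * coeff (E mod \<phi>) d + (\<Sum>l'\<in>\<Lambda>. e l0 l') \<in> vball 0"
      using pballD[OF P[OF l0], of d] d_pos
      by (simp add: P_def low_def coeff_poly_cutoff coeff_sum coeff_linear)
    have 3: "a * S (xs l0) - (of_nat q * \<alpha> l0 + (\<Sum>l'\<in>\<Lambda>. e l0 l')) \<in> vball 0"
    proof -
      have "coeff (down l0 (w ys)) k \<in> vball 0" by (rule high[OF l0]) (use k_ge in linarith)
      from ball_diff[OF this pballD[OF rec[OF l0], of k]] show ?thesis
        by (simp add: T_def R_def coeff_E coeff_sum coeff_linear S_def algebra_simps)
    qed
    have \<theta>\<alpha>: "(of_nat q - coeff (E mod \<phi>) d) * \<alpha> l0 = \<theta> * g * a * S (xs l0)"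
      using a_nonzero by (simp add: \<theta>_def \<alpha>_def field_simps power2_eq_square)
    have eq: "a * ?u * S (xs l0) + (- 1) ^ d * \<pi> ^ d * S ys =
        (a * S (xs l0) - (of_nat q * \<alpha> l0 + (\<Sum>l'\<in>\<Lambda>. e l0 l')))
        + (coeff (down l0 (w ys)) d + \<alpha> l0 * coeff (E mod \<phi>) d + (\<Sum>l'\<in>\<Lambda>. e l0 l'))
        - (coeff (down l0 (w ys)) d - (- 1) ^ d * \<pi> ^ d * S ys)
        + ((of_nat q - coeff (E mod \<phi>) d) * \<alpha> l0 - \<theta> * g * a * S (xs l0))"
      by (simp add: algebra_simps)
    have "a * ?u * S (xs l0) + (- 1) ^ d * \<pi> ^ d * S ys \<in> vball 0"
      unfolding eq \<theta>\<alpha> diff_self add_0_right by (rule ball_diff[OF ball_add[OF 3 2] 1])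
    moreover have "a * ?u \<noteq> 0" "v (a * ?u) = ?b" using a_nonzero u by (auto simp: v_mult)
    ultimately have "(a * ?u * S (xs l0) + (- 1) ^ d * \<pi> ^ d * S ys) / (a * ?u) \<in> vball (- ?b)"
      using ball_divide[of _ 0 "a * ?u"] by simp
    moreover have "(a * ?u * S (xs l0) + (- 1) ^ d * \<pi> ^ d * S ys) / (a * ?u)
        = S (xs l0) - (- ((- 1) ^ d / ?u)) * \<pi> ^ d / a * S ys"
      using a_nonzero u(1) by (simp add: add_divide_distrib)
    ultimately show ?thesis using down_ys[OF l0] Q[OF l0] by (simp add: xs_def)
  qed
  have "(- 1 :: 'c) ^ d / ?u \<in> vball 0"
    using ball_divide[OF ball_power0[of "- 1" d], of ?u] u by simp
  then show ?thesis using main unfolding inv_A_def by auto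
qed

lemma bound_A:
  assumes "2 \<le> d \<or> v a < 1 \<or> of_nat q \<in> vball 2" "xs \<in> lists \<Lambda>"
  shows "w xs \<in> pball (- real d - 1)"
proof -
  obtain t where t: "0 < t" "\<theta> \<in> vball t" using \<theta>_small[OF assms(1)] by blast
  \<comment> \<open>Backward induction from the depth M of the support: beyond it all polynomials
    are 0 and the scalar 0 serves.\<close>
  have "\<exists>g. inv_A m g" for m
  proof (induction "M - m" arbitrary: m)
    case 0
    have z: "w xs = 0" if "xs \<in> lists \<Lambda>" "m \<le> length xs" for xs
      using vanish[of xs] that 0 by simp
    have "inv_A m 0"
      unfolding inv_A_def S_def by (auto simp: z down_def)
    then show ?case by blast
  next
    case (Suc n)
    then have "n = M - Suc m" by simp
    with Suc.hyps(1) inv_A_step[OF _ t] show ?case by blast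
  qed
  then obtain g where "inv_A (length xs) g" by blast
  from inv_A_bound[OF this assms(2) refl] show ?thesis
    by (rule pball_mono) (use a_le in simp)
qed

text \<open>The remaining case is \<open>d = 1\<close>, \<open>v a = 1\<close>, \<open>v q = 1\<close>, where \<open>\<theta>\<close> may be a unit. There the
  binomial coefficients \<open>q choose i\<close> are uniformizers, so the middle coefficients of the recursion bound the
  power moments of the leading coefficients and force these to be congruent to each other.\<close>

lemma linear_decomposition:
  assumes "degree p \<le> q" "\<And>l i. l \<in> \<Lambda> \<Longrightarrow> coeff (down l p) i \<in> vball t"
  shows "coeff p q \<in> vball (t - 1)" "p \<in> pball (t - 1)"
    and "j \<noteq> 1 \<Longrightarrow> j < q \<Longrightarrow> coeff p j \<in> vball t"
    and "l \<in> \<Lambda> \<Longrightarrow> 2 \<le> j \<Longrightarrow> coeff (down l p) j \<in> vball (t + 2)"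
proof -
  show p: "p \<in> pball (t - 1)" using hermite[of p 1 t] assms by simp
  then show c: "coeff p q \<in> vball (t - 1)" by (rule pballD)
  \<comment> \<open>Since the degree is at most q and \<phi> is monic, the quotient by \<phi> is the
    constant leading coefficient.\<close>
  define r where "r = p - smult (coeff p q) \<phi>"
  have p_eq: "p = smult (coeff p q) \<phi> + r" by (simp add: r_def)
  have r: "r \<in> pball t"
  proof (rule interpolation)
    show "degree r < q"
    proof (rule degree_ltI)
      fix i assume "q \<le> i"
      then show "coeff r i = 0"
        using assms(1) by (cases "i = q") (auto simp: r_def lead_coeff_\<phi> degree_\<phi> coeff_eq_0)
    qed (use card_reps_ge in simp)
    fix l assume l: "l \<in> \<Lambda>"
    then show "poly r (- l) \<in> vball t"
      using assms(2)[OF l, of 0] by (simp add: r_def poly_\<phi> coeff_down_0)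
  qed
  show "coeff p j \<in> vball t" if "j \<noteq> 1" "j < q"
  proof -
    have "coeff p q * coeff \<phi> j \<in> vball t"
      by (rule ball_mult_le[OF c coeff_\<phi>_ball]) (use that in auto)
    moreover have "coeff p j = coeff p q * coeff \<phi> j + coeff r j" by (simp add: r_def)
    ultimately show ?thesis using ball_add[OF _ pballD[OF r, of j]] by simp
  qed
  show "coeff (down l p) j \<in> vball (t + 2)" if l: "l \<in> \<Lambda>" and j: "2 \<le> j"
  proof -
    have "down l p = smult (\<pi> * coeff p q) (\<phi>_down l) + down l r"
      by (subst p_eq) (simp add: down_add down_smult down_\<phi>[OF l] mult.commute)
    moreover have "\<pi> * coeff p q \<in> vball t" using c by (simp add: pi_mult_ball)
    then have "\<pi> * coeff p q * coeff (\<phi>_down l) j \<in> vball (t + 2)"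
      by (rule ball_mult[OF _ coeff_\<phi>_down(2)[OF l j]])
    moreover have "coeff (down l r) j \<in> vball (t + 2)"
      by (rule ball_mono[OF coeff_down_ball[OF r l]]) (use j in simp)
    ultimately show ?thesis by (simp add: ball_add)
  qed
qed

lemma binomial_pred_cong: "j < q \<Longrightarrow> of_nat ((q - 1) choose j) - (- 1) ^ j \<in> vball 1"
proof (induction j)
  case (Suc j)
  have q: "q = Suc (q - 1)" using card_reps_ge by simp
  have "(of_nat (q choose Suc j) :: 'c) = of_nat ((q - 1) choose j) + of_nat ((q - 1) choose Suc j)"
    by (subst q) simp
  then have eq: "(of_nat ((q - 1) choose Suc j) :: 'c) - (- 1) ^ Suc j
      = of_nat (q choose Suc j) - (of_nat ((q - 1) choose j) - (- 1) ^ j)" by simp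
  show ?case unfolding eq by (rule ball_diff[OF binomial_ball Suc.IH]) (use Suc.prems in auto)
qed simp

text \<open>A converse to \<open>binomial_ball\<close>: i (q choose i) = q (q - 1 choose i - 1),
  where the last factor is a unit, being a sign modulo \<pi>. As v(q) is an integer below 2, the
  valuation of \<open>q choose i\<close> is at most 1.\<close>

lemma binomial_mult_ball:
  assumes "of_nat q \<notin> vball 2" "0 < i" "i < q" "of_nat (q choose i) * x \<in> vball 0"
  shows "x \<in> vball (- 1)"
proof -
  let ?c = "of_nat ((q - 1) choose (i - 1)) :: 'c"
  have nz: "(of_nat q :: 'c) \<noteq> 0" using assms(1) by auto
  obtain z where z: "v (of_nat q) = of_int z" using A_discrete[OF A_of_nat nz] by (auto elim: Ints_cases)
  have vq: "v (of_nat q) \<le> 1" using assms(1) z by (simp add: vball_def)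
  have c: "?c \<noteq> 0 \<and> v ?c = 0"
  proof -
    have "(- 1) ^ (i - 1) - ?c \<in> vball 1"
      using binomial_pred_cong[of "i - 1"] assms ball_minus_commute by fastforce
    moreover have "v ((- 1) ^ (i - 1)) = 0" using v_power[of "- 1" "i - 1"] by (simp add: v_minus v_one)
    ultimately show ?thesis using v_eq_if_diff[of "(- 1) ^ (i - 1)" ?c 1] by simp
  qed
  have "i * (q choose i) = q * ((q - 1) choose (i - 1))"
    using times_binomial_minus1_eq[of i q] assms by simp
  then have eq: "of_nat q * (?c * x) = of_nat i * (of_nat (q choose i) * x)"
    by (metis mult.assoc of_nat_mult)
  have "of_nat q * (?c * x) \<in> vball 0"
    unfolding eq by (rule ball_mult_le[OF ball_of_nat assms(4)]) simp
  then have "x \<in> vball (0 - v (of_nat q))"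
    using nz c by (simp add: ball_mult_cancel')
  then show ?thesis by (rule ball_mono) (use vq in simp)
qed

lemma inv_B_step:
  assumes d1: "d = 1" and a1: "v a = 1" and q2: "of_nat q \<notin> vball 2"
    and H: "\<And>xs l. xs \<in> lists \<Lambda> \<Longrightarrow> m < length xs \<Longrightarrow> l \<in> \<Lambda> \<Longrightarrow> down l (w xs) \<in> pball (- 1)"
    and ys: "ys \<in> lists \<Lambda>" "length ys = m" and l0: "l0 \<in> \<Lambda>"
  shows "down l0 (w ys) \<in> pball (- 1)"
proof -
  have kq: "d * q = q" by (simp add: d1)
  have deg: "degree (w xs) \<le> q" for xs using degree_w[of xs] by (simp only: kq)
  have H': "coeff (down l (w xs)) i \<in> vball (- 1)" if "xs \<in> lists \<Lambda>" "m < length xs" "l \<in> \<Lambda>" for xs l i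
    by (rule pballD[OF H[OF that]])
  define s where "s l l' = coeff (w (l' # l # ys)) q" for l l'
  have s: "s l l' \<in> vball (- 2)" if "l \<in> \<Lambda>" "l' \<in> \<Lambda>" for l l'
    using linear_decomposition(1)[OF deg H', of "l' # l # ys"] ys that by (simp add: s_def)
  define T where "T l = (\<Sum>l'\<in>\<Lambda>. smult (s l l') ([:l', 1:] ^ q))" for l
  have rec: "down l (w ys) - smult a (w (l # ys)) + T l \<in> pball 0" if l: "l \<in> \<Lambda>" for l
  proof -
    have Q: "coeff (w (l' # l # ys)) j \<in> vball (real j - real k)" if "l' \<in> \<Lambda>" "j < k" for l' j
    proof (cases "j = 1")
      case True
      have "coeff (w (l' # l # ys)) j \<in> vball (- 2)"
        using linear_decomposition(2)[OF deg H', of "l' # l # ys"] ys l that by (simp add: pballD)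
      then show ?thesis by (rule ball_mono) (use card_reps_ge True in \<open>simp add: d1\<close>)
    next
      case False
      have "coeff (w (l' # l # ys)) j \<in> vball (- 1)"
        using linear_decomposition(3)[OF deg H', of "l' # l # ys" j] ys l that False by (simp add: d1)
      then show ?thesis by (rule ball_mono) (use that in \<open>simp add: d1\<close>)
    qed
    have "down l (w ys) - smult a (w (l # ys)) + (\<Sum>l'\<in>\<Lambda>. smult (S (l' # l # ys)) ([:l', 1:] ^ k)) \<in> pball 0"
      by (rule recursion_top[OF ys(1) l]) (rule Q)
    then show ?thesis by (simp only: T_def s_def S_def kq)
  qed
  have aw: "smult a (w (l # ys)) \<in> pball (- 1)" if l: "l \<in> \<Lambda>" for l
    using linear_decomposition(2)[OF deg H', of "l # ys"] ys l
    by (intro pball_smult[of a 1 _ "- 2"]) (auto simp: a1 intro: ballI)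
  have T: "T l \<in> pball (- 2)" if "l \<in> \<Lambda>" for l
    unfolding T_def by (intro pball_sum pball_smult[OF s[OF that] linear_integral]) auto
  have "down l (w ys) \<in> pball (- 2)" if l: "l \<in> \<Lambda>" for l
    using pball_diff[OF pball_add[OF pball_mono[OF rec[OF l]] pball_mono[OF aw[OF l]]] T[OF l]] by simp
  then have "coeff (down l (w ys)) i \<in> vball (- 2)" if "l \<in> \<Lambda>" for l i
    using that by (auto intro!: pballD)
  \<comment> \<open>The polynomial at ys is only known in \<open>pball (- 3)\<close>, so transport
    alone would leave a pole in degree 2. The sharper estimate of the coefficients of
    \<open>\<phi>_down\<close> removes it.\<close>
  note high = linear_decomposition(4)[OF deg this l0, simplified]
  define \<mu> where "\<mu> i = (\<Sum>l\<in>\<Lambda>. s l0 l * l ^ i)" for i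
  have coeff_T: "coeff (T l0) j = of_nat (q choose j) * \<mu> (q - j)" for j
    by (simp add: T_def \<mu>_def coeff_sum coeff_linear sum_distrib_left mult.left_commute)
  have T_high: "coeff (T l0) j - a * coeff (w (l0 # ys)) j \<in> vball 0" if "2 \<le> j" for j
  proof -
    have "(coeff (down l0 (w ys)) j - a * coeff (w (l0 # ys)) j + coeff (T l0) j) - coeff (down l0 (w ys)) j \<in> vball 0"
      using ball_diff[OF pballD[OF rec[OF l0], of j] high[OF that]] by simp
    then show ?thesis by (simp add: algebra_simps)
  qed
  \<comment> \<open>Degree j of \<open>T l0\<close> is \<open>q choose j\<close> times the moment of
    order q - j. The transported parent is integral in degrees at least 2, which gives the moments
    of order at most q - 2 and leaves out only that of order q - 1.\<close>
  have moments: "\<mu> i \<in> vball (- 1)" if i: "i \<le> q - 2" for i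
  proof (cases "i = 0")
    case True
    have "coeff (T l0) q - a * coeff (w (l0 # ys)) q \<in> vball (- 1)"
      by (rule ball_mono[OF T_high]) (use card_reps_ge in auto)
    moreover have "a * coeff (w (l0 # ys)) q \<in> vball (- 1)"
      using pballD[OF aw[OF l0], of q] by simp
    ultimately have "coeff (T l0) q \<in> vball (- 1)" by (simp only: ball_cong_diff)
    then show ?thesis using True by (simp add: coeff_T)
  next
    case False
    have "coeff (w (l0 # ys)) (q - i) \<in> vball (- 1)"
      using linear_decomposition(3)[OF deg H', of "l0 # ys" "q - i"] ys l0 i False card_reps_ge by simp
    then have "a * coeff (w (l0 # ys)) (q - i) \<in> vball 0"
      by (simp add: ball_mult_cancel'[OF a_nonzero] a1)
    moreover have "2 \<le> q - i" using i card_reps_ge by simp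
    ultimately have "coeff (T l0) (q - i) \<in> vball 0" using T_high ball_cong_diff by blast
    moreover have "q - (q - i) = i" using i by simp
    ultimately have "of_nat (q choose (q - i)) * \<mu> i \<in> vball 0" by (simp add: coeff_T)
    then show ?thesis by (rule binomial_mult_ball[OF q2, rotated 2]) (use i False card_reps_ge in auto)
  qed
  have \<mu>_ball: "\<mu> i \<in> vball (- 2)" for i
    unfolding \<mu>_def by (intro ball_sum ball_mult_le[OF s[OF l0] ball_power0[OF rep_ball]]) auto
  \<comment> \<open>The common value of the leading coefficients is - \<mu>(q - 1). Indeed 1 - (l -
    m)^(q - 1) is modulo \<pi> the indicator of l = m; summing it against the leading coefficients
    returns the one at m, while expanding it leaves only the moment of order q - 1 up to
    \<open>vball (- 1)\<close>.\<close>
  define e where "e m = s l0 m + \<mu> (q - 1)" for m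
  have e: "e m \<in> vball (- 1)" if m: "m \<in> \<Lambda>" for m
  proof -
    let ?f = "\<lambda>l. s l0 l * (1 - (l - m) ^ (q - 1))"
    have 1: "(\<Sum>l\<in>\<Lambda>. ?f l) - s l0 m \<in> vball (- 1)"
    proof -
      have "(\<Sum>l\<in>\<Lambda>. ?f l) = s l0 m + (\<Sum>l\<in>\<Lambda> - {m}. ?f l)"
        using card_reps_ge by (subst sum.remove[OF reps_finite m]) (simp add: zero_power)
      moreover have "(\<Sum>l\<in>\<Lambda> - {m}. ?f l) \<in> vball (- 1)"
      proof (rule ball_sum)
        fix l assume l: "l \<in> \<Lambda> - {m}"
        have "(l - m) ^ (q - 1) - 1 \<in> vball 1"
          by (rule unit_power) (use l m A_diff rep_A reps_distinct in auto)
        then have "1 - (l - m) ^ (q - 1) \<in> vball 1" using ball_minus_commute by blast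
        moreover have "s l0 l \<in> vball (- 2)" by (rule s[OF l0]) (use l in simp)
        ultimately show "?f l \<in> vball (- 1)" using ball_mult_le[of "s l0 l" "- 2" _ 1] by simp
      qed
      ultimately show ?thesis by simp
    qed
    let ?g = "\<lambda>i. of_nat ((q - 1) choose i) * (- m) ^ (q - 1 - i) * \<mu> i"
    have ex: "(\<Sum>l\<in>\<Lambda>. s l0 l * (l - m) ^ (q - 1)) = (\<Sum>i\<le>q - 1. ?g i)"
    proof -
      have "(\<Sum>l\<in>\<Lambda>. s l0 l * (l - m) ^ (q - 1))
        = (\<Sum>l\<in>\<Lambda>. \<Sum>i\<le>q - 1. s l0 l * (of_nat ((q - 1) choose i) * l ^ i * (- m) ^ (q - 1 - i)))"
      proof (rule sum.cong[OF refl])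
        fix l
        have "(l - m) ^ (q - 1) = (\<Sum>i\<le>q - 1. of_nat ((q - 1) choose i) * l ^ i * (- m) ^ (q - 1 - i))"
          unfolding diff_conv_add_uminus by (rule binomial_ring)
        then show "s l0 l * (l - m) ^ (q - 1)
          = (\<Sum>i\<le>q - 1. s l0 l * (of_nat ((q - 1) choose i) * l ^ i * (- m) ^ (q - 1 - i)))"
          by (simp only: sum_distrib_left)
      qed
      also have "\<dots> = (\<Sum>i\<le>q - 1. ?g i)"
        by (subst sum.swap) (simp add: \<mu>_def sum_distrib_left mult_ac)
      finally show ?thesis .
    qed
    have q1: "q - 1 = Suc (q - 2)" using card_reps_ge by simp
    have "(\<Sum>i\<le>q - 1. ?g i) = (\<Sum>i\<le>q - 2. ?g i) + \<mu> (q - 1)"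
      unfolding q1 by simp
    then have 2: "(\<Sum>l\<in>\<Lambda>. ?f l) = \<mu> 0 - (\<Sum>i\<le>q - 2. ?g i) - \<mu> (q - 1)"
      using ex by (simp add: right_diff_distrib sum_subtractf \<mu>_def[of 0])
    have "(\<Sum>i\<le>q - 2. ?g i) \<in> vball (- 1)"
      by (intro ball_sum ball_mult_le[of _ 0 _ "- 1"] ball_mult_le[of _ 0 _ 0 0] moments ball_power0)
        (use rep_ball[OF m] in auto)
    then have 3: "\<mu> 0 - (\<Sum>i\<le>q - 2. ?g i) \<in> vball (- 1)"
      by (intro ball_diff moments) auto
    have "e m = (\<mu> 0 - (\<Sum>i\<le>q - 2. ?g i)) - ((\<Sum>l\<in>\<Lambda>. ?f l) - s l0 m)"
      using 2 by (simp add: e_def)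
    then show ?thesis using ball_diff[OF 3 1] by simp
  qed
  define low where "low = poly_cutoff 2 (down l0 (w ys))"
  have low: "down l0 (w ys) - low \<in> pball 0"
    using high by (auto simp: pball_def low_def coeff_poly_cutoff)
  have "low \<in> pball (- 1)"
  proof (rule interpolation)
    show "degree low < q"
      by (rule degree_ltI) (use card_reps_ge in \<open>auto simp: low_def coeff_poly_cutoff\<close>)
    fix m assume m: "m \<in> \<Lambda>"
    have mb: "- m \<in> vball 0" using rep_ball[OF m] by simp
    have 1: "poly (down l0 (w ys)) (- m) - poly low (- m) \<in> vball (- 1)"
      using ball_mono[OF poly_ball[OF low mb]] by simp
    have 2: "poly (down l0 (w ys)) (- m) - a * poly (w (l0 # ys)) (- m) + poly (T l0) (- m) \<in> vball (- 1)"
      using ball_mono[OF poly_ball[OF rec[OF l0] mb], of "- 1"] by simp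
    have 3: "a * poly (w (l0 # ys)) (- m) \<in> vball (- 1)"
      using poly_ball[OF aw[OF l0] mb] by simp
    \<comment> \<open>The common value may have a pole of order 2, but it multiplies this power sum,
      which Frobenius reduces to exponent 1 and which therefore gains a factor \<pi>.\<close>
    have "(\<Sum>l\<in>\<Lambda>. (l - m) ^ q) \<in> vball 1"
    proof -
      have "(\<Sum>l\<in>\<Lambda>. (l - m) ^ q - (l - m)) \<in> vball 1"
        by (intro ball_sum frobenius A_diff rep_A m)
      moreover have "(\<Sum>l\<in>\<Lambda>. l) - of_nat q * m \<in> vball 1"
        using power_sum_ball[of 1] card_reps_ge ball_mult[OF q_ball rep_ball[OF m]] by (intro ball_diff) auto
      ultimately have "(\<Sum>l\<in>\<Lambda>. (l - m) ^ q - (l - m)) + ((\<Sum>l\<in>\<Lambda>. l) - of_nat q * m) \<in> vball 1"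
        by (rule ball_add)
      then show ?thesis by (simp add: sum_subtractf)
    qed
    then have 4: "\<mu> (q - 1) * (\<Sum>l\<in>\<Lambda>. (l - m) ^ q) \<in> vball (- 1)"
      by (rule ball_mult_le[OF \<mu>_ball]) simp
    have 5: "(\<Sum>l\<in>\<Lambda>. e l * (l - m) ^ q) \<in> vball (- 1)"
      by (intro ball_sum ball_mult_le[OF e ball_power0[OF A_ball[OF A_diff]]] rep_A m) auto
    have 6: "poly (T l0) (- m) = (\<Sum>l\<in>\<Lambda>. e l * (l - m) ^ q) - \<mu> (q - 1) * (\<Sum>l\<in>\<Lambda>. (l - m) ^ q)"
      by (simp add: T_def poly_sum e_def distrib_right sum.distrib sum_distrib_left)
    have "poly (T l0) (- m) \<in> vball (- 1)" unfolding 6 by (rule ball_diff[OF 5 4])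
    from ball_diff[OF ball_add[OF 2 3] this] have "poly (down l0 (w ys)) (- m) \<in> vball (- 1)" by simp
    then show "poly low (- m) \<in> vball (- 1)" using 1 ball_cong_diff by blast
  qed
  then show ?thesis using pball_cong_diff[OF pball_mono[OF low, of "- 1"]] by simp
qed

lemma bound_B:
  assumes "d = 1" "v a = 1" "of_nat q \<notin> vball 2" "xs \<in> lists \<Lambda>"
  shows "w xs \<in> pball (- real d - 1)"
proof -
  have *: "\<forall>xs\<in>lists \<Lambda>. length xs = m \<longrightarrow> (\<forall>l\<in>\<Lambda>. down l (w xs) \<in> pball (- 1))" for m
  proof (induction "M - m" arbitrary: m rule: less_induct)
    case less
    show ?case
    proof (cases "m < M")
      case True
      have "down l (w xs) \<in> pball (- 1)" if "xs \<in> lists \<Lambda>" "m < length xs" "l \<in> \<Lambda>" for xs l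
        using less[of "length xs"] that True by auto
      then show ?thesis using inv_B_step[OF assms(1-3), of m] by blast
    next
      case False
      then show ?thesis by (auto simp: vanish down_def)
    qed
  qed
  have "coeff (down l (w xs)) i \<in> vball (- 1)" if "l \<in> \<Lambda>" for l i
    using * assms(4) that by (auto intro!: pballD)
  then have "w xs \<in> pball (- 1 - 1)"
    using linear_decomposition(2)[of "w xs" "- 1"] degree_w[of xs] assms(1) by simp
  then show ?thesis using assms(1) by simp
qed

theorem bound:
  assumes "xs \<in> lists \<Lambda>"
  shows "w xs \<in> pball (- real d - 1)"
proof (cases "2 \<le> d \<or> v a < 1 \<or> of_nat q \<in> vball 2")
  case True
  then show ?thesis by (rule bound_A[OF _ assms])
next
  case False
  then have "d = 1" "v a = 1" "of_nat q \<notin> vball 2" using d_pos a_le by auto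
  then show ?thesis by (rule bound_B[OF _ _ _ assms])
qed

end

section \<open>Completeness of the $p$-adic numbers\<close>

lemma padic_eqI: "(\<And>n. residue x n = residue y n) \<Longrightarrow> x = y"
  by (metis residue_inject ext)

lemma residue_zero_iff:
  assumes "(x::'p::prime_card padic_int) \<noteq> 0"
  shows "residue x n = 0 \<longleftrightarrow> n \<le> padic_ord x"
proof
  show "residue x n = 0 \<Longrightarrow> n \<le> padic_ord x"
    using multiplicity_residue(1)[OF assms, of n] by force
  assume n: "n \<le> padic_ord x"
  show "residue x n = 0"
  proof (cases n)
    case 0
    then show ?thesis by (simp add: residue_0)
  next
    case (Suc j)
    then have "j < (LEAST n. residue x (Suc n) \<noteq> 0)" using n by (simp add: padic_ord_def)
    from not_less_Least[OF this] show ?thesis using Suc by simp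
  qed
qed

lemma residue_of_nat: "residue (of_nat m :: 'p::prime_card padic_int) n = int m mod int CARD('p) ^ n"
  by (induction m) (auto simp: zero_padic_int.rep_eq plus_padic_int.rep_eq one_padic_int.rep_eq mod_simps algebra_simps)

lemma padic_int_of_residues:
  fixes x :: "nat \<Rightarrow> int"
  assumes "\<And>n. 0 \<le> x n \<and> x n < int CARD('p::prime_card) ^ n" "\<And>n. x (Suc n) mod int CARD('p::prime_card) ^ n = x n"
  obtains z :: "'p::prime_card padic_int" where "\<And>n. residue z n = x n"
proof
  show "residue (Abs_padic_int x :: 'p padic_int) n = x n" for n
    using assms by (subst Abs_padic_int_inverse) auto
qed

text \<open>Inverses modulo the powers of p are unique, hence form a compatible sequence.\<close>

lemma padic_unit_inverse:
  assumes "residue (u::'p::prime_card padic_int) 1 \<noteq> 0"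
  obtains w where "u * w = 1"
proof -
  let ?p = "int CARD('p)"
  have cop: "coprime (residue u n) (?p ^ n)" for n
  proof (cases n)
    case (Suc m)
    have "residue u n mod ?p = residue u 1"
      using residue_add_mod[of u 1 m] Suc by simp
    then have "\<not> ?p dvd residue u n" using assms by auto
    then have "coprime ?p (residue u n)" using prime_int_CARD[where 'p = 'p] prime_imp_coprime by blast
    then show ?thesis by (simp add: coprime_commute)
  qed simp
  have "\<exists>y. 0 \<le> y \<and> y < ?p ^ n \<and> [residue u n * y = 1] (mod ?p ^ n)" for n
  proof -
    obtain y where y: "[residue u n * y = 1] (mod ?p ^ n)" using cong_solve_coprime_int[OF cop[of n]] by blast
    have "0 < ?p ^ n" using CARD_prime_pos[where 'p = 'p] by simp
    moreover have "[residue u n * (y mod ?p ^ n) = 1] (mod ?p ^ n)"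
      using y by (simp add: cong_def mod_simps)
    ultimately show ?thesis by (intro exI[of _ "y mod ?p ^ n"]) auto
  qed
  then obtain y where y: "\<And>n. 0 \<le> y n \<and> y n < ?p ^ n" "\<And>n. [residue u n * y n = 1] (mod ?p ^ n)" by metis
  have "y (Suc n) mod ?p ^ n = y n" for n
  proof -
    have "[residue u (Suc n) * y (Suc n) = 1] (mod ?p ^ n)"
      using y(2)[of "Suc n"] by (rule cong_dvd_modulus) (simp add: le_imp_power_dvd)
    moreover have "[residue u (Suc n) = residue u n] (mod ?p ^ n)"
      using residue_Suc_mod[of u n] residue_mod[of u n] by (simp add: cong_def)
    ultimately have "[residue u n * y (Suc n) = residue u n * y n] (mod ?p ^ n)"
      using y(2)[of n] by (metis cong_scalar_right cong_sym cong_trans)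
    then have "[y (Suc n) = y n] (mod ?p ^ n)" using cop[of n] cong_mult_lcancel by blast
    then show ?thesis using y(1)[of n] by (simp add: cong_def)
  qed
  then obtain w :: "'p padic_int" where w: "\<And>n. residue w n = y n"
    using padic_int_of_residues[of y] y(1) by blast
  have "u * w = 1"
    by (rule padic_eqI) (use y(2) in \<open>auto simp: w times_padic_int.rep_eq one_padic_int.rep_eq cong_def\<close>)
  then show ?thesis using that by blast
qed

text \<open>Division by p^s shifts the sequence of residues by s places.\<close>

lemma padic_factor:
  assumes "residue (a::'p::prime_card padic_int) s = 0"
  obtains c where "a = of_nat (CARD('p) ^ s) * c" "\<And>n. residue c n = residue a (n + s) div int CARD('p) ^ s"
proof -
  let ?p = "int CARD('p)"
  have p: "0 < ?p" using CARD_prime_pos[where 'p = 'p] .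
  have dv: "?p ^ s dvd residue a (n + s)" for n
    using residue_add_mod[of a s n] assms by (auto simp: add.commute)
  let ?x = "\<lambda>n. residue a (n + s) div ?p ^ s"
  have bound: "0 \<le> residue a n \<and> residue a n < ?p ^ n" for n
    using residue[of a] by blast
  have "0 \<le> ?x n \<and> ?x n < ?p ^ n" for n
  proof
    show "0 \<le> ?x n" using bound p by (simp add: pos_imp_zdiv_nonneg_iff)
    show "?x n < ?p ^ n"
    proof -
      obtain z where z: "residue a (n + s) = ?p ^ s * z" using dv by blast
      then have "?p ^ s * z < ?p ^ s * ?p ^ n" using bound[of "n + s"] by (simp add: power_add mult.commute)
      then show ?thesis using z p by simp
    qed
  qed
  moreover have "?x (Suc n) mod ?p ^ n = ?x n" for n
  proof -
    have r: "residue a (Suc n + s) mod ?p ^ (s + n) = residue a (n + s)"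
      using residue_Suc_mod[of a "n + s"] by (simp add: add.commute)
    obtain z where z: "residue a (Suc n + s) = ?p ^ s * z" using dv by blast
    have ps: "?p ^ s \<noteq> 0" using p by simp
    have "residue a (n + s) = ?p ^ s * (z mod ?p ^ n)"
      using r unfolding z power_add mult_mod_right by (rule sym)
    then show ?thesis unfolding z by (simp only: nonzero_mult_div_cancel_left[OF ps])
  qed
  ultimately obtain c :: "'p padic_int" where c: "\<And>n. residue c n = ?x n"
    using padic_int_of_residues[of ?x] by blast
  have "a = of_nat (CARD('p) ^ s) * c"
  proof (rule padic_eqI)
    fix n
    have "residue a n = residue a (n + s) mod ?p ^ n" using residue_add_mod[of a n s] by simp
    also have "\<dots> = (?p ^ s * ?x n) mod ?p ^ n" using dv[of n] by simp
    finally show "residue a n = residue (of_nat (CARD('p) ^ s) * c) n"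
      unfolding times_padic_int.rep_eq residue_of_nat c by (simp add: mod_simps)
  qed
  then show ?thesis using c that by blast
qed

text \<open>A power of p splits off from both elements; the remaining factor of b is a unit.\<close>

lemma padic_int_dvd:
  assumes "(b::'p::prime_card padic_int) \<noteq> 0" "residue a (padic_ord b) = 0"
  obtains c where "a = b * c"
proof -
  let ?s = "padic_ord b"
  have "residue b ?s = 0" by (simp add: residue_zero_iff assms)
  then obtain u where u: "b = of_nat (CARD('p) ^ ?s) * u" "\<And>n. residue u n = residue b (n + ?s) div int CARD('p) ^ ?s"
    using padic_factor by blast
  obtain c where c: "a = of_nat (CARD('p) ^ ?s) * c" using padic_factor[OF assms(2)] by blast
  have "residue u 1 \<noteq> 0"
  proof
    assume "residue u 1 = 0"
    moreover have "int CARD('p) ^ ?s dvd residue b (1 + ?s)"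
      using residue_add_mod[of b ?s 1] residue_zero_iff[OF assms(1), of ?s] by (auto simp: add.commute)
    ultimately have "residue b (1 + ?s) = 0" using u(2)[of 1] by auto
    then show False using residue_zero_iff[OF assms(1), of "1 + ?s"] by simp
  qed
  then obtain w where "u * w = 1" using padic_unit_inverse by blast
  then have "a = b * (w * c)" using u(1) c by (metis mult.assoc mult.commute mult_1)
  then show ?thesis using that by blast
qed

lemma padic_ord_add:
  assumes "(x::'p::prime_card padic_int) \<noteq> 0" "y \<noteq> 0" "x + y \<noteq> 0"
  shows "min (padic_ord x) (padic_ord y) \<le> padic_ord (x + y)"
proof -
  let ?n = "min (padic_ord x) (padic_ord y)"
  have "residue x ?n = 0" "residue y ?n = 0" by (simp_all add: residue_zero_iff assms)
  then have "residue (x + y) ?n = 0" by (simp add: plus_padic_int.rep_eq)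
  then show ?thesis using residue_zero_iff[OF assms(3)] by blast
qed

lemma valuation_padic_val: "valuation (\<lambda>x :: 'p::prime_card padic. real_of_int (padic_val x))"
  unfolding valuation_def
proof (intro conjI allI impI)
  fix x y :: "'p padic" assume xy: "x \<noteq> 0" "y \<noteq> 0"
  obtain a b where x: "x = Fraction_Field.Fract a b" "b \<noteq> 0" by (cases x) auto
  obtain c d where y: "y = Fraction_Field.Fract c d" "d \<noteq> 0" by (cases y) auto
  have nz: "a \<noteq> 0" "c \<noteq> 0" using xy x y by (auto simp: Zero_fract_def eq_fract)
  show "real_of_int (padic_val (x * y)) = real_of_int (padic_val x) + real_of_int (padic_val y)"
    using nz x(2) y(2) by (simp add: x(1) y(1) padic_val_Fract padic_mult_nonzero(2))
  assume "x + y \<noteq> 0"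
  then have s: "a * d + c * b \<noteq> 0" using x y by (auto simp: Zero_fract_def eq_fract)
  have "min (padic_ord (a * d)) (padic_ord (c * b)) \<le> padic_ord (a * d + c * b)"
    by (rule padic_ord_add) (use nz x(2) y(2) s in auto)
  then show "min (real_of_int (padic_val x)) (real_of_int (padic_val y)) \<le> real_of_int (padic_val (x + y))"
    using nz x(2) y(2) s by (simp add: x(1) y(1) padic_val_Fract padic_mult_nonzero(2))
qed

interpretation padic: valued_field "\<lambda>x :: 'p::prime_card padic. real_of_int (padic_val x)"
  by unfold_locales (rule valuation_padic_val)

lemma Fract_ball_iff:
  fixes z :: "'p::prime_card padic_int"
  shows "Fraction_Field.Fract z 1 \<in> padic.vball (real n) \<longleftrightarrow> residue z n = 0"
proof (cases "z = 0")
  case True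
  then show ?thesis by (simp add: zero_padic_int.rep_eq flip: Zero_fract_def)
next
  case False
  have "residue (1::'p padic_int) 1 \<noteq> 0"
    using prime_gt_1_nat[OF prime_card, where 'a1 = 'p] by (simp add: one_padic_int.rep_eq)
  then have "padic_ord (1::'p padic_int) = 0" using residue_zero_iff[of "1::'p padic_int" 1] by simp
  then have "padic_val (Fraction_Field.Fract z 1) = int (padic_ord z)"
    using False by (simp add: padic_val_Fract)
  moreover have "Fraction_Field.Fract z 1 \<noteq> 0" using False by (simp add: Zero_fract_def eq_fract)
  ultimately show ?thesis using residue_zero_iff[OF False] by (simp add: padic.vball_def)
qed

lemma padic_ball0_Fract:
  fixes x :: "'p::prime_card padic"
  assumes "x \<in> padic.vball 0"
  obtains z where "x = Fraction_Field.Fract z 1"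
proof -
  obtain a b where x: "x = Fraction_Field.Fract a b" "b \<noteq> 0" by (cases x) auto
  have "residue a (padic_ord b) = 0"
  proof (cases "a = 0")
    case False
    then have "x \<noteq> 0" using x by (simp add: Zero_fract_def eq_fract)
    then have "padic_ord b \<le> padic_ord a"
      using assms False x by (simp add: padic.vball_def padic_val_Fract)
    then show ?thesis by (simp add: residue_zero_iff False)
  qed (simp add: zero_padic_int.rep_eq)
  then obtain c where "a = b * c" using padic_int_dvd[OF x(2)] by blast
  then have "x = Fraction_Field.Fract c 1" using x by (simp add: eq_fract mult.commute)
  then show ?thesis using that by blast
qed

text \<open>After subtraction of the first term all terms are p-adic integers. The residue at place
  n is constant from the n-th term on, and the diagonal of residues is the limit.\<close>

lemma padic_complete:
  fixes x :: "nat \<Rightarrow> 'p::prime_card padic"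
  assumes "\<And>m n. n \<le> m \<Longrightarrow> x m - x n \<in> padic.vball (real n)"
  obtains y where "\<And>n. y - x n \<in> padic.vball (real n)"
proof -
  have "\<exists>z. x n - x 0 = Fraction_Field.Fract z 1" for n
    using padic_ball0_Fract[of "x n - x 0"] assms[of 0 n] by auto
  then obtain z where z: "\<And>n. x n - x 0 = Fraction_Field.Fract (z n) 1" by metis
  have diff: "Fraction_Field.Fract u 1 - Fraction_Field.Fract w 1 = Fraction_Field.Fract (u - w) 1" for u w :: "'p padic_int"
    by simp
  have r: "residue (u - w) n = 0 \<longleftrightarrow> residue u n = residue w n" for u w :: "'p padic_int" and n
  proof -
    have "residue (u - w) n = 0 \<longleftrightarrow> residue u n mod int CARD('p) ^ n = residue w n mod int CARD('p) ^ n"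
      unfolding minus_padic_int.rep_eq by (simp add: mod_eq_dvd_iff dvd_eq_mod_eq_0)
    then show ?thesis by (simp add: residue_mod)
  qed
  have zz: "residue (z m) n = residue (z n) n" if "n \<le> m" for m n
  proof -
    have "x m - x n = Fraction_Field.Fract (z m - z n) 1"
      using z[of m] z[of n] diff by (metis diff_diff_eq2 diff_add_cancel)
    then show ?thesis using assms[OF that] Fract_ball_iff r by metis
  qed
  have "0 \<le> residue (z n) n \<and> residue (z n) n < int CARD('p) ^ n" for n using residue[of "z n"] by blast
  moreover have "residue (z (Suc n)) (Suc n) mod int CARD('p) ^ n = residue (z n) n" for n
    using residue_Suc_mod[of "z (Suc n)" n] zz[of n "Suc n"] by simp
  ultimately obtain u :: "'p padic_int" where u: "\<And>n. residue u n = residue (z n) n"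
    using padic_int_of_residues[of "\<lambda>n. residue (z n) n"] by blast
  have "(x 0 + Fraction_Field.Fract u 1) - x n \<in> padic.vball (real n)" for n
  proof -
    have "(x 0 + Fraction_Field.Fract u 1) - x n = Fraction_Field.Fract (u - z n) 1"
      using z[of n] diff by (metis add_diff_eq diff_add_eq diff_diff_eq2 add.commute)
    then show ?thesis using Fract_ball_iff r u by metis
  qed
  then show ?thesis using that by blast
qed

section \<open>Finite extensions of the $p$-adic numbers\<close>

text \<open>The vector space notions are unfolded into sums, in the form needed to adjoin basis
  elements one at a time.\<close>

lemma extension_basis:
  fixes j :: "'k::field \<Rightarrow> 'l::field"
  assumes "finite_extension j"
  obtains B where "finite B" "\<And>x. \<exists>c. x = (\<Sum>b\<in>B. j (c b) * b)"
    "\<And>S b c. S \<subseteq> B \<Longrightarrow> b \<in> B - S \<Longrightarrow> b \<noteq> (\<Sum>s\<in>S. j (c s) * s)"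
proof -
  obtain B where "finite_dimensional_vector_space (\<lambda>a x. j a * x) B"
    using assms by (auto simp: finite_extension_def)
  then interpret V: finite_dimensional_vector_space "\<lambda>a x. j a * x" B .
  show thesis
  proof
    show "finite B" by (rule V.finite_Basis)
    fix x
    have "x \<in> V.span B" by (simp add: V.span_Basis)
    then show "\<exists>c. x = (\<Sum>b\<in>B. j (c b) * b)"
      unfolding V.span_finite[OF V.finite_Basis] by auto
  next
    fix S b c assume S: "S \<subseteq> B" "b \<in> B - S"
    show "b \<noteq> (\<Sum>s\<in>S. j (c s) * s)"
    proof
      assume "b = (\<Sum>s\<in>S. j (c s) * s)"
      then have "b \<in> V.span S" using V.span_sum V.span_scale V.span_base by (metis (no_types, lifting))
      then have "b \<in> V.span (B - {b})" using V.span_mono[of S "B - {b}"] S by blast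
      then show False using V.independent_Basis S by (auto simp: V.dependent_def)
    qed
  qed
qed

text \<open>Meant for F with its own valuation and also with the valuation of C pulled back along an
  embedding, so that the two can be compared.\<close>

locale padic_extension = valued_field v for v :: "'f::field \<Rightarrow> real" +
  fixes j :: "'p::prime_card padic \<Rightarrow> 'f" and e :: real
  assumes j_ext: "finite_extension j" and e_pos: "0 < e"
    and v_j: "\<And>x. x \<noteq> 0 \<Longrightarrow> v (j x) = e * real_of_int (padic_val x)"
begin

sublocale j: comm_ring_hom j
  using j_ext by (simp add: finite_extension_def)

lemma j_eq_0_iff: "j x = 0 \<longleftrightarrow> x = 0"
proof
  assume "j x = 0"
  then have "j (x * inverse x) = 0" by (simp add: j.hom_mult)
  then show "x = 0" by (metis j.hom_one one_neq_zero right_inverse)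
qed simp

lemma j_ball: "j x \<in> vball t \<longleftrightarrow> x \<in> padic.vball (t / e)"
  using e_pos by (cases "x = 0") (auto simp: vball_def padic.vball_def j_eq_0_iff v_j field_simps)

definition comb :: "'f set \<Rightarrow> ('f \<Rightarrow> 'p padic) \<Rightarrow> 'f" where
  "comb S x = (\<Sum>s\<in>S. j (x s) * s)"

lemma comb_diff: "comb S (\<lambda>s. x s - y s) = comb S x - comb S y"
  by (simp add: comb_def j.hom_minus left_diff_distrib sum_subtractf)

text \<open>One half of the equivalence of norms in finite dimension: passing from an element to its
  coordinates loses at most c. The other half is \<open>comb_ball\<close>.\<close>

definition bounded_coords :: "'f set \<Rightarrow> real \<Rightarrow> bool" where
  "bounded_coords S c \<longleftrightarrow> (\<forall>x t. comb S x \<in> vball t \<longrightarrow> (\<forall>s\<in>S. j (x s) \<in> vball (t - c)))"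

lemma finite_ball_bound: "finite S \<Longrightarrow> \<exists>c. S \<subseteq> vball c"
proof (induction S rule: finite_induct)
  case (insert a S)
  then obtain c where "S \<subseteq> vball c" by blast
  then have "insert a S \<subseteq> vball (min c (v a))"
    by (auto intro: ball_mono ballI)
  then show ?case by blast
qed simp

lemma comb_ball:
  assumes "S \<subseteq> vball c" "\<And>s. s \<in> S \<Longrightarrow> j (x s) \<in> vball t"
  shows "comb S x \<in> vball (t + c)"
  unfolding comb_def by (intro ball_sum ball_mult) (use assms in auto)

text \<open>Coordinatewise limits. Closeness to the limit is asserted along a subsequence, which is
  enough for a Cauchy sequence.\<close>

lemma comb_complete:
  assumes S: "finite S" "bounded_coords S c"
    and X: "\<And>m n. n \<le> m \<Longrightarrow> comb S (x m) - comb S (x n) \<in> vball (real n)"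
  obtains y where "\<And>K::nat. \<exists>n\<ge>K. comb S y - comb S (x n) \<in> vball (real K)"
proof -
  obtain b where b: "S \<subseteq> vball b" using finite_ball_bound[OF S(1)] by blast
  \<comment> \<open>The index is so large that, after the loss c and the rescaling by e, the
    coordinates are Cauchy at rate n.\<close>
  define f where "f n = nat \<lceil>e * real n + c\<rceil>" for n
  have f: "e * real n + c \<le> real (f n)" for n unfolding f_def by linarith
  have f_mono: "f n \<le> f m" if "n \<le> m" for m n
    unfolding f_def using that e_pos by (intro nat_mono ceiling_mono) (simp add: mult_left_mono)
  have "\<exists>y. \<forall>n. y - x (f n) s \<in> padic.vball (real n)" if s: "s \<in> S" for s
  proof -
    have "x (f m) s - x (f n) s \<in> padic.vball (real n)" if "n \<le> m" for m n
    proof -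
      have "comb S (\<lambda>s. x (f m) s - x (f n) s) \<in> vball (real (f n))"
        using X[OF f_mono[OF that]] by (simp add: comb_diff)
      then have "j (x (f m) s - x (f n) s) \<in> vball (real (f n) - c)"
        using S(2) s unfolding bounded_coords_def by blast
      then have "j (x (f m) s - x (f n) s) \<in> vball (e * real n)"
        by (rule ball_mono) (use f[of n] in simp)
      then show ?thesis using e_pos by (simp add: j_ball)
    qed
    then show ?thesis using padic_complete[of "\<lambda>n. x (f n) s"] by metis
  qed
  then obtain y where y: "\<And>s n. s \<in> S \<Longrightarrow> y s - x (f n) s \<in> padic.vball (real n)" by metis
  have lim: "comb S y - comb S (x (f n)) \<in> vball (e * real n + b)" for n
    unfolding comb_diff[symmetric]
    by (rule comb_ball[OF b]) (use y e_pos in \<open>simp add: j_ball\<close>)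
  have "\<exists>n\<ge>K. comb S y - comb S (x n) \<in> vball (real K)" for K :: nat
  proof -
    obtain n where n: "(real K + \<bar>b\<bar> + \<bar>c\<bar>) / e < real n" using reals_Archimedean2 by blast
    then have "real K + \<bar>b\<bar> + \<bar>c\<bar> < e * real n" using e_pos by (simp add: field_simps)
    then have "real K \<le> real (f n)" "real K \<le> e * real n + b" using f[of n] by linarith+
    then show ?thesis using ball_mono[OF lim[of n], of "real K"] by auto
  qed
  then show ?thesis using that by blast
qed

text \<open>The span of S is complete, hence closed, so b has positive distance from it. Dividing a
  combination by the coordinate at b bounds this coordinate, and then the induction hypothesis
  bounds the others.\<close>

lemma bounded_coords_insert:
  assumes S: "finite S" "bounded_coords S c" "b \<notin> S" and b: "\<And>x. b \<noteq> comb S x"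
  shows "\<exists>c'. bounded_coords (insert b S) c'"
proof -
  have "\<exists>c0. \<forall>x. b - comb S x \<notin> vball c0"
  proof (rule ccontr)
    assume "\<not> ?thesis"
    then have "\<forall>n::nat. \<exists>x. b - comb S x \<in> vball (real n)" by blast
    then obtain x where x: "\<And>n::nat. b - comb S (x n) \<in> vball (real n)" by metis
    have "comb S (x m) - comb S (x n) \<in> vball (real n)" if "n \<le> m" for m n
      using ball_diff[OF x[of n] ball_mono[OF x[of m], of "real n"]] that by simp
    then obtain y where y: "\<And>K::nat. \<exists>n\<ge>K. comb S y - comb S (x n) \<in> vball (real K)"
      using comb_complete[OF S(1,2)] by blast
    have "b - comb S y \<in> vball (real K)" for K :: nat
    proof -
      obtain n where n: "K \<le> n" "comb S y - comb S (x n) \<in> vball (real K)" using y by blast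
      from ball_diff[OF ball_mono[OF x[of n], of "real K"] n(2)] n(1) show ?thesis by simp
    qed
    then have "b - comb S y = 0" by (rule ball_eq_zero)
    then show False using b[of y] by simp
  qed
  then obtain c0 where c0: "\<And>x. b - comb S x \<notin> vball c0" by blast
  \<comment> \<open>The coordinate at b loses c0. The others lose c and whatever is lost by moving
    the term at b to the other side, which is at most c0 - v(b).\<close>
  define c' where "c' = max c0 (c + max 0 (c0 - v b))"
  have "j (x s) \<in> vball (t - c')" if t: "comb (insert b S) x \<in> vball t" and s: "s \<in> insert b S" for x t s
  proof -
    let ?T = "comb (insert b S) x"
    have T: "?T = j (x b) * b + comb S x" using S by (simp add: comb_def)
    have xb: "j (x b) \<in> vball (t - c0)"
    proof (cases "x b = 0")
      case False
      then have nz: "j (x b) \<noteq> 0" by (simp add: j_eq_0_iff)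
      have "j (y / x b) = j y / j (x b)" for y
        using False nz j.hom_mult[of "y / x b" "x b"] by (simp add: field_simps)
      then have "comb S (\<lambda>s. - (x s / x b)) = - (comb S x / j (x b))"
        by (simp add: comb_def j.hom_uminus sum_negf sum_divide_distrib)
      then have "b - comb S (\<lambda>s. - (x s / x b)) = ?T / j (x b)"
        using nz by (simp add: T field_simps)
      then have "b - comb S (\<lambda>s. - (x s / x b)) \<in> vball (t - v (j (x b)))"
        using ball_divide[OF t nz] by simp
      then have "t - v (j (x b)) < c0" using c0 ball_mono by (meson not_le)
      then show ?thesis by (intro ballI) simp
    qed simp
    show ?thesis
    proof (cases "s = b")
      case True
      then show ?thesis using ball_mono[OF xb, of "t - c'"] by (simp add: c'_def)
    next
      case False
      let ?t = "min t (t - c0 + v b)"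
      have "j (x b) * b \<in> vball ?t" by (rule ball_mult_le[OF xb ballI[OF order.refl]]) simp
      from ball_diff[OF ball_mono[OF t] this] have "comb S x \<in> vball ?t" by (simp add: T)
      then have "j (x s) \<in> vball (?t - c)" using S(2) s False by (auto simp: bounded_coords_def)
      then show ?thesis by (rule ball_mono) (auto simp: c'_def)
    qed
  qed
  then show ?thesis unfolding bounded_coords_def by blast
qed

lemma coordinates:
  obtains B c b where "finite B" "bounded_coords B c" "B \<subseteq> vball b" "\<And>x. \<exists>y. x = comb B y"
proof -
  obtain B where B: "finite B" "\<And>x. \<exists>c. x = (\<Sum>b\<in>B. j (c b) * b)"
    "\<And>S b c. S \<subseteq> B \<Longrightarrow> b \<in> B - S \<Longrightarrow> b \<noteq> (\<Sum>s\<in>S. j (c s) * s)"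
    using extension_basis[OF j_ext] by metis
  have "\<exists>c. bounded_coords S c" if "finite S" "S \<subseteq> B" for S
    using that
  proof (induction S rule: finite_induct)
    case empty
    then show ?case by (simp add: bounded_coords_def)
  next
    case (insert b S)
    then obtain c where c: "bounded_coords S c" by blast
    show ?case
      by (rule bounded_coords_insert[OF insert.hyps(1) c insert.hyps(2)])
        (use insert B(3)[of S b] in \<open>auto simp: comb_def\<close>)
  qed
  then obtain c where "bounded_coords B c" using B(1) by blast
  then show ?thesis using that B(1,2) finite_ball_bound[OF B(1)] unfolding comb_def by metis
qed

lemma complete:
  assumes X: "\<And>m n. n \<le> m \<Longrightarrow> X m - X n \<in> vball (real n)"
  obtains Y where "\<And>K::nat. \<exists>n\<ge>K. Y - X n \<in> vball (real K)"
proof -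
  obtain B c where B: "finite B" "bounded_coords B c" "\<And>x. \<exists>y. x = comb B y" using coordinates by metis
  have "\<forall>n. \<exists>y. X n = comb B y" using B(3) by blast
  then obtain x where x: "\<And>n. X n = comb B (x n)" by metis
  have "comb B (x m) - comb B (x n) \<in> vball (real n)" if "n \<le> m" for m n
    using X[OF that] by (simp add: x)
  then obtain y where "\<And>K::nat. \<exists>n\<ge>K. comb B y - comb B (x n) \<in> vball (real K)"
    using comb_complete[OF B(1,2), of x] by blast
  then show ?thesis using that[of "comb B y"] by (simp add: x)
qed

text \<open>Both valuations are compared with the same coordinates, hence differ by a constant
  independent of the element. Applied to the powers of x, this leaves no room for a difference at
  x.\<close>

lemma v_le_unique:
  assumes "padic_extension v' j e" "x \<noteq> 0"
  shows "v x \<le> v' x"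
proof (rule ccontr)
  interpret W: padic_extension v' j e by (rule assms(1))
  assume "\<not> v x \<le> v' x"
  obtain B c where B: "finite B" "bounded_coords B c" "\<And>x. \<exists>y. x = comb B y" using coordinates by metis
  obtain b where b: "B \<subseteq> W.vball b" using W.finite_ball_bound[OF B(1)] by blast
  have *: "t - c + b \<le> v' z" if "z \<noteq> 0" "t \<le> v z" for z t
  proof -
    obtain y where y: "z = comb B y" using B(3) by blast
    then have "comb B y \<in> vball t" using that by (simp add: vball_def)
    then have "j (y s) \<in> vball (t - c)" if "s \<in> B" for s using B(2) that by (simp add: bounded_coords_def)
    then have "j (y s) \<in> W.vball (t - c)" if "s \<in> B" for s using that by (simp add: j_ball W.j_ball)
    then have "W.comb B y \<in> W.vball (t - c + b)" by (rule W.comb_ball[OF b])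
    then show ?thesis using y that by (simp add: comb_def W.comb_def W.vball_def)
  qed
  define \<delta> where "\<delta> = v x - v' x"
  have \<delta>: "0 < \<delta>" using \<open>\<not> v x \<le> v' x\<close> by (simp add: \<delta>_def)
  obtain n where n: "(c - b) / \<delta> < real n" using reals_Archimedean2 by blast
  have "real n * v x - c + b \<le> real n * v' x"
    using *[of "x ^ n" "real n * v x"] assms(2) by (simp add: v_power W.v_power)
  then have "real n * \<delta> \<le> c - b" by (simp add: \<delta>_def algebra_simps)
  then show False using n \<delta> by (simp add: field_simps)
qed

end

lemma valuation_unique:
  assumes "padic_extension v j e" "padic_extension v' j e" "x \<noteq> 0"
  shows "v x = v' x"
  using padic_extension.v_le_unique[OF assms] padic_extension.v_le_unique[OF assms(2,1,3)] by simp

section \<open>Residues and digits in $F$\<close>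

text \<open>The lower bound on \<open>residue_card\<close> also contains the finiteness of the
  residue field, since \<open>card\<close> is 0 on infinite sets. In the theorem it follows from 1
  \<le> d < q / 2.\<close>

locale hecke_data =
  fixes D :: "('p::prime_card, 'f::field, 'c::field) padic_data"
  assumes setting: "padic_setting D" and residue_card_ge: "3 \<le> residue_card D"
begin

abbreviation \<open>q \<equiv> residue_card D\<close>

abbreviation \<open>\<pi> \<equiv> unif D\<close>

sublocale F: valued_field "\<lambda>x. real_of_int (val_F D x)"
proof
  have "valuation (val_F D)" using setting by (simp add: padic_setting_def)
  then show "valuation (\<lambda>x. real_of_int (val_F D x))"
    unfolding valuation_def by (metis of_int_add of_int_le_iff of_int_min)
qed

sublocale C: valued_field "val_C D"
  using setting by unfold_locales (simp add: padic_setting_def)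

lemma O_F_eq: "O_F D = F.vball 0"
  by (simp add: val_ring_def F.vball_def)

lemma O_C_eq: "O_C D = C.vball 0"
  by (simp add: val_ring_def C.vball_def)

lemma val_ideal_eq: "val_ideal (val_F D) = F.vball 1"
  by (auto simp: val_ideal_def F.vball_def)

lemma unif: "\<pi> \<noteq> 0" "val_F D \<pi> = 1"
  using setting by (auto simp: padic_setting_def)

lemma unif_ball: "\<pi> \<in> F.vball 1"
  by (simp add: F.vball_def unif)

lemma unif_power_ball_iff: "\<pi> ^ n * x \<in> F.vball t \<longleftrightarrow> x \<in> F.vball (t - real n)"
  using F.ball_mult_cancel'[of "\<pi> ^ n" x t] F.v_power[of \<pi> n] unif by simp

text \<open>The common factor e makes the valuation of F and its pullbacks from C extend the same
  function on Q_p; uniqueness of extensions then identifies them.\<close>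

lemma ramification:
  obtains e :: real where "padic_extension (\<lambda>x. real_of_int (val_F D x)) (emb_F D) e"
    "\<And>\<sigma>. \<sigma> \<in> Emb D \<Longrightarrow> padic_extension (\<lambda>x. val_C D (\<sigma> x)) (emb_F D) e"
proof -
  obtain e :: int where e: "e > 0" "\<And>x. x \<noteq> 0 \<Longrightarrow> val_F D (emb_F D x) = e * padic_val x
      \<and> val_C D (emb_C D x) = real_of_int (e * padic_val x)"
    using setting by (auto simp: padic_setting_def)
  have ext: "finite_extension (emb_F D)" using setting by (simp add: padic_setting_def)
  have 1: "padic_extension (\<lambda>x. real_of_int (val_F D x)) (emb_F D) (real_of_int e)"
    by unfold_locales (use ext e in auto)
  have 2: "padic_extension (\<lambda>x. val_C D (\<sigma> x)) (emb_F D) (real_of_int e)" if \<sigma>: "\<sigma> \<in> Emb D" for \<sigma>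
  proof unfold_locales
    interpret \<sigma>: comm_ring_hom \<sigma> using \<sigma> by (simp add: Emb_def)
    have nz: "\<sigma> x \<noteq> 0" if "x \<noteq> 0" for x
      using that \<sigma>.hom_mult[of x "inverse x"] by auto
    show "valuation (\<lambda>x. val_C D (\<sigma> x))"
      unfolding valuation_def \<sigma>.hom_mult \<sigma>.hom_add
      using C.v_mult C.v_add nz by (metis \<sigma>.hom_add)
    show "val_C D (\<sigma> (emb_F D x)) = real_of_int e * real_of_int (padic_val x)" if "x \<noteq> 0" for x
      using \<sigma> e(2)[OF that] by (simp add: Emb_def)
  qed (use ext e in auto)
  show ?thesis using that[OF 1 2] by blast
qed

lemma Emb_hom: "\<sigma> \<in> Emb D \<Longrightarrow> comm_ring_hom \<sigma>"
  by (simp add: Emb_def)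

lemma Emb_eq_0_iff:
  assumes "\<sigma> \<in> Emb D"
  shows "\<sigma> x = 0 \<longleftrightarrow> x = 0"
proof -
  interpret comm_ring_hom \<sigma> by (rule Emb_hom[OF assms])
  show ?thesis using hom_mult[of x "inverse x"] by (cases "x = 0") auto
qed

lemma val_C_Emb:
  assumes "\<sigma> \<in> Emb D" "x \<noteq> 0"
  shows "val_C D (\<sigma> x) = real_of_int (val_F D x)"
proof -
  obtain e :: real where e: "padic_extension (\<lambda>x. real_of_int (val_F D x)) (emb_F D) e"
    "padic_extension (\<lambda>x. val_C D (\<sigma> x)) (emb_F D) e"
    using ramification assms(1) by metis
  show ?thesis by (rule valuation_unique[OF e(2,1) assms(2)])
qed

lemma Emb_ball: "\<sigma> \<in> Emb D \<Longrightarrow> \<sigma> x \<in> C.vball t \<longleftrightarrow> x \<in> F.vball t"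
  by (cases "x = 0") (auto simp: C.vball_def F.vball_def val_C_Emb Emb_eq_0_iff)

lemma F_complete:
  assumes "\<And>m n. n \<le> m \<Longrightarrow> X m - X n \<in> F.vball (real n)"
  obtains Y where "\<And>K::nat. \<exists>n\<ge>K. Y - X n \<in> F.vball (real K)"
proof -
  obtain e :: real where "padic_extension (\<lambda>x. real_of_int (val_F D x)) (emb_F D) e"
    using ramification by metis
  then interpret padic_extension "\<lambda>x. real_of_int (val_F D x)" "emb_F D" e .
  show ?thesis using complete[of X] assms that by blast
qed

section \<open>Residue classes and Teichmueller representatives\<close>

definition cls :: "'f \<Rightarrow> 'f set" where "cls x = {y. y - x \<in> F.vball 1}"

lemma residue_field_eq: "residue_field D = cls ` F.vball 0"
  by (simp add: residue_field_def cls_def val_ideal_eq O_F_eq)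

lemma finite_residue_field: "finite (residue_field D)"
  using residue_card_ge unfolding residue_card_def by (intro card_ge_0_finite) simp

lemma in_cls: "y \<in> cls x \<longleftrightarrow> y - x \<in> F.vball 1"
  by (simp add: cls_def)

lemma cls_eq_iff: "cls x = cls y \<longleftrightarrow> x - y \<in> F.vball 1"
proof
  assume "cls x = cls y"
  moreover have "x \<in> cls x" by (simp add: in_cls)
  ultimately show "x - y \<in> F.vball 1" by (simp add: in_cls)
next
  assume xy: "x - y \<in> F.vball 1"
  have "z - x \<in> F.vball 1 \<longleftrightarrow> z - y \<in> F.vball 1" for z
    using F.ball_add[OF _ xy, of "z - x"] F.ball_diff[OF _ xy, of "z - y"] by auto
  then show "cls x = cls y" by (simp add: cls_def)
qed

text \<open>Used twice. An arbitrary choice of representatives already yields the Frobenius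
  congruence and the smallness of q, from which the Teichmueller representatives are constructed;
  afterwards the lemma is applied to these.\<close>

lemma residue_system_section:
  assumes "\<And>\<mu>. \<mu> \<in> residue_field D \<Longrightarrow> t \<mu> \<in> \<mu>"
  shows "residue_system (\<lambda>x. real_of_int (val_F D x)) \<pi> (F.vball 0) (t ` residue_field D)"
    and "card (t ` residue_field D) = q" and "inj_on t (residue_field D)"
proof -
  have cls_t: "cls (t \<mu>) = \<mu>" if "\<mu> \<in> residue_field D" for \<mu>
  proof -
    obtain x where x: "\<mu> = cls x" using \<open>\<mu> \<in> residue_field D\<close> by (auto simp: residue_field_eq)
    then have "t \<mu> - x \<in> F.vball 1" using assms[OF that] by (simp add: in_cls)
    then show ?thesis using cls_eq_iff x by blast
  qed
  show inj: "inj_on t (residue_field D)" by (rule inj_on_inverseI[of _ cls]) (rule cls_t)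
  show card: "card (t ` residue_field D) = q" by (simp add: card_image[OF inj] residue_card_def)
  show "residue_system (\<lambda>x. real_of_int (val_F D x)) \<pi> (F.vball 0) (t ` residue_field D)"
  proof
    fix x assume x: "x \<in> F.vball 0"
    then have "cls x \<in> residue_field D" by (simp add: residue_field_eq)
    moreover from assms[OF this] have "x - t (cls x) \<in> F.vball 1"
      using F.ball_minus_commute by (auto simp: in_cls)
    ultimately show "\<exists>l\<in>t ` residue_field D. x - l \<in> F.vball 1" by blast
  next
    show "t ` residue_field D \<subseteq> F.vball 0"
    proof
      fix y assume "y \<in> t ` residue_field D"
      then obtain x where x: "x \<in> F.vball 0" "y = t (cls x)" by (auto simp: residue_field_eq)
      then have "y - x \<in> F.vball 0"
        using assms[of "cls x"] F.ball_mono[of _ 1 0] by (auto simp: residue_field_eq in_cls)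
      then show "y \<in> F.vball 0" using F.ball_cong_diff x by blast
    qed
  next
    fix l l' assume "l \<in> t ` residue_field D" "l' \<in> t ` residue_field D" "l - l' \<in> F.vball 1"
    then obtain \<mu> \<nu> where "\<mu> \<in> residue_field D" "\<nu> \<in> residue_field D" "l = t \<mu>" "l' = t \<nu>" by blast
    then show "l = l'" using cls_t[of \<mu>] cls_t[of \<nu>] cls_eq_iff[of l l'] \<open>l - l' \<in> F.vball 1\<close> by simp
  next
    show "x * y \<in> F.vball 0" if "x \<in> F.vball 0" "y \<in> F.vball 0" for x y
      using F.ball_mult[OF that] by simp
    show "3 \<le> card (t ` residue_field D)" using card residue_card_ge by simp
    show "finite (t ` residue_field D)" using finite_residue_field by simp
  qed (simp_all add: unif F.ball_add)
qed

lemma frobenius_F: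
  assumes "x \<in> F.vball 0"
  shows "x ^ q - x \<in> F.vball 1" and "of_nat q \<in> F.vball 1"
proof -
  have "(SOME y. y \<in> \<mu>) \<in> \<mu>" if "\<mu> \<in> residue_field D" for \<mu>
  proof (rule someI_ex)
    obtain x where "\<mu> = cls x" using \<open>\<mu> \<in> residue_field D\<close> by (auto simp: residue_field_eq)
    then show "\<exists>y. y \<in> \<mu>" by (auto simp: in_cls intro: exI[of _ x])
  qed
  note R = residue_system_section[OF this]
  interpret R: residue_system "\<lambda>x. real_of_int (val_F D x)" \<pi> "F.vball 0" "(\<lambda>\<mu>. SOME y. y \<in> \<mu>) ` residue_field D"
    by (rule R(1))
  show "x ^ q - x \<in> F.vball 1" using R.frobenius[OF assms] R(2) by simp
  show "of_nat q \<in> F.vball 1" using R.q_ball R(2) by simp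
qed

text \<open>The cofactor is a sum of q terms, all congruent to y^(q - 1), and q lies in the maximal
  ideal. This contraction gives both the convergence of the powers x^(q^n) and the uniqueness of a
  fixed point within a class.\<close>

lemma power_q_contracts:
  assumes x: "x \<in> F.vball 0" and y: "y \<in> F.vball 0" and xy: "x - y \<in> F.vball t" "1 \<le> t"
  obtains s where "x ^ q - y ^ q = (x - y) * s" "s \<in> F.vball 1"
proof
  let ?s = "\<Sum>i<q. y ^ (q - Suc i) * x ^ i"
  show "x ^ q - y ^ q = (x - y) * ?s" by (rule power_diff_sumr2)
  have "y ^ (q - Suc i) * x ^ i - y ^ (q - 1) \<in> F.vball 1" if "i < q" for i
  proof -
    have "q - 1 = (q - Suc i) + i" using that by simp
    then have e: "y ^ (q - Suc i) * x ^ i - y ^ (q - 1) = y ^ (q - Suc i) * (x ^ i - y ^ i)"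
      by (simp only: power_add right_diff_distrib)
    show ?thesis unfolding e
      by (rule F.ball_mult_le[OF F.ball_power0[OF y] F.power_cong_ball[OF x y F.ball_mono[OF xy]]]) simp
  qed
  then have "(\<Sum>i<q. y ^ (q - Suc i) * x ^ i - y ^ (q - 1)) \<in> F.vball 1"
    by (intro F.ball_sum) auto
  moreover have "of_nat q * y ^ (q - 1) \<in> F.vball 1"
    by (rule F.ball_mult_le[OF frobenius_F(2)[OF x] F.ball_power0[OF y]]) simp
  ultimately have "(\<Sum>i<q. y ^ (q - Suc i) * x ^ i - y ^ (q - 1)) + of_nat q * y ^ (q - 1) \<in> F.vball 1"
    by (rule F.ball_add)
  then show "?s \<in> F.vball 1" by (simp add: sum_subtractf)
qed

lemma teichmueller_exists:
  assumes x: "x \<in> F.vball 0"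
  obtains t where "t - x \<in> F.vball 1" "t ^ q = t"
proof -
  define X where "X n = x ^ (q ^ n)" for n
  have Xb: "X n \<in> F.vball 0" for n unfolding X_def by (rule F.ball_power0[OF x])
  have X_Suc: "X (Suc n) = X n ^ q" for n by (simp add: X_def power_mult[symmetric] mult.commute)
  have incr: "X (Suc n) - X n \<in> F.vball (real n + 1)" for n
  proof (induction n)
    case 0
    show ?case using frobenius_F(1)[OF x] by (simp add: X_def)
  next
    case (Suc n)
    obtain s where s: "X (Suc n) ^ q - X n ^ q = (X (Suc n) - X n) * s" "s \<in> F.vball 1"
      using power_q_contracts[OF Xb Xb Suc.IH] by auto
    have eq: "X (Suc (Suc n)) - X (Suc n) = (X (Suc n) - X n) * s" using s(1) by (simp only: X_Suc)
    show ?case unfolding eq by (rule F.ball_mult_le[OF Suc.IH s(2)]) simp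
  qed
  have cauchy: "X m - X n \<in> F.vball (real n + 1)" if "n \<le> m" for m n
    using that
  proof (induction m rule: dec_induct)
    case (step m)
    have "X (Suc m) - X m \<in> F.vball (real n + 1)"
      by (rule F.ball_mono[OF incr]) (use step in simp)
    from F.ball_add[OF this step.IH] show ?case by simp
  qed simp
  have "X m - X n \<in> F.vball (real n)" if "n \<le> m" for m n
    by (rule F.ball_mono[OF cauchy[OF that]]) simp
  then obtain t where t: "\<And>K::nat. \<exists>n\<ge>K. t - X n \<in> F.vball (real K)"
    using F_complete[of X] by blast
  obtain n where n: "1 \<le> n" "t - X n \<in> F.vball 1" using t[of 1] by auto
  have "t - X n + (X n - X 0) \<in> F.vball 1"
    by (rule F.ball_add[OF n(2) F.ball_mono[OF cauchy]]) auto
  then have tx: "t - x \<in> F.vball 1" by (simp add: X_def)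
  then have tb: "t \<in> F.vball 0" using F.ball_cong_diff[OF F.ball_mono[OF tx]] x by simp
  have "t ^ q - t \<in> F.vball (real K)" for K :: nat
  proof -
    obtain n where n: "K \<le> n" "t - X n \<in> F.vball (real K)" using t by blast
    have 1: "t ^ q - X n ^ q \<in> F.vball (real K)" by (rule F.power_cong_ball[OF tb Xb n(2)])
    have 2: "X n ^ q - X n \<in> F.vball (real K)"
      using F.ball_mono[OF incr[of n], of "real K"] n(1) by (simp add: X_Suc)
    from F.ball_diff[OF F.ball_add[OF 1 2] n(2)] show ?thesis by simp
  qed
  then have "t ^ q - t = 0" by (rule F.ball_eq_zero)
  then show ?thesis using that tx by simp
qed

lemma teichmueller_unique:
  assumes "x \<in> F.vball 0" "y \<in> F.vball 0" "x - y \<in> F.vball 1" "x ^ q = x" "y ^ q = y"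
  shows "x = y"
proof -
  obtain s where s: "x ^ q - y ^ q = (x - y) * s" "s \<in> F.vball 1"
    using power_q_contracts[OF assms(1-3)] by auto
  have "(x - y) * (1 - s) = 0" using s(1) assms(4,5) by (simp add: algebra_simps)
  moreover have "1 - s \<noteq> 0" using s(2) F.v_one by (auto simp: F.vball_def)
  ultimately show ?thesis by simp
qed

lemma teich:
  assumes "\<mu> \<in> residue_field D"
  shows "teich D \<mu> \<in> \<mu>" and "teich D \<mu> ^ q = teich D \<mu>"
proof -
  obtain x where x: "x \<in> F.vball 0" "\<mu> = cls x" using assms by (auto simp: residue_field_eq)
  obtain t where t: "t - x \<in> F.vball 1" "t ^ q = t" using teichmueller_exists[OF x(1)] by blast
  have "t \<in> \<mu> \<and> t ^ q = t" using t x by (simp add: in_cls)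
  moreover have "u = t" if u: "u \<in> \<mu> \<and> u ^ q = u" for u
  proof (rule teichmueller_unique)
    have b: "y \<in> F.vball 0" if "y \<in> \<mu>" for y
      using that x F.ball_cong_diff[of y x 0] F.ball_mono[of "y - x" 1 0] by (simp add: in_cls)
    show "u \<in> F.vball 0" "t \<in> F.vball 0" using b u t x by (auto simp: in_cls)
    show "u - t \<in> F.vball 1" using u t(1) x F.ball_diff[of "u - x" 1 "t - x"] by (simp add: in_cls)
  qed (use u t in auto)
  ultimately have "teich D \<mu> \<in> \<mu> \<and> teich D \<mu> ^ q = teich D \<mu>"
    unfolding teich_def by (rule theI2) auto
  then show "teich D \<mu> \<in> \<mu>" "teich D \<mu> ^ q = teich D \<mu>" by auto
qed

section \<open>Digit expansions\<close>

lemma digits_0: "digits D 0 = {0}"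
  by (auto simp: digits_def)

text \<open>Horner form: splitting off the lowest digit instead of the highest makes covering and
  uniqueness inductions over n with division by \<pi>.\<close>

lemma digits_Suc: "digits D (Suc n) = (\<lambda>(\<mu>, y). teich D \<mu> + \<pi> * y) ` (residue_field D \<times> digits D n)"
proof (intro equalityI subsetI)
  fix x assume "x \<in> digits D (Suc n)"
  then obtain \<mu> where x: "x = (\<Sum>i<Suc n. \<pi> ^ i * teich D (\<mu> i))" and \<mu>: "\<forall>i<Suc n. \<mu> i \<in> residue_field D"
    by (auto simp: digits_def)
  have "x = teich D (\<mu> 0) + \<pi> * (\<Sum>i<n. \<pi> ^ i * teich D (\<mu> (Suc i)))"
    unfolding x sum.lessThan_Suc_shift by (simp add: sum_distrib_left mult.assoc)
  moreover have "(\<Sum>i<n. \<pi> ^ i * teich D (\<mu> (Suc i))) \<in> digits D n"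
    using \<mu> by (auto simp: digits_def intro!: exI[of _ "\<lambda>i. \<mu> (Suc i)"])
  ultimately show "x \<in> (\<lambda>(\<mu>, y). teich D \<mu> + \<pi> * y) ` (residue_field D \<times> digits D n)"
    using \<mu> by force
next
  fix x assume "x \<in> (\<lambda>(\<mu>, y). teich D \<mu> + \<pi> * y) ` (residue_field D \<times> digits D n)"
  then obtain \<nu> \<mu> where x: "x = teich D \<nu> + \<pi> * (\<Sum>i<n. \<pi> ^ i * teich D (\<mu> i))"
    and \<mu>: "\<nu> \<in> residue_field D" "\<forall>i<n. \<mu> i \<in> residue_field D"
    by (auto simp: digits_def)
  let ?\<mu> = "\<lambda>i. case i of 0 \<Rightarrow> \<nu> | Suc i \<Rightarrow> \<mu> i"
  have "x = (\<Sum>i<Suc n. \<pi> ^ i * teich D (?\<mu> i))"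
    unfolding x sum.lessThan_Suc_shift by (simp add: sum_distrib_left mult.assoc)
  moreover have "\<forall>i<Suc n. ?\<mu> i \<in> residue_field D" using \<mu> by (auto split: nat.split)
  ultimately show "x \<in> digits D (Suc n)" unfolding digits_def by blast
qed

lemma digits_1: "digits D 1 = teich D ` residue_field D"
  unfolding One_nat_def digits_Suc digits_0 by (simp add: image_def)

sublocale R: residue_system "\<lambda>x. real_of_int (val_F D x)" \<pi> "F.vball 0" "digits D 1"
  unfolding digits_1 by (rule residue_system_section(1)) (rule teich)

lemma card_digits_1: "card (digits D 1) = q"
  unfolding digits_1 by (rule residue_system_section(2)) (rule teich)

lemma digits_Suc': "digits D (Suc n) = (\<lambda>(l, y). l + \<pi> * y) ` (digits D 1 \<times> digits D n)"
proof (intro equalityI subsetI)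
  fix x assume "x \<in> digits D (Suc n)"
  then obtain \<mu> y where "\<mu> \<in> residue_field D" "y \<in> digits D n" "x = teich D \<mu> + \<pi> * y"
    unfolding digits_Suc by auto
  then show "x \<in> (\<lambda>(l, y). l + \<pi> * y) ` (digits D 1 \<times> digits D n)"
    unfolding digits_1 by (intro image_eqI[of _ _ "(teich D \<mu>, y)"]) auto
next
  fix x assume "x \<in> (\<lambda>(l, y). l + \<pi> * y) ` (digits D 1 \<times> digits D n)"
  then obtain \<mu> y where "\<mu> \<in> residue_field D" "y \<in> digits D n" "x = teich D \<mu> + \<pi> * y"
    unfolding digits_1 by auto
  then show "x \<in> digits D (Suc n)"
    unfolding digits_Suc by (intro image_eqI[of _ _ "(\<mu>, y)"]) auto
qed

lemma finite_digits: "finite (digits D n)"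
proof (induction n)
  case (Suc n)
  show ?case unfolding digits_Suc by (intro finite_imageI finite_cartesian_product finite_residue_field Suc)
qed (simp add: digits_0)

lemma digits_integral: "x \<in> digits D n \<Longrightarrow> x \<in> F.vball 0"
proof (induction n arbitrary: x)
  case (Suc n)
  then obtain l y where x: "x = l + \<pi> * y" "l \<in> digits D 1" "y \<in> digits D n" unfolding digits_Suc' by auto
  have "\<pi> * y \<in> F.vball 0" by (rule F.ball_mult_le[OF R.pi_ball0 Suc.IH[OF x(3)]]) simp
  from F.ball_add[OF R.rep_ball[OF x(2)] this] show ?case by (simp add: x(1))
qed (simp add: digits_0)

lemma digits_cover:
  assumes "x \<in> F.vball 0"
  obtains y where "y \<in> digits D n" "x - y \<in> F.vball (real n)"
proof -
  have "\<exists>y\<in>digits D n. x - y \<in> F.vball (real n)" using assms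
  proof (induction n arbitrary: x)
    case 0
    then show ?case by (simp add: digits_0)
  next
    case (Suc n)
    obtain l where l: "l \<in> digits D 1" "x - l \<in> F.vball 1" using R.reps_cover[OF Suc.prems] by blast
    have "(x - l) / \<pi> \<in> F.vball 0" using F.ball_divide[OF l(2) unif(1)] unif(2) by simp
    then obtain y where y: "y \<in> digits D n" "(x - l) / \<pi> - y \<in> F.vball (real n)" using Suc.IH by blast
    have "x - (l + \<pi> * y) = \<pi> * ((x - l) / \<pi> - y)" using unif by (simp add: field_simps)
    then have "x - (l + \<pi> * y) \<in> F.vball (real (Suc n))"
      using R.pi_mult_ball[of _ "real (Suc n)"] y(2) by simp
    then show ?case using l y unfolding digits_Suc' by force
  qed
  then show ?thesis using that by blast
qed

lemma digits_unique:
  "x \<in> digits D n \<Longrightarrow> y \<in> digits D n \<Longrightarrow> x - y \<in> F.vball (real n) \<Longrightarrow> x = y"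
proof (induction n arbitrary: x y)
  case (Suc n)
  obtain l x' where x: "x = l + \<pi> * x'" "l \<in> digits D 1" "x' \<in> digits D n"
    using Suc.prems(1) unfolding digits_Suc' by auto
  obtain m y' where y: "y = m + \<pi> * y'" "m \<in> digits D 1" "y' \<in> digits D n"
    using Suc.prems(2) unfolding digits_Suc' by auto
  have "\<pi> * (x' - y') \<in> F.vball 1"
    unfolding R.pi_mult_ball using digits_integral x(3) y(3) by (simp add: F.ball_diff)
  then have "(x - y) - \<pi> * (x' - y') \<in> F.vball 1"
    by (intro F.ball_diff F.ball_mono[OF Suc.prems(3)]) auto
  then have "l - m \<in> F.vball 1" by (simp add: x(1) y(1) algebra_simps)
  then have lm: "l = m" using R.reps_distinct x(2) y(2) by blast
  then have "\<pi> * (x' - y') \<in> F.vball (real (Suc n))"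
    using Suc.prems(3) by (simp add: x(1) y(1) algebra_simps)
  then have "x' = y'" using Suc.IH[OF x(3) y(3)] R.pi_mult_ball[of _ "real (Suc n)"] by simp
  then show ?case using lm x y by simp
qed (simp add: digits_0)

lemma residue_system_C:
  assumes \<sigma>: "\<sigma> \<in> Emb D"
  shows "residue_system (val_C D) (\<sigma> \<pi>) (\<sigma> ` F.vball 0) (\<sigma> ` digits D 1)"
    and "card (\<sigma> ` digits D 1) = q"
proof -
  interpret \<sigma>: comm_ring_hom \<sigma> by (rule Emb_hom[OF \<sigma>])
  have inj: "inj \<sigma>"
  proof (rule injI)
    fix x y assume "\<sigma> x = \<sigma> y"
    then have "\<sigma> (x - y) = 0" by (simp add: \<sigma>.hom_minus)
    then show "x = y" by (simp add: Emb_eq_0_iff[OF \<sigma>])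
  qed
  show card: "card (\<sigma> ` digits D 1) = q"
    by (rule trans[OF card_image[OF inj_on_subset[OF inj subset_UNIV]] card_digits_1])
  show "residue_system (val_C D) (\<sigma> \<pi>) (\<sigma> ` F.vball 0) (\<sigma> ` digits D 1)"
  proof
    show "\<exists>l\<in>\<sigma> ` digits D 1. x - l \<in> C.vball 1" if x: "x \<in> \<sigma> ` F.vball 0" for x
    proof -
      obtain y where y: "y \<in> F.vball 0" "x = \<sigma> y" using x by blast
      obtain l where "l \<in> digits D 1" "y - l \<in> F.vball 1" using R.reps_cover[OF y(1)] by blast
      then show ?thesis using y(2) Emb_ball[OF \<sigma>, of "y - l" 1] by (auto simp: \<sigma>.hom_minus)
    qed
    show "l = l'" if l: "l \<in> \<sigma> ` digits D 1" "l' \<in> \<sigma> ` digits D 1" "l - l' \<in> C.vball 1" for l l'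
    proof -
      obtain x y where xy: "x \<in> digits D 1" "y \<in> digits D 1" "l = \<sigma> x" "l' = \<sigma> y" using l by blast
      then have "x - y \<in> F.vball 1" using l(3) Emb_ball[OF \<sigma>, of "x - y" 1] by (simp add: \<sigma>.hom_minus)
      then show ?thesis using R.reps_distinct xy by blast
    qed
    show "val_C D x \<in> \<int>" if x: "x \<in> \<sigma> ` F.vball 0" "x \<noteq> 0" for x
    proof -
      obtain y where "x = \<sigma> y" using x by blast
      then show ?thesis using x val_C_Emb[OF \<sigma>, of y] Emb_eq_0_iff[OF \<sigma>, of y] by auto
    qed
    show "\<sigma> ` F.vball 0 \<subseteq> C.vball 0" using Emb_ball[OF \<sigma>] by auto
    show "1 \<in> \<sigma> ` F.vball 0" by (metis \<sigma>.hom_one F.ball_one imageI)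
    show "x + y \<in> \<sigma> ` F.vball 0" if "x \<in> \<sigma> ` F.vball 0" "y \<in> \<sigma> ` F.vball 0" for x y
      using that F.ball_add[of _ 0] by (auto simp flip: \<sigma>.hom_add)
    show "- x \<in> \<sigma> ` F.vball 0" if "x \<in> \<sigma> ` F.vball 0" for x
      using that by (auto simp flip: \<sigma>.hom_uminus)
    show "x * y \<in> \<sigma> ` F.vball 0" if "x \<in> \<sigma> ` F.vball 0" "y \<in> \<sigma> ` F.vball 0" for x y
      using that F.ball_mult[of _ 0 _ 0] by (auto simp flip: \<sigma>.hom_mult)
    show "\<sigma> \<pi> \<noteq> 0" "val_C D (\<sigma> \<pi>) = 1"
      using unif val_C_Emb[OF \<sigma>] Emb_eq_0_iff[OF \<sigma>] by auto
    show "\<sigma> ` digits D 1 \<subseteq> \<sigma> ` F.vball 0" using digits_integral by blast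
    show "finite (\<sigma> ` digits D 1)" using finite_digits by blast
    show "3 \<le> card (\<sigma> ` digits D 1)" using card residue_card_ge by simp
  qed
qed

text \<open>The number of embeddings is the degree of F, which is positive, and a positive
  \<open>card\<close> excludes infinite sets.\<close>

lemma finite_Emb: "finite (Emb D)"
proof -
  have ext: "finite_extension (emb_F D)" using setting by (simp add: padic_setting_def)
  have c: "card (Emb D) = ext_degree (emb_F D)" using setting unfolding padic_setting_def by (elim conjE)
  obtain B where "finite_dimensional_vector_space (\<lambda>a x. emb_F D a * x) B"
    using ext unfolding finite_extension_def by blast
  then interpret V: finite_dimensional_vector_space "\<lambda>a x. emb_F D a * x" B .
  have "B \<noteq> {}"
  proof
    assume "B = {}"
    then have "(1::'f) \<in> V.span {}" using V.span_Basis by simp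
    then show False by simp
  qed
  then have "card (Emb D) \<noteq> 0"
    using V.finite_Basis by (simp add: c ext_degree_def)
  then show ?thesis by (metis card.infinite)
qed

end

section \<open>Two by two matrices\<close>

lemma mat2_sel [simp]:
  "mat2 a b c d $ 1 $ 1 = a" "mat2 a b c d $ 1 $ 2 = b" "mat2 a b c d $ 2 $ 1 = c" "mat2 a b c d $ 2 $ 2 = d"
  by (simp_all add: mat2_def)

lemma mat2_eta: "mat2 (g $ 1 $ 1) (g $ 1 $ 2) (g $ 2 $ 1) (g $ 2 $ 2) = g"
  by (simp add: vec_eq_iff forall_2)

lemma mat2_eq_iff [simp]: "mat2 a b c d = mat2 a' b' c' d' \<longleftrightarrow> a = a' \<and> b = b' \<and> c = c' \<and> d = d'"
  by (metis mat2_sel)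

lemma mat2_mult [simp]:
  "mat2 a b c d ** mat2 a' b' c' d' =
    mat2 (a * a' + b * c') (a * b' + b * d') (c * a' + d * c') (c * b' + d * (d'::'a::comm_ring_1))"
  by (simp add: vec_eq_iff forall_2 matrix_matrix_mult_def sum_2)

lemma mat_eq_mat2: "(mat z :: 'a::comm_ring_1 ^ 2 ^ 2) = mat2 z 0 0 z"
  by (simp add: vec_eq_iff forall_2 mat_def)

lemma det_mat2 [simp]: "det (mat2 a b c d) = a * d - b * (c::'a::comm_ring_1)"
  by (simp add: det_2)

lemma matrix_inv_eqI:
  fixes A :: "'a::field ^ 'n ^ 'n"
  assumes "A ** B = mat 1" "B ** A = mat 1"
  shows "matrix_inv A = B"
proof -
  have "A ** matrix_inv A = mat 1 \<and> matrix_inv A ** A = mat 1"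
    unfolding matrix_inv_def by (rule someI) (use assms in blast)
  then have "matrix_inv A = (B ** A) ** matrix_inv A" by (simp add: assms)
  also have "\<dots> = B" using \<open>_ \<and> _\<close> by (simp flip: matrix_mul_assoc)
  finally show ?thesis .
qed

lemma mat2_adjugate:
  fixes a b c d :: "'a::field"
  assumes "\<Delta> \<noteq> 0" "\<Delta> = a * d - b * c"
  shows "mat2 a b c d ** mat2 (d / \<Delta>) (- b / \<Delta>) (- c / \<Delta>) (a / \<Delta>) = mat 1"
    and "mat2 (d / \<Delta>) (- b / \<Delta>) (- c / \<Delta>) (a / \<Delta>) ** mat2 a b c d = mat 1"
proof -
  have "(a * d - b * c) / \<Delta> = 1" using assms by simp
  then have "a * d / \<Delta> - b * c / \<Delta> = 1" by (simp only: diff_divide_distrib)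
  then show "mat2 a b c d ** mat2 (d / \<Delta>) (- b / \<Delta>) (- c / \<Delta>) (a / \<Delta>) = mat 1"
    and "mat2 (d / \<Delta>) (- b / \<Delta>) (- c / \<Delta>) (a / \<Delta>) ** mat2 a b c d = mat 1"
    by (simp_all add: mat_eq_mat2 mult.commute)
qed

lemma GL2_iff: "g \<in> GL2 \<longleftrightarrow> det (g :: 'a::field ^ 2 ^ 2) \<noteq> 0"
proof
  assume "g \<in> GL2"
  then obtain h where "g ** h = mat 1" by (auto simp: GL2_def invertible_def)
  then have "det g * det h = 1" by (metis det_mul det_I)
  then show "det g \<noteq> 0" by auto
next
  assume nz: "det g \<noteq> 0"
  let ?a = "g $ 1 $ 1" and ?b = "g $ 1 $ 2" and ?c = "g $ 2 $ 1" and ?d = "g $ 2 $ 2"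
  let ?D = "det g" and ?h = "mat2 (?d / det g) (- ?b / det g) (- ?c / det g) (?a / det g)"
  have D: "?D = ?a * ?d - ?b * ?c" by (simp add: det_2)
  have "mat2 ?a ?b ?c ?d ** ?h = mat 1" "?h ** mat2 ?a ?b ?c ?d = mat 1"
    using mat2_adjugate[OF nz D] by simp_all
  then show "g \<in> GL2" unfolding mat2_eta GL2_def invertible_def by blast
qed

lemma matrix_inv_mult:
  fixes g :: "'a::field ^ 2 ^ 2"
  assumes "g \<in> GL2"
  shows "g ** matrix_inv g = mat 1" "matrix_inv g ** g = mat 1"
proof -
  obtain h where h: "g ** h = mat 1" "h ** g = mat 1" using assms by (auto simp: GL2_def invertible_def)
  then show "g ** matrix_inv g = mat 1" "matrix_inv g ** g = mat 1" using matrix_inv_eqI[OF h] by auto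
qed

lemma matrix_inv_mat2:
  fixes a b c d :: "'a::field"
  assumes "a * d - b * c \<noteq> 0"
  shows "matrix_inv (mat2 a b c d) = mat2 (d / (a * d - b * c)) (- b / (a * d - b * c)) (- c / (a * d - b * c)) (a / (a * d - b * c))"
  by (rule matrix_inv_eqI) (rule mat2_adjugate[OF assms refl])+

lemma GL2_mult: "g \<in> GL2 \<Longrightarrow> h \<in> GL2 \<Longrightarrow> g ** (h :: 'a::field ^ 2 ^ 2) \<in> GL2"
  by (simp add: GL2_iff det_mul)

lemma GL2_inv: "g \<in> GL2 \<Longrightarrow> matrix_inv (g :: 'a::field ^ 2 ^ 2) \<in> GL2"
  using matrix_inv_mult[of g] by (auto simp: GL2_def invertible_def)

lemma GL2_one: "(mat 1 :: 'a::field ^ 2 ^ 2) \<in> GL2"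
  by (simp add: GL2_iff)

lemma matrix_inv_matrix_mult:
  fixes g h :: "'a::field ^ 2 ^ 2"
  assumes "g \<in> GL2" "h \<in> GL2"
  shows "matrix_inv (g ** h) = matrix_inv h ** matrix_inv g"
proof (rule matrix_inv_eqI)
  have "g ** h ** (matrix_inv h ** matrix_inv g) = g ** (h ** matrix_inv h) ** matrix_inv g"
    by (simp add: matrix_mul_assoc)
  then show "g ** h ** (matrix_inv h ** matrix_inv g) = mat 1" using assms by (simp add: matrix_inv_mult)
  have "matrix_inv h ** matrix_inv g ** (g ** h) = matrix_inv h ** (matrix_inv g ** g) ** h"
    by (simp add: matrix_mul_assoc)
  then show "matrix_inv h ** matrix_inv g ** (g ** h) = mat 1" using assms by (simp add: matrix_inv_mult)
qed

lemma matrix_inv_inv: "g \<in> GL2 \<Longrightarrow> matrix_inv (matrix_inv g) = (g :: 'a::field ^ 2 ^ 2)"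
  by (rule matrix_inv_eqI) (simp_all add: matrix_inv_mult)

lemma det_matrix_inv:
  fixes g :: "'a::field ^ 2 ^ 2"
  assumes "g \<in> GL2"
  shows "det (matrix_inv g) = inverse (det g)"
proof -
  have "det g * det (matrix_inv g) = 1" using matrix_inv_mult(1)[OF assms] by (metis det_mul det_I)
  then show ?thesis using assms by (simp add: GL2_iff field_simps)
qed

lemma mult_inv_cancel:
  fixes g h :: "'a::field ^ 2 ^ 2"
  assumes "g \<in> GL2"
  shows "g ** (matrix_inv g ** h) = h" "matrix_inv g ** (g ** h) = h"
    "h ** g ** matrix_inv g = h" "h ** matrix_inv g ** g = h"
  using matrix_inv_mult[OF assms] by (simp_all add: matrix_mul_assoc) (simp_all flip: matrix_mul_assoc)

text \<open>Conjugation by this matrix carries the family \<open>g1\<close> into \<open>g0\<close>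
  with the level raised by one, so both halves of the tree are treated by one argument.\<close>

definition swap :: "'a::comm_ring_1 ^ 2 ^ 2" where
  "swap = mat2 0 1 1 0"

lemma swap_swap: "swap ** swap = (mat 1 :: 'a::comm_ring_1 ^ 2 ^ 2)"
  by (simp add: swap_def mat_eq_mat2)

lemma swap_GL2: "(swap :: 'a::field ^ 2 ^ 2) \<in> GL2"
  by (simp add: GL2_iff swap_def)

lemma inv_swap: "matrix_inv swap = (swap :: 'a::field ^ 2 ^ 2)"
  by (rule matrix_inv_eqI) (simp_all add: swap_swap)

section \<open>Cosets of $KZ$\<close>

context hecke_data
begin

lemma zero_digits: "0 \<in> digits D n"
proof (induction n)
  case (Suc n)
  have \<mu>: "cls 0 \<in> residue_field D" by (simp add: residue_field_eq)
  have t: "teich D (cls 0) \<in> F.vball 1" using teich(1)[OF \<mu>] by (simp add: in_cls)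
  have "teich D (cls 0) = 0"
    by (rule teichmueller_unique)
      (use t teich(2)[OF \<mu>] F.ball_mono[OF t, of 0] residue_card_ge in auto)
  then show ?case unfolding digits_Suc using \<mu> Suc by (intro image_eqI[of _ _ "(cls 0, 0)"]) auto
qed (simp add: digits_0)

section \<open>Membership in KZ in terms of valuations\<close>

definition in_lattice :: "int \<Rightarrow> 'f ^ 2 ^ 2 \<Rightarrow> bool" where
  "in_lattice l g \<longleftrightarrow> (\<forall>i j. g $ i $ j \<in> F.vball (real_of_int l))"

lemma in_lattice_mat2: "in_lattice l (mat2 a b c d) \<longleftrightarrow>
    a \<in> F.vball (real_of_int l) \<and> b \<in> F.vball (real_of_int l) \<and> c \<in> F.vball (real_of_int l) \<and> d \<in> F.vball (real_of_int l)"
  by (simp add: in_lattice_def forall_2)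

lemma in_lattice_mult: "in_lattice l g \<Longrightarrow> in_lattice m h \<Longrightarrow> in_lattice (l + m) (g ** h)"
  unfolding in_lattice_def matrix_matrix_mult_def
  by (auto intro!: F.ball_sum F.ball_mult)

lemma val_mult: "x \<noteq> 0 \<Longrightarrow> y \<noteq> 0 \<Longrightarrow> val_F D (x * y) = val_F D x + val_F D y"
  using F.v_mult[of x y] by linarith

lemma val_inverse: "x \<noteq> 0 \<Longrightarrow> val_F D (inverse x) = - val_F D x"
  using F.v_inverse[of x] by linarith

lemma val_divide: "x \<noteq> 0 \<Longrightarrow> y \<noteq> 0 \<Longrightarrow> val_F D (x / y) = val_F D x - val_F D y"
  using F.v_divide[of x y] by linarith

lemma val_one: "val_F D 1 = 0"
  using F.v_one by simp

lemma val_unif_power: "val_F D (\<pi> ^ n) = int n"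
  by (induction n) (auto simp: val_one val_mult unif)

lemma val_unif_powi: "val_F D (\<pi> powi l) = l"
  using val_unif_power unif by (auto simp: power_int_def val_inverse power_inverse)

lemma in_lattice_inv:
  assumes "in_lattice l g" "g \<in> GL2"
  shows "in_lattice (l - val_F D (det g)) (matrix_inv g)"
proof -
  let ?a = "g $ 1 $ 1" and ?b = "g $ 1 $ 2" and ?c = "g $ 2 $ 1" and ?d = "g $ 2 $ 2"
  have D: "?a * ?d - ?b * ?c = det g" by (simp add: det_2)
  have nz: "det g \<noteq> 0" using assms(2) by (simp add: GL2_iff)
  have "matrix_inv (mat2 ?a ?b ?c ?d) = mat2 (?d / det g) (- ?b / det g) (- ?c / det g) (?a / det g)"
    using matrix_inv_mat2[of ?a ?d ?b ?c] nz unfolding D by simp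
  then have e: "matrix_inv g = mat2 (?d / det g) (- ?b / det g) (- ?c / det g) (?a / det g)"
    by (simp only: mat2_eta)
  have *: "x / det g \<in> F.vball (real_of_int (l - val_F D (det g)))" if "x \<in> F.vball (real_of_int l)" for x
    using F.ball_divide[OF that nz] by simp
  show ?thesis unfolding e in_lattice_mat2
    using assms(1) unfolding in_lattice_def by (intro conjI *) auto
qed

lemma GL2_int_iff: "g \<in> GL2_int D \<longleftrightarrow> g \<in> GL2 \<and> in_lattice 0 g \<and> val_F D (det g) = 0"
proof
  assume g: "g \<in> GL2_int D"
  then have gl: "g \<in> GL2" and l: "in_lattice 0 g" "in_lattice 0 (matrix_inv g)"
    by (auto simp: GL2_int_def in_lattice_def O_F_eq)
  have d: "0 \<le> val_F D (det h)" if "in_lattice 0 h" "det h \<noteq> 0" for h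
  proof -
    have "det h \<in> F.vball 0"
      unfolding det_2 using that(1) F.ball_mult[of _ 0 _ 0] by (intro F.ball_diff) (auto simp: in_lattice_def)
    then show ?thesis using that(2) by (simp add: F.vball_def)
  qed
  have nz: "det g \<noteq> 0" using gl by (simp add: GL2_iff)
  have "0 \<le> - val_F D (det g)"
    using d[OF l(2)] det_matrix_inv[OF gl] nz by (simp add: val_inverse)
  then show "g \<in> GL2 \<and> in_lattice 0 g \<and> val_F D (det g) = 0" using gl l d[OF l(1)] nz by simp
next
  assume "g \<in> GL2 \<and> in_lattice 0 g \<and> val_F D (det g) = 0"
  then show "g \<in> GL2_int D"
    using in_lattice_inv[of 0 g] by (auto simp: GL2_int_def in_lattice_def O_F_eq)
qed

lemma mult_mat: "(g ** mat z) $ i $ j = g $ i $ j * (z :: 'f)" for g :: "'f ^ 2 ^ 2"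
  by (simp add: matrix_matrix_mult_def mat_def if_distrib[of "(*) _"] cong: if_cong)

text \<open>The scalar may be taken as \<pi>^l, where 2l is the valuation of the determinant;
  dividing by it leaves an integral matrix with unit determinant. No decomposition has to be
  exhibited afterwards.\<close>

lemma KZ_iff: "g \<in> KZ D \<longleftrightarrow> g \<in> GL2 \<and> (\<exists>l. val_F D (det g) = 2 * l \<and> in_lattice l g)"
proof
  assume "g \<in> KZ D"
  then obtain h z where g: "g = h ** mat z" "h \<in> GL2" "in_lattice 0 h" "val_F D (det h) = 0" "z \<noteq> 0"
    by (auto simp: KZ_def GL2_int_iff)
  have hd: "det h \<noteq> 0" using g by (simp add: GL2_iff)
  have dz: "det (mat z :: 'f ^ 2 ^ 2) = z * z" by (simp add: mat_eq_mat2)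
  have "val_F D (det g) = 2 * val_F D z" using g hd by (simp add: det_mul dz val_mult)
  moreover have "in_lattice (val_F D z) g"
    unfolding in_lattice_def
  proof (intro allI)
    fix i j
    have "h $ i $ j * z \<in> F.vball (0 + real_of_int (val_F D z))"
      by (rule F.ball_mult) (use g in \<open>auto simp: in_lattice_def F.vball_def\<close>)
    then show "g $ i $ j \<in> F.vball (real_of_int (val_F D z))" by (simp add: g mult_mat)
  qed
  ultimately show "g \<in> GL2 \<and> (\<exists>l. val_F D (det g) = 2 * l \<and> in_lattice l g)"
    using g hd by (auto simp: GL2_iff det_mul dz)
next
  assume "g \<in> GL2 \<and> (\<exists>l. val_F D (det g) = 2 * l \<and> in_lattice l g)"
  then obtain l where l: "val_F D (det g) = 2 * l" "in_lattice l g" and gl: "g \<in> GL2" by blast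
  define z where "z = \<pi> powi l"
  have z: "z \<noteq> 0" "val_F D z = l" using unif val_unif_powi by (auto simp: z_def)
  let ?h = "g ** mat (inverse z)"
  have dz: "det (mat (inverse z) :: 'f ^ 2 ^ 2) = inverse z * inverse z" by (simp add: mat_eq_mat2)
  have "?h \<in> GL2_int D"
    unfolding GL2_int_iff
  proof (intro conjI)
    show "?h \<in> GL2" using gl z by (simp add: GL2_iff det_mul dz)
    show "val_F D (det ?h) = 0"
      using gl z l by (simp add: GL2_iff det_mul dz val_mult val_inverse)
    show "in_lattice 0 ?h"
      unfolding in_lattice_def mult_mat
    proof (intro allI)
      fix i j
      have "g $ i $ j / z \<in> F.vball (real_of_int l - real_of_int (val_F D z))"
        by (rule F.ball_divide) (use l z in \<open>auto simp: in_lattice_def\<close>)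
      then show "g $ i $ j * inverse z \<in> F.vball (real_of_int 0)" using z by (simp add: field_simps)
    qed
  qed
  moreover have "g = ?h ** mat z"
    using z by (simp add: vec_eq_iff mult_mat)
  ultimately show "g \<in> KZ D" using z unfolding KZ_def by blast
qed

lemma KZ_GL2: "g \<in> KZ D \<Longrightarrow> g \<in> GL2"
  by (simp add: KZ_iff)

lemma KZ_I: "det g \<noteq> 0 \<Longrightarrow> val_F D (det g) = 2 * l \<Longrightarrow> in_lattice l g \<Longrightarrow> g \<in> KZ D"
  by (auto simp: KZ_iff GL2_iff)

lemma KZ_mult: "g \<in> KZ D \<Longrightarrow> h \<in> KZ D \<Longrightarrow> g ** h \<in> KZ D"
proof -
  assume "g \<in> KZ D" "h \<in> KZ D"
  then obtain l m where g: "g \<in> GL2" "val_F D (det g) = 2 * l" "in_lattice l g"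
    and h: "h \<in> GL2" "val_F D (det h) = 2 * m" "in_lattice m h"
    by (auto simp: KZ_iff)
  show ?thesis
    by (rule KZ_I[of _ "l + m"])
      (use g h in_lattice_mult in \<open>auto simp: det_mul val_mult GL2_iff\<close>)
qed

lemma KZ_inv: "g \<in> KZ D \<Longrightarrow> matrix_inv g \<in> KZ D"
proof -
  assume "g \<in> KZ D"
  then obtain l where g: "g \<in> GL2" "val_F D (det g) = 2 * l" "in_lattice l g" by (auto simp: KZ_iff)
  show ?thesis
    by (rule KZ_I[of _ "- l"])
      (use g in_lattice_inv[OF g(3,1)] in \<open>auto simp: det_matrix_inv GL2_iff val_inverse\<close>)
qed

lemma KZ_one: "mat 1 \<in> KZ D"
  by (rule KZ_I[of _ 0]) (auto simp: mat_eq_mat2 in_lattice_mat2 val_one)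

lemma swap_KZ: "swap \<in> KZ D"
  by (rule KZ_I[of _ 0]) (use F.v_minus[of 1] F.v_one in \<open>auto simp: swap_def in_lattice_mat2\<close>)

lemma KZ_mult_left_iff: "g \<in> KZ D \<Longrightarrow> g ** h \<in> KZ D \<longleftrightarrow> h \<in> KZ D"
  using KZ_mult[of "matrix_inv g" "g ** h"] KZ_mult[of g h] KZ_inv[of g] mult_inv_cancel(2)[OF KZ_GL2] by metis

lemma KZ_mult_right_iff: "g \<in> KZ D \<Longrightarrow> h ** g \<in> KZ D \<longleftrightarrow> h \<in> KZ D"
  using KZ_mult[of "h ** g" "matrix_inv g"] KZ_mult[of h g] KZ_inv[of g] mult_inv_cancel(3)[OF KZ_GL2] by metis

section \<open>Representatives of the cosets of KZ\<close>

lemma g0_GL2: "g0 D n \<mu> \<in> GL2"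
  using unif by (simp add: g0_def GL2_iff)

lemma g1_GL2: "g1 D n \<mu> \<in> GL2"
  using unif by (simp add: g1_def GL2_iff)

lemma inv_g0: "matrix_inv (g0 D n \<mu>) = mat2 (inverse (\<pi> ^ n)) (- \<mu> / \<pi> ^ n) 0 1"
  unfolding g0_def using unif by (subst matrix_inv_mat2) (auto simp: field_simps)

lemma g1_eq: "g1 D n \<mu> = swap ** g0 D (Suc n) (\<pi> * \<mu>) ** swap"
  by (simp add: g1_def g0_def swap_def)

lemma inv_g1: "matrix_inv (g1 D n \<mu>) = swap ** matrix_inv (g0 D (Suc n) (\<pi> * \<mu>)) ** swap"
  unfolding g1_eq
  by (simp add: matrix_inv_matrix_mult swap_GL2 g0_GL2 GL2_mult inv_swap matrix_mul_assoc)

lemma g0_g0_KZ: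
  assumes "matrix_inv (g0 D m \<mu>) ** g0 D n \<nu> \<in> KZ D"
  shows "m = n \<and> \<nu> - \<mu> \<in> F.vball (real m)"
proof -
  have e: "matrix_inv (g0 D m \<mu>) ** g0 D n \<nu> = mat2 (\<pi> ^ n / \<pi> ^ m) ((\<nu> - \<mu>) / \<pi> ^ m) 0 1"
    unfolding inv_g0 by (simp add: g0_def field_simps diff_divide_distrib)
  obtain l where l: "val_F D (\<pi> ^ n / \<pi> ^ m) = 2 * l" "in_lattice l (mat2 (\<pi> ^ n / \<pi> ^ m) ((\<nu> - \<mu>) / \<pi> ^ m) 0 1)"
    using assms unfolding e KZ_iff by auto
  have v: "val_F D (\<pi> ^ n / \<pi> ^ m) = int n - int m"
    using unif by (simp add: val_divide val_unif_power)
  have "l \<le> int n - int m" "l \<le> 0" and b: "(\<nu> - \<mu>) / \<pi> ^ m \<in> F.vball (real_of_int l)"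
    using l(2) v unif by (auto simp: in_lattice_mat2 F.vball_def val_one)
  then have l0: "l = 0" and mn: "m = n" using l(1) v by auto
  have "\<pi> ^ m * ((\<nu> - \<mu>) / \<pi> ^ m) \<in> F.vball (real m)"
    unfolding unif_power_ball_iff using b l0 by simp
  then show ?thesis using mn unif by simp
qed

text \<open>Since \<nu> lies in the maximal ideal, the entry (1 - \<mu> \<nu>) / \<pi>^m has
  valuation exactly - m. Membership in KZ would force it to be at least (n - m) / 2, which exceeds -
  m for n \<ge> 1.\<close>

lemma g0_swap_g0_KZ:
  assumes "\<mu> \<in> F.vball 0" "\<nu> \<in> F.vball 1" "1 \<le> n"
  shows "matrix_inv (g0 D m \<mu>) ** swap ** g0 D n \<nu> \<notin> KZ D"
proof
  assume "matrix_inv (g0 D m \<mu>) ** swap ** g0 D n \<nu> \<in> KZ D"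
  moreover have "matrix_inv (g0 D m \<mu>) ** swap ** g0 D n \<nu>
      = mat2 (- \<mu> / \<pi> ^ m * \<pi> ^ n) ((1 - \<mu> * \<nu>) / \<pi> ^ m) (\<pi> ^ n) \<nu>"
    unfolding inv_g0 by (simp add: g0_def swap_def field_simps diff_divide_distrib)
  ultimately obtain l where l: "val_F D (det (mat2 (- \<mu> / \<pi> ^ m * \<pi> ^ n) ((1 - \<mu> * \<nu>) / \<pi> ^ m) (\<pi> ^ n) \<nu>)) = 2 * l"
    "in_lattice l (mat2 (- \<mu> / \<pi> ^ m * \<pi> ^ n) ((1 - \<mu> * \<nu>) / \<pi> ^ m) (\<pi> ^ n) \<nu>)"
    unfolding KZ_iff by auto
  have "det (mat2 (- \<mu> / \<pi> ^ m * \<pi> ^ n) ((1 - \<mu> * \<nu>) / \<pi> ^ m) (\<pi> ^ n) \<nu>) = - (\<pi> ^ n / \<pi> ^ m)"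
    using unif by (simp add: field_simps)
  moreover have "val_F D (- (\<pi> ^ n / \<pi> ^ m)) = int n - int m"
    using F.v_minus[of "\<pi> ^ n / \<pi> ^ m"] unif by (simp add: val_divide val_unif_power)
  ultimately have 1: "int n - int m = 2 * l" using l(1) by simp
  have "\<mu> * \<nu> \<in> F.vball 1" using F.ball_mult[OF assms(1,2)] by simp
  then have u: "1 - \<mu> * \<nu> \<noteq> 0 \<and> val_F D (1 - \<mu> * \<nu>) = 0"
    using F.v_eq_if_diff[of 1 "1 - \<mu> * \<nu>" 1] by (simp add: val_one)
  then have "val_F D ((1 - \<mu> * \<nu>) / \<pi> ^ m) = - int m"
    using unif by (simp add: val_divide val_unif_power)
  then have "l \<le> - int m" using l(2) u unif by (simp add: in_lattice_mat2 F.vball_def)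
  then show False using 1 assms(3) by simp
qed

definition same_coset :: "'f ^ 2 ^ 2 \<Rightarrow> 'f ^ 2 ^ 2 \<Rightarrow> bool" where
  "same_coset g h \<longleftrightarrow> (\<exists>\<kappa>\<in>KZ D. g = h ** \<kappa>)"

text \<open>Iwasawa decomposition: the bottom row is cleared from the right with its entry of
  smaller valuation as pivot.\<close>

lemma upper_triangular_rep:
  assumes "g \<in> GL2"
  obtains A B where "A \<noteq> 0" "same_coset g (mat2 A B 0 1)"
proof -
  define a b c d where abcd: "a = g $ 1 $ 1" "b = g $ 1 $ 2" "c = g $ 2 $ 1" "d = g $ 2 $ 2"
  have g: "g = mat2 a b c d" by (simp add: abcd mat2_eta)
  have nz: "a * d - b * c \<noteq> 0" using assms by (simp add: GL2_iff g)
  show thesis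
  proof (cases "d \<noteq> 0 \<and> c \<in> F.vball (real_of_int (val_F D d))")
    case True
    let ?h = "mat2 ((a * d - b * c) / d ^ 2) (b / d) 0 1" and ?k = "mat2 d 0 c d"
    have "g = ?h ** ?k" using True by (simp add: g field_simps power2_eq_square)
    moreover have "?k \<in> KZ D"
      by (rule KZ_I[of _ "val_F D d"]) (use True in \<open>auto simp: val_mult in_lattice_mat2 intro: F.ballI\<close>)
    moreover have "(a * d - b * c) / d ^ 2 \<noteq> 0" using nz True by simp
    ultimately show ?thesis using that unfolding same_coset_def by blast
  next
    case False
    then have c: "c \<noteq> 0" using nz by auto
    have d: "d \<in> F.vball (real_of_int (val_F D c))" using False c by (auto simp: F.vball_def)
    let ?h = "mat2 (- (a * d - b * c) / c ^ 2) (a / c) 0 1" and ?k = "mat2 0 c c d"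
    have "g = ?h ** ?k" using c by (simp add: g field_simps power2_eq_square)
    moreover have "?k \<in> KZ D"
      by (rule KZ_I[of _ "val_F D c"])
        (use c d F.v_minus[of "c * c"] in \<open>auto simp: val_mult in_lattice_mat2 intro: F.ballI\<close>)
    moreover have "- (a * d - b * c) / c ^ 2 \<noteq> 0" using nz c by simp
    ultimately show ?thesis using that unfolding same_coset_def by blast
  qed
qed

text \<open>The coset of (A, B) is the disc B + A O_F. Either it lies in O_F, or it contains 0 and
  is larger than O_F, or it avoids 0 and lies outside O_F. The last case is reduced to the maximal
  ideal by inversion.\<close>

lemma triangular_coset:
  assumes A: "A \<noteq> 0"
  shows "(\<exists>n. \<exists>\<mu>\<in>digits D n. same_coset (mat2 A B 0 1) (g0 D n \<mu>)) \<or>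
    (\<exists>n. \<exists>\<mu>\<in>digits D n. same_coset (mat2 A B 0 1) (g1 D n \<mu>))"
proof -
  let ?n = "val_F D A"
  consider (a) "0 \<le> ?n" "B \<in> F.vball 0" | (b) "?n < 0" "B \<in> F.vball (real_of_int ?n)"
    | (c) "B \<noteq> 0" "val_F D B < 0" "val_F D B < ?n"
    by (force simp: F.vball_def)
  then show ?thesis
  proof cases
    case a
    define n where "n = nat ?n"
    obtain \<mu> where \<mu>: "\<mu> \<in> digits D n" "B - \<mu> \<in> F.vball (real n)" using digits_cover[OF a(2)] by blast
    let ?k = "mat2 (A / \<pi> ^ n) ((B - \<mu>) / \<pi> ^ n) 0 1"
    have v: "val_F D (A / \<pi> ^ n) = 0" using A a unif by (simp add: val_divide val_unif_power n_def)
    have "(B - \<mu>) / \<pi> ^ n \<in> F.vball 0"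
      using F.ball_divide[OF \<mu>(2), of "\<pi> ^ n"] unif by (simp add: val_unif_power)
    then have "?k \<in> KZ D"
      by (intro KZ_I[of _ 0]) (use A unif v in \<open>auto simp: in_lattice_mat2 intro: F.ballI\<close>)
    moreover have "mat2 A B 0 1 = g0 D n \<mu> ** ?k" using unif by (simp add: g0_def)
    ultimately show ?thesis using \<mu>(1) unfolding same_coset_def by blast
  next
    case b
    define m where "m = nat (- ?n) - 1"
    have m: "int (m + 1) = - ?n" using b by (simp add: m_def)
    let ?k = "mat2 A B 0 (inverse (\<pi> ^ (m + 1)))"
    have v: "val_F D (inverse (\<pi> ^ (m + 1))) = ?n"
      using unif m val_unif_power[of "m + 1"] by (simp add: val_inverse del: power_Suc)
    have "?k \<in> KZ D"
      by (rule KZ_I[of _ ?n]) (use A unif v b in \<open>auto simp: in_lattice_mat2 val_mult simp del: power_Suc intro: F.ballI\<close>)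
    moreover have "mat2 A B 0 1 = g1 D m 0 ** ?k" using unif by (simp add: g1_def field_simps)
    ultimately show ?thesis using zero_digits[of m] unfolding same_coset_def by blast
  next
    case c
    \<comment> \<open>Inversion maps the disc to one around 1 / B of radius A / B^2. The level l + 1
      is the valuation of this radius, and \<nu> is 1 / B divided by \<pi>, since \<open>g1\<close>
      carries the address \<pi> \<mu> in the inverted coordinate.\<close>
    define l where "l = nat (?n - 2 * val_F D B) - 1"
    have l: "int l + 1 = ?n - 2 * val_F D B" using c by (simp add: l_def)
    define \<nu> where "\<nu> = inverse (\<pi> * B)"
    have v\<nu>: "val_F D \<nu> = - 1 - val_F D B" "\<nu> \<noteq> 0"
      using c unif by (auto simp: \<nu>_def val_inverse val_mult)
    have "\<nu> \<in> F.vball 0" using v\<nu> c by (intro F.ballI) simp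
    then obtain \<mu> where \<mu>: "\<mu> \<in> digits D l" "\<nu> - \<mu> \<in> F.vball (real l)" using digits_cover by blast
    have "\<nu> - (\<nu> - \<mu>) \<in> F.vball (real_of_int (- 1 - val_F D B))"
    proof (rule F.ball_diff)
      show "\<nu> \<in> F.vball (real_of_int (- 1 - val_F D B))" using v\<nu> by (intro F.ballI) simp
      have "- 1 - val_F D B \<le> int l" using l c by linarith
      then show "\<nu> - \<mu> \<in> F.vball (real_of_int (- 1 - val_F D B))"
        by (intro F.ball_mono[OF \<mu>(2)]) linarith
    qed
    then have \<mu>b: "\<mu> \<in> F.vball (real_of_int (- 1 - val_F D B))" by simp
    define P where "P = \<pi> ^ (l + 1)"
    have P: "P \<noteq> 0" "val_F D P = int l + 1" using unif val_unif_power[of "l + 1"] by (auto simp: P_def)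
    let ?k = "mat2 A B (- (\<pi> * \<mu> * A) / P) (\<pi> * B * (\<nu> - \<mu>) / P)"
    have \<nu>B: "\<pi> * B * \<nu> = 1" using c unif by (simp add: \<nu>_def field_simps)
    have det: "det ?k = A / P"
    proof -
      have "det ?k = A * (\<pi> * B * \<nu>) / P" using P by (simp add: field_simps)
      then show ?thesis by (simp add: \<nu>B)
    qed
    have "?k \<in> KZ D"
    proof (rule KZ_I[of _ "val_F D B"])
      show "det ?k \<noteq> 0" unfolding det using A P by simp
      show "val_F D (det ?k) = 2 * val_F D B" unfolding det using A P l by (simp add: val_divide)
      have Ab: "A \<in> F.vball (real_of_int ?n)" "B \<in> F.vball (real_of_int (val_F D B))" by (auto intro: F.ballI)
      have "\<pi> * \<mu> * A \<in> F.vball (1 + real_of_int (- 1 - val_F D B) + real_of_int ?n)"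
        by (intro F.ball_mult unif_ball \<mu>b Ab)
      from F.ball_divide[OF this P(1)] have 1: "(\<pi> * \<mu> * A) / P \<in> F.vball (real_of_int (val_F D B))"
        using P(2) l by (elim F.ball_mono) linarith
      have "\<pi> * B * (\<nu> - \<mu>) \<in> F.vball (1 + real_of_int (val_F D B) + real l)"
        by (intro F.ball_mult unif_ball \<mu>(2) Ab)
      from F.ball_divide[OF this P(1)] have 2: "\<pi> * B * (\<nu> - \<mu>) / P \<in> F.vball (real_of_int (val_F D B))"
        using P(2) by (elim F.ball_mono) linarith
      have "A \<in> F.vball (real_of_int (val_F D B))" using c by (intro F.ballI) simp
      then show "in_lattice (val_F D B) ?k" using 1 2 Ab(2) by (simp add: in_lattice_mat2)
    qed
    moreover have "mat2 A B 0 1 = g1 D l \<mu> ** ?k"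
    proof -
      have "\<pi> * \<mu> * B + P * (\<pi> * B * (\<nu> - \<mu>) / P) = \<pi> * B * \<nu>" using P(1) by (simp add: field_simps)
      then show ?thesis unfolding g1_def P_def[symmetric] using P(1) \<nu>B by simp
    qed
    ultimately show ?thesis using \<mu>(1) unfolding same_coset_def by blast
  qed
qed

lemma same_coset_trans: "same_coset g h \<Longrightarrow> same_coset h k \<Longrightarrow> same_coset g k"
  unfolding same_coset_def using KZ_mult by (metis matrix_mul_assoc)

lemma coset_cases:
  assumes "g \<in> GL2"
  obtains (zero) n \<mu> where "\<mu> \<in> digits D n" "same_coset g (g0 D n \<mu>)"
    | (one) n \<mu> where "\<mu> \<in> digits D n" "same_coset g (g1 D n \<mu>)"
proof -
  obtain A B where AB: "A \<noteq> 0" "same_coset g (mat2 A B 0 1)" using upper_triangular_rep[OF assms] by blast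
  show ?thesis using triangular_coset[OF AB(1), of B] same_coset_trans[OF AB(2)] that by blast
qed

end

section \<open>Substitution in polynomials\<close>

lemma mpoly_sum_monomials: "(\<Sum>m\<in>Poly_Mapping.keys P. Poly_Mapping.single m (Poly_Mapping.lookup P m)) = P"
proof (rule poly_mapping_eqI)
  fix k
  show "Poly_Mapping.lookup (\<Sum>m\<in>Poly_Mapping.keys P. Poly_Mapping.single m (Poly_Mapping.lookup P m)) k = Poly_Mapping.lookup P k"
    by (auto simp: lookup_sum lookup_single when_def sum.delta in_keys_iff)
qed

lemma Const_0 [simp]: "Const 0 = 0" and Const_1 [simp]: "Const 1 = 1"
  and Const_add: "Const (a + b) = Const a + Const b"
  and Const_mult: "Const (a * b) = Const a * Const b"
  and Const_uminus: "Const (- a) = - Const a"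
  by (auto simp: Const_def single_add mult_single single_uminus)

lemma Const_diff: "Const (a - b) = Const a - Const b"
  using Const_add[of a "- b"] by (simp add: Const_uminus)

lemma Const_power: "Const (a ^ n) = Const a ^ n"
  by (induction n) (auto simp: Const_mult)

lemma Var_power: "Var x ^ n = Poly_Mapping.single (Poly_Mapping.single x n) (1 :: 'c::comm_ring_1)"
proof (induction n)
  case (Suc n)
  have "Poly_Mapping.single x (1::nat) + Poly_Mapping.single x n = Poly_Mapping.single x (Suc n)"
    by (simp flip: single_add)
  then show ?case using Suc by (simp add: Var_def mult_single)
qed simp

definition mono_subst :: "('s var \<Rightarrow> ('s, 'c::comm_ring_1) mpoly) \<Rightarrow> ('s var \<Rightarrow>\<^sub>0 nat) \<Rightarrow> ('s, 'c) mpoly" where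
  "mono_subst \<theta> m = (\<Prod>x\<in>Poly_Mapping.keys m. \<theta> x ^ Poly_Mapping.lookup m x)"

lemma mono_subst_superset:
  "finite X \<Longrightarrow> Poly_Mapping.keys m \<subseteq> X \<Longrightarrow> mono_subst \<theta> m = (\<Prod>x\<in>X. \<theta> x ^ Poly_Mapping.lookup m x)"
  unfolding mono_subst_def by (intro prod.mono_neutral_left) (auto simp: in_keys_iff)

lemma mono_subst_add: "mono_subst \<theta> (m + n) = mono_subst \<theta> m * mono_subst \<theta> n"
proof -
  let ?X = "Poly_Mapping.keys m \<union> Poly_Mapping.keys n"
  have "mono_subst \<theta> (m + n) = (\<Prod>x\<in>?X. \<theta> x ^ Poly_Mapping.lookup (m + n) x)"
    by (rule mono_subst_superset) (auto dest: subsetD[OF keys_add])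
  also have "\<dots> = mono_subst \<theta> m * mono_subst \<theta> n"
    by (simp add: mono_subst_superset[of ?X m] mono_subst_superset[of ?X n] lookup_add power_add prod.distrib)
  finally show ?thesis .
qed

lemma mpoly_subst_superset:
  assumes "finite X" "Poly_Mapping.keys P \<subseteq> X"
  shows "mpoly_subst \<theta> P = (\<Sum>m\<in>X. Const (Poly_Mapping.lookup P m) * mono_subst \<theta> m)"
  unfolding mpoly_subst_def mono_subst_def[symmetric]
  by (rule sum.mono_neutral_left) (use assms in \<open>auto simp: in_keys_iff\<close>)

lemma mpoly_subst_0 [simp]: "mpoly_subst \<theta> 0 = 0"
  by (simp add: mpoly_subst_def)

lemma mpoly_subst_add: "mpoly_subst \<theta> (P + Q) = mpoly_subst \<theta> P + mpoly_subst \<theta> Q"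
proof -
  let ?X = "Poly_Mapping.keys P \<union> Poly_Mapping.keys Q"
  have "mpoly_subst \<theta> (P + Q) = (\<Sum>m\<in>?X. Const (Poly_Mapping.lookup (P + Q) m) * mono_subst \<theta> m)"
    by (rule mpoly_subst_superset) (auto dest: subsetD[OF keys_add])
  also have "\<dots> = mpoly_subst \<theta> P + mpoly_subst \<theta> Q"
    by (simp add: mpoly_subst_superset[of ?X P] mpoly_subst_superset[of ?X Q] lookup_add Const_add distrib_right sum.distrib)
  finally show ?thesis .
qed

lemma mpoly_subst_sum: "mpoly_subst \<theta> (sum f A) = (\<Sum>x\<in>A. mpoly_subst \<theta> (f x))"
  by (induction A rule: infinite_finite_induct) (auto simp: mpoly_subst_add)

lemma mpoly_subst_single: "mpoly_subst \<theta> (Poly_Mapping.single m c) = Const c * mono_subst \<theta> m"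
  by (subst mpoly_subst_superset[of "{m}"]) auto

lemma mpoly_subst_mult: "mpoly_subst \<theta> (P * Q) = mpoly_subst \<theta> P * mpoly_subst \<theta> Q"
proof -
  let ?l = Poly_Mapping.lookup and ?s = Poly_Mapping.single and ?k = Poly_Mapping.keys
  have "P * Q = (\<Sum>m\<in>?k P. ?s m (?l P m)) * (\<Sum>n\<in>?k Q. ?s n (?l Q n))"
    by (simp only: mpoly_sum_monomials)
  also have "\<dots> = (\<Sum>m\<in>?k P. \<Sum>n\<in>?k Q. ?s (m + n) (?l P m * ?l Q n))"
    by (simp add: sum_product mult_single)
  finally have "mpoly_subst \<theta> (P * Q)
      = (\<Sum>m\<in>?k P. \<Sum>n\<in>?k Q. (Const (?l P m) * mono_subst \<theta> m) * (Const (?l Q n) * mono_subst \<theta> n))"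
    by (simp add: mpoly_subst_sum mpoly_subst_single mono_subst_add Const_mult mult_ac)
  then show ?thesis
    by (simp add: mpoly_subst_def mono_subst_def sum_product)
qed

lemma mpoly_subst_Const [simp]: "mpoly_subst \<theta> (Const c) = Const c"
  unfolding Const_def mpoly_subst_single by (simp add: mono_subst_def)

lemma mpoly_subst_power: "mpoly_subst \<theta> (P ^ n) = mpoly_subst \<theta> P ^ n"
proof (induction n)
  case 0
  then show ?case using mpoly_subst_Const[of \<theta> 1] by simp
qed (simp add: mpoly_subst_mult)

lemma mpoly_subst_Var [simp]: "mpoly_subst \<theta> (Var x) = \<theta> x"
  unfolding Var_def mpoly_subst_single by (simp add: mono_subst_def)

section \<open>Binary forms as polynomials in one variable\<close>

text \<open>A and B are arbitrary polynomials and not just the two variables, so that a substitution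
  maps forms to expressions of the same shape.\<close>

definition form :: "('s, 'c) mpoly \<Rightarrow> ('s, 'c) mpoly \<Rightarrow> nat \<Rightarrow> 'c::comm_ring_1 poly \<Rightarrow> ('s, 'c) mpoly" where
  "form A B n p = (\<Sum>j\<le>n. Const (coeff p j) * A ^ (n - j) * B ^ j)"

abbreviation homog :: "'s \<Rightarrow> nat \<Rightarrow> 'c::comm_ring_1 poly \<Rightarrow> ('s, 'c) mpoly" where
  "homog s \<equiv> form (Var (XVar s)) (Var (YVar s))"

lemma form_0 [simp]: "form A B n 0 = 0"
  by (simp add: form_def)

lemma form_add: "form A B n (p + r) = form A B n p + form A B n r"
  by (simp add: form_def Const_add distrib_right sum.distrib)

lemma form_smult: "form A B n (smult c p) = Const c * form A B n p"
  by (simp add: form_def Const_mult sum_distrib_left mult.assoc)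

lemma form_diff: "form A B n (p - r) = form A B n p - form A B n r"
  by (simp add: form_def Const_diff left_diff_distrib sum_subtractf)

lemma form_sum: "form A B n (sum f I) = (\<Sum>i\<in>I. form A B n (f i))"
  by (induction I rule: infinite_finite_induct) (auto simp: form_add)

lemma form_monom:
  assumes "i \<le> n"
  shows "form A B n (monom c i) = Const c * A ^ (n - i) * B ^ i"
proof -
  have "form A B n (monom c i) = (\<Sum>j\<le>n. if j = i then Const c * A ^ (n - i) * B ^ i else 0)"
    unfolding form_def by (rule sum.cong) auto
  then show ?thesis using assms by simp
qed

lemma sum_monoms: "degree p \<le> n \<Longrightarrow> p = (\<Sum>i\<le>n. monom (coeff p i) i)"
  by (simp add: poly_as_sum_of_monoms')

lemma form_mult:
  assumes "degree p \<le> m" "degree r \<le> n"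
  shows "form A B m p * form A B n r = form A B (m + n) (p * r)"
proof -
  have "p * r = (\<Sum>i\<le>m. monom (coeff p i) i) * (\<Sum>j\<le>n. monom (coeff r j) j)"
    using sum_monoms[OF assms(1)] sum_monoms[OF assms(2)] by simp
  also have "\<dots> = (\<Sum>i\<le>m. \<Sum>j\<le>n. monom (coeff p i * coeff r j) (i + j))"
    by (simp add: sum_product mult_monom)
  finally have "form A B (m + n) (p * r)
    = (\<Sum>i\<le>m. \<Sum>j\<le>n. form A B (m + n) (monom (coeff p i * coeff r j) (i + j)))"
    by (simp add: form_sum)
  also have "\<dots> = (\<Sum>i\<le>m. \<Sum>j\<le>n. (Const (coeff p i) * A ^ (m - i) * B ^ i) * (Const (coeff r j) * A ^ (n - j) * B ^ j))"
  proof (intro sum.cong refl)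
    fix i j assume "i \<in> {..m}" "j \<in> {..n}"
    then have "m + n - (i + j) = (m - i) + (n - j)" "i + j \<le> m + n" by auto
    then show "form A B (m + n) (monom (coeff p i * coeff r j) (i + j))
        = (Const (coeff p i) * A ^ (m - i) * B ^ i) * (Const (coeff r j) * A ^ (n - j) * B ^ j)"
      by (simp only: form_monom Const_mult power_add mult_ac)
  qed
  also have "\<dots> = form A B m p * form A B n r"
    by (simp add: form_def sum_product)
  finally show ?thesis by simp
qed

lemma degree_power_le': "degree p \<le> m \<Longrightarrow> degree (p ^ n) \<le> n * m" for p :: "'a::comm_ring_1 poly"
  by (rule order.trans[OF degree_power_le]) (metis mult.commute mult_le_mono1)

lemma form_power: "degree p \<le> m \<Longrightarrow> form A B m p ^ n = form A B (n * m) (p ^ n)"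
proof (induction n)
  case 0
  have "form A B 0 1 = 1" by (simp add: form_def)
  then show ?case by simp
next
  case (Suc n)
  have "degree (p ^ n) \<le> n * m"
    by (rule degree_power_le'[OF Suc.prems])
  then show ?case using Suc form_mult[OF Suc.prems] by simp
qed

lemma form_linear: "form A B 1 [:a, c:] = Const a * A + Const c * B"
  by (simp add: form_def)

text \<open>Linear substitution read in the coordinate z = y / x: the linear forms become the
  polynomials u and w.\<close>

lemma form_of_forms:
  assumes "degree u \<le> 1" "degree w \<le> 1"
  shows "form (form A B 1 u) (form A B 1 w) n p = form A B n (\<Sum>j\<le>n. smult (coeff p j) (u ^ (n - j) * w ^ j))"
proof -
  have "Const (coeff p j) * form A B 1 u ^ (n - j) * form A B 1 w ^ j
      = form A B n (smult (coeff p j) (u ^ (n - j) * w ^ j))" if "j \<le> n" for j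
  proof -
    have "degree (u ^ (n - j)) \<le> (n - j) * 1" "degree (w ^ j) \<le> j * 1"
      by (rule degree_power_le', rule assms)+
    then have "form A B 1 u ^ (n - j) * form A B 1 w ^ j = form A B ((n - j) * 1 + j * 1) (u ^ (n - j) * w ^ j)"
      unfolding form_power[OF assms(1)] form_power[OF assms(2)] by (rule form_mult)
    then show ?thesis using that by (simp add: form_smult mult.assoc)
  qed
  then show ?thesis unfolding form_def[of "form A B 1 u"] form_sum by (intro sum.cong) auto
qed

lemma mpoly_subst_form: "mpoly_subst \<theta> (form A B n p) = form (mpoly_subst \<theta> A) (mpoly_subst \<theta> B) n p"
  by (simp add: form_def mpoly_subst_sum mpoly_subst_mult mpoly_subst_power)

definition xy_mono :: "'s \<Rightarrow> nat \<Rightarrow> nat \<Rightarrow> ('s var \<Rightarrow>\<^sub>0 nat)" where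
  "xy_mono s i j = Poly_Mapping.single (XVar s) i + Poly_Mapping.single (YVar s) j"

lemma lookup_xy_mono: "Poly_Mapping.lookup (xy_mono s i j) (YVar s) = j"
  "Poly_Mapping.lookup (xy_mono s i j) (XVar t) = (if t = s then i else 0)"
  by (auto simp: xy_mono_def lookup_add lookup_single when_def)

lemma XY_power: "Const c * Var (XVar s) ^ i * Var (YVar s) ^ j = Poly_Mapping.single (xy_mono s i j) c"
  by (simp add: Const_def Var_power mult_single xy_mono_def)

lemma hom_eq: "homog s n p = (\<Sum>j\<le>n. Poly_Mapping.single (xy_mono s (n - j) j) (coeff p j))"
  by (simp add: form_def XY_power)

lemma lookup_hom:
  assumes "j \<le> n"
  shows "Poly_Mapping.lookup (homog s n p) (xy_mono s (n - j) j) = coeff p j"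
proof -
  have "Poly_Mapping.lookup (homog s n p) (xy_mono s (n - j) j) = (\<Sum>i\<le>n. if i = j then coeff p j else 0)"
    unfolding hom_eq lookup_sum
  proof (rule sum.cong[OF refl])
    fix i
    have "xy_mono s (n - i) i = xy_mono s (n - j) j \<longleftrightarrow> i = j"
      using lookup_xy_mono(1) by metis
    then show "Poly_Mapping.lookup (Poly_Mapping.single (xy_mono s (n - i) i) (coeff p i)) (xy_mono s (n - j) j)
        = (if i = j then coeff p j else 0)"
      by (auto simp: lookup_single when_def)
  qed
  then show ?thesis using assms by simp
qed

lemma hom_inject:
  assumes "homog s n p = homog s n r" "degree p \<le> n" "degree r \<le> n"
  shows "p = r"
proof (rule poly_eqI)
  fix j
  show "coeff p j = coeff r j"
    using lookup_hom[of j n s p] lookup_hom[of j n s r] assms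
    by (cases "j \<le> n") (auto simp: coeff_eq_0)
qed

section \<open>The representation in a single weight\<close>

locale single_weight = hecke_data D for D :: "('p::prime_card, 'f::field, 'c::field) padic_data" +
  fixes k :: "('f \<Rightarrow> 'c) \<Rightarrow> nat" and \<sigma> :: "'f \<Rightarrow> 'c"
  assumes \<sigma>_Emb: "\<sigma> \<in> Emb D" and k_single: "\<And>\<sigma>'. \<sigma>' \<in> Emb D \<Longrightarrow> \<sigma>' \<noteq> \<sigma> \<Longrightarrow> k \<sigma>' = 0"
begin

abbreviation \<open>K \<equiv> k \<sigma>\<close>

abbreviation \<open>s \<equiv> sqrt_unif D \<sigma>\<close>

sublocale \<sigma>: comm_ring_hom \<sigma>
  by (rule Emb_hom[OF \<sigma>_Emb])

lemma s_square: "s * s = \<sigma> \<pi>"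
  using setting \<sigma>_Emb unfolding padic_setting_def by (simp add: power2_eq_square)

lemma s_nonzero: "s \<noteq> 0"
  using s_square unif Emb_eq_0_iff[OF \<sigma>_Emb, of \<pi>] by auto

lemma tensor_monom_eq:
  assumes "i \<in> (\<Pi>\<^sub>E \<sigma>'\<in>Emb D. {..k \<sigma>'})"
  shows "tensor_monom D k i = Var (XVar \<sigma>) ^ (K - i \<sigma>) * Var (YVar \<sigma>) ^ i \<sigma>"
proof -
  have "(\<Prod>\<sigma>'\<in>Emb D - {\<sigma>}. Var (XVar \<sigma>') ^ (k \<sigma>' - i \<sigma>') * Var (YVar \<sigma>') ^ i \<sigma>') = (1 :: ('f \<Rightarrow> 'c, 'c) mpoly)"
  proof (rule prod.neutral, rule ballI)
    fix \<sigma>' assume *: "\<sigma>' \<in> Emb D - {\<sigma>}"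
    have "i \<sigma>' \<in> {..k \<sigma>'}" by (rule PiE_mem[OF assms]) (use * in simp)
    then have "i \<sigma>' = 0" "k \<sigma>' = 0" using k_single * by auto
    then show "Var (XVar \<sigma>') ^ (k \<sigma>' - i \<sigma>') * Var (YVar \<sigma>') ^ i \<sigma>' = (1 :: ('f \<Rightarrow> 'c, 'c) mpoly)" by simp
  qed
  then show ?thesis unfolding tensor_monom_def prod.remove[OF finite_Emb \<sigma>_Emb] by simp
qed

text \<open>Away from \<sigma> the weights are 0, so a multi-index is determined by its component at
  \<sigma>.\<close>

lemma index_bij: "bij_betw (\<lambda>i. i \<sigma>) (\<Pi>\<^sub>E \<sigma>'\<in>Emb D. {..k \<sigma>'}) {..K}"
proof (rule bij_betwI[where g = "\<lambda>j. restrict (\<lambda>\<sigma>'. if \<sigma>' = \<sigma> then j else 0) (Emb D)"])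
  show "(\<lambda>i. i \<sigma>) \<in> (\<Pi>\<^sub>E \<sigma>'\<in>Emb D. {..k \<sigma>'}) \<rightarrow> {..K}"
    using \<sigma>_Emb by (auto dest: PiE_mem)
  show "(\<lambda>j. restrict (\<lambda>\<sigma>'. if \<sigma>' = \<sigma> then j else 0) (Emb D)) \<in> {..K} \<rightarrow> (\<Pi>\<^sub>E \<sigma>'\<in>Emb D. {..k \<sigma>'})"
    by auto
  show "restrict (\<lambda>\<sigma>'. if \<sigma>' = \<sigma> then i \<sigma> else 0) (Emb D) = i" if i: "i \<in> (\<Pi>\<^sub>E \<sigma>'\<in>Emb D. {..k \<sigma>'})" for i
  proof (rule PiE_ext[where k = "Emb D" and s = "\<lambda>_. UNIV"])
    fix \<sigma>' assume *: "\<sigma>' \<in> Emb D"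
    have "i \<sigma>' \<in> {..k \<sigma>'}" by (rule PiE_mem[OF i *])
    then show "restrict (\<lambda>\<sigma>'. if \<sigma>' = \<sigma> then i \<sigma> else 0) (Emb D) \<sigma>' = i \<sigma>'"
      using * k_single by (cases "\<sigma>' = \<sigma>") auto
  qed (use i in \<open>auto simp: PiE_def\<close>)
qed (use \<sigma>_Emb in auto)

lemma monom_span_eq:
  assumes "0 \<in> R"
  shows "monom_span D k R = {homog \<sigma> K p | p. degree p \<le> K \<and> (\<forall>j. coeff p j \<in> R)}"
proof -
  let ?I = "\<Pi>\<^sub>E \<sigma>'\<in>Emb D. {..k \<sigma>'}"
  have key: "(\<Sum>i\<in>?I. Const (c (i \<sigma>)) * tensor_monom D k i) = (\<Sum>j\<le>K. Const (c j) * Var (XVar \<sigma>) ^ (K - j) * Var (YVar \<sigma>) ^ j)"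
    for c :: "nat \<Rightarrow> 'c"
    unfolding sum.reindex_bij_betw[OF index_bij, symmetric, of "\<lambda>j. Const (c j) * Var (XVar \<sigma>) ^ (K - j) * Var (YVar \<sigma>) ^ j"]
    by (intro sum.cong refl) (simp add: tensor_monom_eq mult.assoc)
  show ?thesis
  proof (intro equalityI subsetI)
    fix P assume "P \<in> monom_span D k R"
    then obtain c where P: "P = (\<Sum>i\<in>?I. Const (c i) * tensor_monom D k i)" and c: "\<And>i. c i \<in> R"
      by (auto simp: monom_span_def)
    \<comment> \<open>The given coefficients are indexed by full multi-indices; they are pulled back
      to the exponent of y at \<sigma>.\<close>
    define c' where "c' j = c (inv_into ?I (\<lambda>i. i \<sigma>) j)" for j
    have "P = (\<Sum>i\<in>?I. Const (c' (i \<sigma>)) * tensor_monom D k i)"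
      unfolding P c'_def using bij_betw_inv_into_left[OF index_bij] by (intro sum.cong refl) simp
    then have P2: "P = (\<Sum>j\<le>K. Const (c' j) * Var (XVar \<sigma>) ^ (K - j) * Var (YVar \<sigma>) ^ j)" by (simp only: key)
    define p where "p = (\<Sum>j\<le>K. monom (c' j) j)"
    have cp: "coeff p j = (if j \<le> K then c' j else 0)" for j
      by (simp add: p_def coeff_sum)
    have "P = homog \<sigma> K p" unfolding P2 form_def by (intro sum.cong refl) (simp add: cp)
    moreover have "degree p \<le> K" by (rule degree_le) (simp add: cp)
    moreover have "coeff p j \<in> R" for j using c assms by (simp add: cp c'_def)
    ultimately show "P \<in> {homog \<sigma> K p | p. degree p \<le> K \<and> (\<forall>j. coeff p j \<in> R)}" by blast
  next
    fix P assume "P \<in> {homog \<sigma> K p | p. degree p \<le> K \<and> (\<forall>j. coeff p j \<in> R)}"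
    then obtain p where P: "P = homog \<sigma> K p" "\<And>j. coeff p j \<in> R" by blast
    have "P = (\<Sum>i\<in>?I. Const (coeff p (i \<sigma>)) * tensor_monom D k i)" unfolding key P(1) form_def ..
    then show "P \<in> monom_span D k R" unfolding monom_span_def mem_Collect_eq
      using P(2) by (intro exI[of _ "\<lambda>i. coeff p (i \<sigma>)"]) simp
  qed
qed

lemma Vk_eq: "Vk D k = {homog \<sigma> K p | p. degree p \<le> K}"
  unfolding Vk_def by (simp add: monom_span_eq)

lemma Vk0_eq: "Vk0 D k = {homog \<sigma> K p | p. degree p \<le> K \<and> p \<in> C.pball 0}"
  unfolding Vk0_def O_C_eq by (simp add: monom_span_eq C.pball_def)

lemma Vk0_sub_Vk: "Vk0 D k \<subseteq> Vk D k"
  unfolding Vk_eq Vk0_eq by blast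

lemma Vk_E:
  assumes "P \<in> Vk D k"
  obtains p where "P = homog \<sigma> K p" "degree p \<le> K"
  using assms unfolding Vk_eq by blast

lemma hom_Vk: "degree p \<le> K \<Longrightarrow> homog \<sigma> K p \<in> Vk D k"
  unfolding Vk_eq by blast

lemma Vk_zero: "0 \<in> Vk D k" and Vk0_zero: "0 \<in> Vk0 D k"
proof -
  have "homog \<sigma> K 0 = (0 :: ('f \<Rightarrow> 'c, 'c) mpoly)" by simp
  then show "0 \<in> Vk D k" "0 \<in> Vk0 D k"
    unfolding Vk_eq Vk0_eq mem_Collect_eq by (metis degree_0 le0 C.pball_zero)+
qed

section \<open>The action on polynomials in one variable\<close>

definition twist :: "'f ^ 2 ^ 2 \<Rightarrow> 'c" where
  "twist g = s powi (- val_F D (det g) * int K)"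

definition act :: "'f ^ 2 ^ 2 \<Rightarrow> 'c poly \<Rightarrow> 'c poly" where
  "act g p = smult (twist g) (\<Sum>j\<le>K. smult (coeff p j)
     ([:\<sigma> (g $ 1 $ 1), \<sigma> (g $ 2 $ 1):] ^ (K - j) * [:\<sigma> (g $ 1 $ 2), \<sigma> (g $ 2 $ 2):] ^ j))"

abbreviation subst_of :: "'f ^ 2 ^ 2 \<Rightarrow> ('f \<Rightarrow> 'c) var \<Rightarrow> ('f \<Rightarrow> 'c, 'c) mpoly" where
  "subst_of g \<equiv> (\<lambda>x. case x of
         XVar \<sigma> \<Rightarrow> Const (\<sigma> (g $ 1 $ 1)) * Var (XVar \<sigma>) + Const (\<sigma> (g $ 2 $ 1)) * Var (YVar \<sigma>)
       | YVar \<sigma> \<Rightarrow> Const (\<sigma> (g $ 1 $ 2)) * Var (XVar \<sigma>) + Const (\<sigma> (g $ 2 $ 2)) * Var (YVar \<sigma>))"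

lemma rho_eq: "rho D k g P = Const (twist g) * mpoly_subst (subst_of g) P"
proof -
  have "(\<Prod>\<sigma>'\<in>Emb D - {\<sigma>}. sqrt_unif D \<sigma>' powi (- val_F D (det g) * int (k \<sigma>'))) = 1"
    by (rule prod.neutral) (use k_single in auto)
  then have "(\<Prod>\<sigma>'\<in>Emb D. sqrt_unif D \<sigma>' powi (- val_F D (det g) * int (k \<sigma>'))) = twist g"
    unfolding prod.remove[OF finite_Emb \<sigma>_Emb] twist_def by simp
  then show ?thesis unfolding rho_def by simp
qed

lemma degree_act: "degree (act g p) \<le> K"
proof -
  have "degree (smult (coeff p j) ([:\<sigma> (g $ 1 $ 1), \<sigma> (g $ 2 $ 1):] ^ (K - j) * [:\<sigma> (g $ 1 $ 2), \<sigma> (g $ 2 $ 2):] ^ j)) \<le> K"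
    if "j \<le> K" for j
  proof -
    let ?u = "[:\<sigma> (g $ 1 $ 1), \<sigma> (g $ 2 $ 1):] ^ (K - j)" and ?w = "[:\<sigma> (g $ 1 $ 2), \<sigma> (g $ 2 $ 2):] ^ j"
    have "degree ?u \<le> (K - j) * 1" "degree ?w \<le> j * 1" by (rule degree_power_le', simp)+
    then show ?thesis
      using degree_smult_le[of "coeff p j" "?u * ?w"] degree_mult_le[of ?u ?w] that by linarith
  qed
  then show ?thesis unfolding act_def by (intro order.trans[OF degree_smult_le degree_sum_le]) auto
qed

lemma rho_hom: "rho D k g (homog \<sigma> K p) = homog \<sigma> K (act g p)"
proof -
  have "mpoly_subst (subst_of g) (homog \<sigma> K p)
      = form (homog \<sigma> 1 [:\<sigma> (g $ 1 $ 1), \<sigma> (g $ 2 $ 1):]) (homog \<sigma> 1 [:\<sigma> (g $ 1 $ 2), \<sigma> (g $ 2 $ 2):]) K p"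
    unfolding mpoly_subst_form form_linear by simp
  also have "\<dots> = homog \<sigma> K (\<Sum>j\<le>K. smult (coeff p j)
     ([:\<sigma> (g $ 1 $ 1), \<sigma> (g $ 2 $ 1):] ^ (K - j) * [:\<sigma> (g $ 1 $ 2), \<sigma> (g $ 2 $ 2):] ^ j))"
    by (rule form_of_forms) auto
  finally show ?thesis unfolding rho_eq act_def by (simp add: form_smult)
qed

lemma rho_Vk: "P \<in> Vk D k \<Longrightarrow> rho D k g P \<in> Vk D k"
  by (elim Vk_E) (simp add: rho_hom hom_Vk degree_act)

lemma rho_0 [simp]: "rho D k g 0 = 0"
  by (simp add: rho_eq)

lemma rho_Const_mult: "rho D k g (Const c * P) = Const c * rho D k g P"
  by (simp add: rho_eq mpoly_subst_mult mult_ac)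

lemma twist_mult: "g \<in> GL2 \<Longrightarrow> h \<in> GL2 \<Longrightarrow> twist (g ** h) = twist g * twist h"
proof -
  assume "g \<in> GL2" "h \<in> GL2"
  then have "val_F D (det (g ** h)) = val_F D (det g) + val_F D (det h)"
    by (simp add: det_mul val_mult GL2_iff)
  then have eq: "- val_F D (det (g ** h)) * int K = - val_F D (det g) * int K + - val_F D (det h) * int K"
    by (simp add: algebra_simps)
  show ?thesis unfolding twist_def eq by (rule power_int_add) (use s_nonzero in simp)
qed

lemma rho_mult:
  assumes "g \<in> GL2" "h \<in> GL2" "P \<in> Vk D k"
  shows "rho D k (g ** h) P = rho D k g (rho D k h P)"
proof -
  obtain p where P: "P = homog \<sigma> K p" using assms(3) by (auto simp: Vk_eq)
  have e: "(g ** h) $ i $ j = g $ i $ 1 * h $ 1 $ j + g $ i $ 2 * h $ 2 $ j" for i j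
    by (simp add: matrix_matrix_mult_def sum_2)
  have "mpoly_subst (subst_of g) (mpoly_subst (subst_of h) P) = mpoly_subst (subst_of (g ** h)) P"
    unfolding P mpoly_subst_form
    by (simp add: mpoly_subst_add mpoly_subst_mult e \<sigma>.hom_add \<sigma>.hom_mult Const_add Const_mult algebra_simps)
  then show ?thesis
    unfolding rho_eq mpoly_subst_mult mpoly_subst_Const twist_mult[OF assms(1,2)] Const_mult by (simp add: mult.assoc)
qed

lemma rho_scalar:
  assumes "z \<noteq> 0" "P \<in> Vk D k"
  shows "rho D k (mat z) P = Const ((\<sigma> z * s powi (- 2 * val_F D z)) ^ K) * P"
proof -
  obtain p where P: "P = homog \<sigma> K p" using assms(2) by (auto simp: Vk_eq)
  have "mpoly_subst (subst_of (mat z)) P = form (Const (\<sigma> z) * Var (XVar \<sigma>)) (Const (\<sigma> z) * Var (YVar \<sigma>)) K p"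
    unfolding P mpoly_subst_form by (simp add: mat_eq_mat2)
  also have "\<dots> = Const (\<sigma> z ^ K) * P"
  proof -
    have "Const (coeff p j) * (Const (\<sigma> z) * Var (XVar \<sigma>)) ^ (K - j) * (Const (\<sigma> z) * Var (YVar \<sigma>)) ^ j
      = Const (\<sigma> z ^ K) * (Const (coeff p j) * Var (XVar \<sigma>) ^ (K - j) * Var (YVar \<sigma>) ^ j)" if "j \<le> K" for j
    proof -
      have eq: "Const (\<sigma> z ^ K) = Const (\<sigma> z) ^ (K - j) * Const (\<sigma> z) ^ j"
        using that by (simp add: Const_power flip: power_add)
      show ?thesis by (simp only: eq power_mult_distrib mult_ac)
    qed
    then show ?thesis unfolding P form_def sum_distrib_left by (intro sum.cong[OF refl]) simp
  qed
  finally have 1: "mpoly_subst (subst_of (mat z)) P = Const (\<sigma> z ^ K) * P" .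
  have 2: "twist (mat z) = (s powi (- 2 * val_F D z)) ^ K"
  proof -
    have "det (mat z :: 'f ^ 2 ^ 2) = z * z" by (simp add: mat_eq_mat2)
    then have "- val_F D (det (mat z :: 'f ^ 2 ^ 2)) = - 2 * val_F D z" using assms(1) by (simp add: val_mult)
    then show ?thesis unfolding twist_def by (simp only: power_int_mult power_int_of_nat)
  qed
  show ?thesis unfolding rho_eq 1 2 by (simp only: Const_mult power_mult_distrib mult_ac)
qed

text \<open>If the determinant has valuation 2l, the entries contribute \<pi>^(lK). As v(s) = 1/2,
  the twist contributes exactly \<pi>^(- lK).\<close>

lemma act_KZ_integral:
  assumes "g \<in> KZ D" "p \<in> C.pball 0"
  shows "act g p \<in> C.pball 0"
proof -
  obtain l where l: "g \<in> GL2" "val_F D (det g) = 2 * l" "in_lattice l g" using assms(1) by (auto simp: KZ_iff)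
  have ent: "\<sigma> (g $ i $ j) \<in> C.vball (real_of_int l)" for i j
    using l(3) Emb_ball[OF \<sigma>_Emb] by (simp add: in_lattice_def)
  have lin: "[:a, b:] ^ n \<in> C.pball (real n * real_of_int l)"
    if "a \<in> C.vball (real_of_int l)" "b \<in> C.vball (real_of_int l)" for a b n
  proof (induction n)
    case (Suc n)
    have "[:a, b:] \<in> C.pball (real_of_int l)" using that by simp
    from C.pball_mult[OF this Suc] show ?case by (simp add: algebra_simps)
  qed simp
  have "(\<Sum>j\<le>K. smult (coeff p j) ([:\<sigma> (g $ 1 $ 1), \<sigma> (g $ 2 $ 1):] ^ (K - j) * [:\<sigma> (g $ 1 $ 2), \<sigma> (g $ 2 $ 2):] ^ j))
      \<in> C.pball (real K * real_of_int l)"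
  proof (rule C.pball_sum)
    fix j assume j: "j \<in> {..K}"
    have "[:\<sigma> (g $ 1 $ 1), \<sigma> (g $ 2 $ 1):] ^ (K - j) * [:\<sigma> (g $ 1 $ 2), \<sigma> (g $ 2 $ 2):] ^ j \<in> C.pball (real K * real_of_int l)"
      by (rule C.pball_mult[OF lin[OF ent ent] lin[OF ent ent]])
        (use j in \<open>simp add: of_nat_diff algebra_simps\<close>)
    then show "smult (coeff p j) ([:\<sigma> (g $ 1 $ 1), \<sigma> (g $ 2 $ 1):] ^ (K - j) * [:\<sigma> (g $ 1 $ 2), \<sigma> (g $ 2 $ 2):] ^ j)
        \<in> C.pball (real K * real_of_int l)"
      by (rule C.pball_smult[OF C.pballD[OF assms(2)]]) simp
  qed
  moreover have "twist g \<in> C.vball (- real K * real_of_int l)"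
  proof -
    have vs: "val_C D (s powi n) = real_of_int n * val_C D s" for n
      using C.v_power[OF s_nonzero] C.v_power[of "inverse s"] C.v_inverse[OF s_nonzero] s_nonzero
      by (auto simp: power_int_def)
    have "val_C D s + val_C D s = 1"
      using C.v_mult[OF s_nonzero s_nonzero] s_square val_C_Emb[OF \<sigma>_Emb unif(1)] unif(2) by simp
    then have "val_C D s = 1 / 2" by simp
    then have "val_C D (twist g) = - real K * real_of_int l" by (simp add: twist_def vs l(2))
    then show ?thesis by (intro C.ballI) simp
  qed
  ultimately show ?thesis unfolding act_def by (intro C.pball_smult) auto
qed

lemma rho_KZ_Vk0: "g \<in> KZ D \<Longrightarrow> P \<in> Vk0 D k \<Longrightarrow> rho D k g P \<in> Vk0 D k"
proof -
  assume g: "g \<in> KZ D" and "P \<in> Vk0 D k"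
  then obtain p where p: "P = homog \<sigma> K p" "p \<in> C.pball 0" unfolding Vk0_eq by blast
  show ?thesis
    unfolding p(1) rho_hom Vk0_eq using degree_act[of g p] act_KZ_integral[OF g p(2)] by blast
qed

end

section \<open>The Hecke operator as a sum over neighbours\<close>

lemma fsum_eq:
  assumes "finite B" "B \<subseteq> A" "\<And>i. i \<in> A - B \<Longrightarrow> t i = 0"
  shows "fsum A t = sum t B"
  unfolding fsum_def using assms by (intro sum.mono_neutral_left) auto

lemma Uk_superset:
  assumes "finite X" "Poly_Mapping.keys P \<subseteq> X"
  shows "Uk D P = (\<Sum>m\<in>X. Poly_Mapping.single m
    (Poly_Mapping.lookup P m * (\<Prod>\<sigma>\<in>Emb D. \<sigma> (unif D) ^ Poly_Mapping.lookup m (XVar \<sigma>))))"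
  unfolding Uk_def by (rule sum.mono_neutral_left) (use assms in \<open>auto simp: in_keys_iff\<close>)

lemma Uk_add: "Uk D (P + Q) = Uk D P + Uk D Q"
proof -
  let ?X = "Poly_Mapping.keys P \<union> Poly_Mapping.keys Q"
  have "Poly_Mapping.keys (P + Q) \<subseteq> ?X" by (rule keys_add)
  then show ?thesis
    by (simp add: Uk_superset[of ?X] lookup_add distrib_right single_add sum.distrib)
qed

lemma Uk_sum: "Uk D (sum f A) = (\<Sum>x\<in>A. Uk D (f x))"
proof (induction A rule: infinite_finite_induct)
  case (infinite A)
  then show ?case by (simp add: Uk_def)
next
  case empty
  then show ?case by (simp add: Uk_def)
qed (simp add: Uk_add)

lemma Uk_single: "Uk D (Poly_Mapping.single m c) =
    Poly_Mapping.single m (c * (\<Prod>\<sigma>\<in>Emb D. \<sigma> (unif D) ^ Poly_Mapping.lookup m (XVar \<sigma>)))"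
  by (subst Uk_superset[of "{m}"]) auto

context single_weight
begin

section \<open>\<psi> as a multiple of the representation on its support\<close>

definition double_coset :: "('f ^ 2 ^ 2) set" where
  "double_coset = {g. \<exists>\<kappa>1\<in>KZ D. \<exists>\<kappa>2\<in>KZ D. g = \<kappa>1 ** matrix_inv (alpha D) ** \<kappa>2}"

lemma alpha_GL2: "alpha D \<in> GL2"
  using unif by (simp add: alpha_def GL2_iff)

lemma inv_alpha: "matrix_inv (alpha D) = mat2 1 0 0 (inverse \<pi>)"
  unfolding alpha_def using unif by (subst matrix_inv_mat2) (auto simp: field_simps)

text \<open>The inverse of \<alpha> fixes x and divides y by \<pi>, and its twist is s^K; one more
  s^K completes the factor to \<pi>^(K - j) on x^(K - j) y^j. Consequently \<psi>(g) is s^K times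
  the action of g, and its independence of the decomposition of g is immediate.\<close>

lemma Uk_hom: "Uk D (homog \<sigma> K p) = Const (s ^ K) * rho D k (matrix_inv (alpha D)) (homog \<sigma> K p)"
proof -
  have prod: "(\<Prod>\<sigma>'\<in>Emb D. \<sigma>' \<pi> ^ Poly_Mapping.lookup (xy_mono \<sigma> i j) (XVar \<sigma>')) = \<sigma> \<pi> ^ i" for i j
  proof -
    have "(\<Prod>\<sigma>'\<in>Emb D - {\<sigma>}. \<sigma>' \<pi> ^ Poly_Mapping.lookup (xy_mono \<sigma> i j) (XVar \<sigma>')) = 1"
      by (rule prod.neutral) (auto simp: lookup_xy_mono)
    then show ?thesis unfolding prod.remove[OF finite_Emb \<sigma>_Emb] by (simp add: lookup_xy_mono)
  qed
  have "det (mat2 1 0 0 (inverse \<pi>)) = inverse \<pi>" by simp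
  then have tw: "twist (matrix_inv (alpha D)) = s ^ K"
    unfolding twist_def inv_alpha using unif val_inverse[of \<pi>] by simp
  have inv: "\<sigma> (inverse \<pi>) = inverse (\<sigma> \<pi>)"
    using \<sigma>.hom_mult[of \<pi> "inverse \<pi>"] unif Emb_eq_0_iff[OF \<sigma>_Emb, of \<pi>] by (simp add: field_simps)
  have ss: "s ^ K * s ^ K = \<sigma> \<pi> ^ K" by (simp add: s_square flip: power_mult_distrib)
  have "rho D k (matrix_inv (alpha D)) (homog \<sigma> K p)
    = Const (s ^ K) * form (Var (XVar \<sigma>)) (Const (inverse (\<sigma> \<pi>)) * Var (YVar \<sigma>)) K p"
    unfolding rho_eq tw mpoly_subst_form by (simp add: inv_alpha inv)
  then have "Const (s ^ K) * rho D k (matrix_inv (alpha D)) (homog \<sigma> K p)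
    = (\<Sum>j\<le>K. Const (\<sigma> \<pi> ^ K) * (Const (coeff p j) * Var (XVar \<sigma>) ^ (K - j) * (Const (inverse (\<sigma> \<pi>)) * Var (YVar \<sigma>)) ^ j))"
    by (simp add: form_def sum_distrib_left ss mult.assoc[symmetric] Const_mult[symmetric])
  also have "\<dots> = (\<Sum>j\<le>K. Const (coeff p j * \<sigma> \<pi> ^ (K - j)) * Var (XVar \<sigma>) ^ (K - j) * Var (YVar \<sigma>) ^ j)"
  proof (intro sum.cong refl)
    fix j assume "j \<in> {..K}"
    then have "\<sigma> \<pi> ^ K = \<sigma> \<pi> ^ (K - j) * \<sigma> \<pi> ^ j" by (simp flip: power_add)
    then have e: "\<sigma> \<pi> ^ K * coeff p j * inverse (\<sigma> \<pi>) ^ j = coeff p j * \<sigma> \<pi> ^ (K - j)"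
      using unif Emb_eq_0_iff[OF \<sigma>_Emb, of \<pi>] by (simp add: field_simps)
    have "Const (\<sigma> \<pi> ^ K) * (Const (coeff p j) * Var (XVar \<sigma>) ^ (K - j) * (Const (inverse (\<sigma> \<pi>)) * Var (YVar \<sigma>)) ^ j)
      = Const (\<sigma> \<pi> ^ K * coeff p j * inverse (\<sigma> \<pi>) ^ j) * Var (XVar \<sigma>) ^ (K - j) * Var (YVar \<sigma>) ^ j"
      by (simp only: Const_mult Const_power power_mult_distrib mult_ac)
    then show "Const (\<sigma> \<pi> ^ K) * (Const (coeff p j) * Var (XVar \<sigma>) ^ (K - j) * (Const (inverse (\<sigma> \<pi>)) * Var (YVar \<sigma>)) ^ j)
      = Const (coeff p j * \<sigma> \<pi> ^ (K - j)) * Var (XVar \<sigma>) ^ (K - j) * Var (YVar \<sigma>) ^ j"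
      by (simp only: e)
  qed
  also have "\<dots> = Uk D (homog \<sigma> K p)"
    by (simp add: hom_eq Uk_sum Uk_single prod XY_power)
  finally show ?thesis by simp
qed

lemma psi_eq:
  assumes P: "P \<in> Vk D k"
  shows "psi D k g P = (if g \<in> double_coset then Const (s ^ K) * rho D k g P else 0)"
proof -
  have val: "rho D k \<kappa>1 (Uk D (rho D k \<kappa>2 P)) = Const (s ^ K) * rho D k (\<kappa>1 ** matrix_inv (alpha D) ** \<kappa>2) P"
    if \<kappa>: "\<kappa>1 \<in> KZ D" "\<kappa>2 \<in> KZ D" for \<kappa>1 \<kappa>2
  proof -
    note gl = KZ_GL2[OF \<kappa>(1)] KZ_GL2[OF \<kappa>(2)] GL2_inv[OF alpha_GL2]
    obtain p where p: "rho D k \<kappa>2 P = homog \<sigma> K p" using rho_Vk[OF P] by (rule Vk_E)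
    have "rho D k \<kappa>1 (Uk D (rho D k \<kappa>2 P)) = Const (s ^ K) * rho D k \<kappa>1 (rho D k (matrix_inv (alpha D)) (rho D k \<kappa>2 P))"
      unfolding p Uk_hom by (rule rho_Const_mult)
    then show ?thesis
      using gl P rho_Vk[OF P] by (simp add: rho_mult GL2_mult)
  qed
  show ?thesis
  proof (cases "g \<in> double_coset")
    case True
    then have ex: "\<exists>\<kappa>1\<in>KZ D. \<exists>\<kappa>2\<in>KZ D. g = \<kappa>1 ** matrix_inv (alpha D) ** \<kappa>2" by (simp add: double_coset_def)
    have "(THE Q. \<exists>\<kappa>1\<in>KZ D. \<exists>\<kappa>2\<in>KZ D. g = \<kappa>1 ** matrix_inv (alpha D) ** \<kappa>2
                    \<and> Q = rho D k \<kappa>1 (Uk D (rho D k \<kappa>2 P))) = Const (s ^ K) * rho D k g P"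
    proof (rule the_equality)
      show "\<exists>\<kappa>1\<in>KZ D. \<exists>\<kappa>2\<in>KZ D. g = \<kappa>1 ** matrix_inv (alpha D) ** \<kappa>2
          \<and> Const (s ^ K) * rho D k g P = rho D k \<kappa>1 (Uk D (rho D k \<kappa>2 P))"
        using ex val by metis
    qed (use val in auto)
    then show ?thesis unfolding psi_def using ex True by simp
  next
    case False
    then show ?thesis unfolding psi_def double_coset_def by auto
  qed
qed

lemma double_coset_GL2: "g \<in> double_coset \<Longrightarrow> g \<in> GL2"
  unfolding double_coset_def using GL2_mult KZ_GL2 GL2_inv[OF alpha_GL2] by blast

lemma double_coset_mult_left:
  assumes "\<kappa> \<in> KZ D"
  shows "\<kappa> ** g \<in> double_coset \<longleftrightarrow> g \<in> double_coset"
proof -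
  have *: "\<kappa> ** g \<in> double_coset" if \<kappa>: "\<kappa> \<in> KZ D" and g: "g \<in> double_coset" for \<kappa> g
  proof -
    obtain \<kappa>1 \<kappa>2 where k: "\<kappa>1 \<in> KZ D" "\<kappa>2 \<in> KZ D" "g = \<kappa>1 ** matrix_inv (alpha D) ** \<kappa>2"
      using g by (auto simp: double_coset_def)
    then have "\<kappa> ** g = (\<kappa> ** \<kappa>1) ** matrix_inv (alpha D) ** \<kappa>2" by (simp add: matrix_mul_assoc)
    then show ?thesis unfolding double_coset_def using KZ_mult[OF \<kappa> k(1)] k(2) by blast
  qed
  show ?thesis
    using *[OF assms, of g] *[OF KZ_inv[OF assms], of "\<kappa> ** g"] mult_inv_cancel(2)[OF KZ_GL2[OF assms]] by auto
qed

lemma double_coset_mult_right: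
  assumes "\<kappa> \<in> KZ D"
  shows "g ** \<kappa> \<in> double_coset \<longleftrightarrow> g \<in> double_coset"
proof -
  have *: "g ** \<kappa> \<in> double_coset" if \<kappa>: "\<kappa> \<in> KZ D" and g: "g \<in> double_coset" for \<kappa> g
  proof -
    obtain \<kappa>1 \<kappa>2 where k: "\<kappa>1 \<in> KZ D" "\<kappa>2 \<in> KZ D" "g = \<kappa>1 ** matrix_inv (alpha D) ** \<kappa>2"
      using g by (auto simp: double_coset_def)
    then have "g ** \<kappa> = \<kappa>1 ** matrix_inv (alpha D) ** (\<kappa>2 ** \<kappa>)" by (simp add: matrix_mul_assoc)
    then show ?thesis unfolding double_coset_def using KZ_mult[OF k(2) \<kappa>] k(1) by blast
  qed
  show ?thesis
    using *[OF assms, of g] *[OF KZ_inv[OF assms], of "g ** \<kappa>"] mult_inv_cancel(3)[OF KZ_GL2[OF assms]] by auto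
qed

section \<open>The neighbours of a vertex\<close>

definition neighbours :: "('f ^ 2 ^ 2) set" where
  "neighbours = insert (alpha D) (g0 D 1 ` digits D 1)"

lemma finite_neighbours: "finite neighbours"
  by (simp add: neighbours_def finite_digits)

lemma alpha_g1: "alpha D = g1 D 0 0"
  by (simp add: alpha_def g1_def)

lemma neighbours_GL2: "y \<in> neighbours \<Longrightarrow> y \<in> GL2"
  by (auto simp: neighbours_def alpha_GL2 g0_GL2)

text \<open>Multiplying the inverse of \<alpha> by \<pi> \<open>swap\<close> on the left and by
  \<open>swap\<close> on the right gives \<alpha>, so the two have the same double coset. The other
  neighbours arise from \<alpha> through integral matrices with unit determinant.\<close>

lemma neighbours_double_coset:
  assumes "y \<in> neighbours"
  shows "y \<in> double_coset"
proof -
  have "mat2 \<pi> 0 0 \<pi> \<in> KZ D"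
    by (rule KZ_I[of _ 1]) (use unif in \<open>auto simp: val_mult in_lattice_mat2 unif_ball\<close>)
  then have k: "mat2 0 \<pi> \<pi> 0 \<in> KZ D" using KZ_mult[OF swap_KZ, of "mat2 \<pi> 0 0 \<pi>"] by (simp add: swap_def)
  have "mat2 0 \<pi> \<pi> 0 ** matrix_inv (alpha D) ** swap \<in> double_coset"
    unfolding double_coset_def using k swap_KZ by blast
  moreover have "mat2 0 \<pi> \<pi> 0 ** matrix_inv (alpha D) ** swap = alpha D"
    unfolding inv_alpha unfolding alpha_def swap_def using unif by simp
  ultimately have 1: "alpha D \<in> double_coset" by simp
  show ?thesis
  proof (cases "y = alpha D")
    case False
    then obtain l where l: "l \<in> digits D 1" "y = g0 D 1 l" using assms by (auto simp: neighbours_def)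
    have "mat2 1 l 0 1 \<in> KZ D"
      by (rule KZ_I[of _ 0]) (use digits_integral[OF l(1)] in \<open>auto simp: val_one in_lattice_mat2\<close>)
    moreover have "y = mat2 l 1 1 0 ** alpha D ** swap"
      by (simp add: l g0_def alpha_def swap_def)
    moreover have "mat2 l 1 1 0 = mat2 1 l 0 1 ** (swap :: 'f ^ 2 ^ 2)" by (simp add: swap_def)
    ultimately show ?thesis
      using 1 KZ_mult[OF _ swap_KZ] double_coset_mult_left double_coset_mult_right[OF swap_KZ] by metis
  qed (use 1 in simp)
qed

text \<open>An invariant replaces explicit decompositions: to have determinant of valuation 2l + 1
  and all entries divisible by \<pi>^l is preserved by KZ on the right, and among the
  representatives of all cosets only the neighbours have this property.\<close>

lemma double_coset_cases:
  assumes "g \<in> double_coset"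
  obtains y where "y \<in> neighbours" "same_coset g y"
proof -
  define odd_lattice where "odd_lattice h \<longleftrightarrow> (\<exists>l. val_F D (det h) = 2 * l + 1 \<and> in_lattice l h)" for h
  have odd: "odd_lattice (h ** \<kappa>)" if h: "h \<in> GL2" "odd_lattice h" and \<kappa>: "\<kappa> \<in> KZ D" for h \<kappa>
  proof -
    obtain l where l: "val_F D (det h) = 2 * l + 1" "in_lattice l h" using h by (auto simp: odd_lattice_def)
    obtain m where m: "\<kappa> \<in> GL2" "val_F D (det \<kappa>) = 2 * m" "in_lattice m \<kappa>" using \<kappa> by (auto simp: KZ_iff)
    have "val_F D (det (h ** \<kappa>)) = 2 * (l + m) + 1" using h(1) m(1) l m by (simp add: det_mul val_mult GL2_iff)
    then show ?thesis using in_lattice_mult[OF l(2) m(3)] unfolding odd_lattice_def by blast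
  qed
  obtain \<kappa>1 \<kappa>2 where \<kappa>: "\<kappa>1 \<in> KZ D" "\<kappa>2 \<in> KZ D" "g = \<kappa>1 ** matrix_inv (alpha D) ** \<kappa>2"
    using assms by (auto simp: double_coset_def)
  obtain m where m: "\<kappa>1 \<in> GL2" "val_F D (det \<kappa>1) = 2 * m" "in_lattice m \<kappa>1" using \<kappa>(1) by (auto simp: KZ_iff)
  have "in_lattice (- 1) (matrix_inv (alpha D))"
    unfolding inv_alpha in_lattice_mat2 using unif F.ball_mono[OF F.ball_one, of "- 1"]
    by (auto simp: val_inverse intro: F.ballI)
  from in_lattice_mult[OF m(3) this] have "in_lattice (m - 1) (\<kappa>1 ** matrix_inv (alpha D))" by simp
  moreover have "val_F D (det (\<kappa>1 ** matrix_inv (alpha D))) = 2 * (m - 1) + 1"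
    using m unif by (simp add: det_mul inv_alpha val_mult val_inverse GL2_iff)
  ultimately have "odd_lattice (\<kappa>1 ** matrix_inv (alpha D))" unfolding odd_lattice_def by blast
  from odd[OF GL2_mult[OF m(1) GL2_inv[OF alpha_GL2]] this \<kappa>(2)] have og: "odd_lattice g" by (simp add: \<kappa>(3))
  have g: "g \<in> GL2" by (rule double_coset_GL2[OF assms])
  have oh: "odd_lattice h" if "same_coset g h" "h \<in> GL2" for h
  proof -
    obtain \<kappa> where \<kappa>: "\<kappa> \<in> KZ D" "g = h ** \<kappa>" using \<open>same_coset g h\<close> by (auto simp: same_coset_def)
    then have "h = g ** matrix_inv \<kappa>" using mult_inv_cancel(3)[OF KZ_GL2[OF \<kappa>(1)]] by simp
    then show ?thesis using odd[OF g og KZ_inv[OF \<kappa>(1)]] by simp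
  qed
  from g show ?thesis
  proof (cases rule: coset_cases)
    case (zero n \<mu>)
    obtain l where l: "val_F D (det (g0 D n \<mu>)) = 2 * l + 1" "in_lattice l (g0 D n \<mu>)"
      using oh[OF zero(2) g0_GL2] by (auto simp: odd_lattice_def)
    have "int n = 2 * l + 1" "l \<le> 0"
      using l by (auto simp: g0_def val_unif_power in_lattice_mat2 F.vball_def val_one)
    then have "n = 1" by presburger
    then show ?thesis using zero that[of "g0 D 1 \<mu>"] by (simp add: neighbours_def)
  next
    case (one n \<mu>)
    obtain l where l: "val_F D (det (g1 D n \<mu>)) = 2 * l + 1" "in_lattice l (g1 D n \<mu>)"
      using oh[OF one(2) g1_GL2] by (auto simp: odd_lattice_def)
    have "det (g1 D n \<mu>) = \<pi> ^ (n + 1)" by (simp add: g1_def)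
    then have "int (n + 1) = 2 * l + 1" using l(1) val_unif_power[of "n + 1"] by simp
    moreover have "l \<le> 0" using l(2) by (auto simp: g1_def in_lattice_mat2 F.vball_def val_one)
    ultimately have "n = 0" by simp
    then show ?thesis using one that[of "alpha D"] by (simp add: neighbours_def alpha_g1 digits_0)
  qed
qed

lemma neighbours_distinct:
  assumes "y \<in> neighbours" "y' \<in> neighbours" "matrix_inv y ** y' \<in> KZ D"
  shows "y = y'"
proof -
  have mixed: False if l: "l \<in> digits D 1" and k: "matrix_inv (g0 D 1 l) ** alpha D \<in> KZ D" for l
  proof -
    have "matrix_inv (g0 D 1 l) ** alpha D = matrix_inv (g0 D 1 l) ** swap ** g0 D 1 0 ** swap"
      unfolding alpha_g1 g1_eq by (simp add: matrix_mul_assoc)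
    then have "matrix_inv (g0 D 1 l) ** swap ** g0 D 1 0 \<in> KZ D"
      using k KZ_mult_right_iff[OF swap_KZ] by simp
    then show False using g0_swap_g0_KZ[of l 0 1 1] digits_integral[OF l] by simp
  qed
  have mixed': False if l: "l \<in> digits D 1" and k: "matrix_inv (alpha D) ** g0 D 1 l \<in> KZ D" for l
  proof -
    have "matrix_inv (matrix_inv (alpha D) ** g0 D 1 l) = matrix_inv (g0 D 1 l) ** alpha D"
      by (simp add: matrix_inv_matrix_mult matrix_inv_inv GL2_inv alpha_GL2 g0_GL2)
    then show False using KZ_inv[OF k] mixed[OF l] by simp
  qed
  show ?thesis
  proof (cases "y = alpha D"; cases "y' = alpha D")
    assume "y \<noteq> alpha D" "y' \<noteq> alpha D"
    then obtain l l' where l: "l \<in> digits D 1" "l' \<in> digits D 1" "y = g0 D 1 l" "y' = g0 D 1 l'"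
      using assms by (auto simp: neighbours_def)
    then have "l' - l \<in> F.vball 1" using g0_g0_KZ[of 1 l 1 l'] assms(3) by simp
    then show ?thesis using R.reps_distinct l by blast
  next
    assume y: "y \<noteq> alpha D" "y' = alpha D"
    then obtain l where "l \<in> digits D 1" "y = g0 D 1 l" using assms by (auto simp: neighbours_def)
    then show ?thesis using mixed assms(3) y(2) by blast
  next
    assume y: "y = alpha D" "y' \<noteq> alpha D"
    then obtain l where "l \<in> digits D 1" "y' = g0 D 1 l" using assms by (auto simp: neighbours_def)
    then show ?thesis using mixed' assms(3) y(1) by blast
  qed simp
qed

section \<open>Evaluation of the Hecke operator\<close>

definition coset :: "'f ^ 2 ^ 2 \<Rightarrow> ('f ^ 2 ^ 2) set" where
  "coset x = (\<lambda>\<kappa>. x ** \<kappa>) ` KZ D"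

lemma cosets_eq: "cosets D = coset ` GL2"
  by (simp add: cosets_def coset_def)

lemma in_coset_self: "x \<in> coset x"
  unfolding coset_def by (rule image_eqI[OF _ KZ_one]) simp

lemma coset_eqI:
  assumes "\<kappa> \<in> KZ D" "y = x ** \<kappa>"
  shows "coset y = coset x"
proof -
  have "x = y ** matrix_inv \<kappa>" using assms mult_inv_cancel(3)[OF KZ_GL2[OF assms(1)]] by simp
  then show ?thesis
    unfolding coset_def using assms KZ_mult KZ_inv
    by (auto simp: image_iff) (metis KZ_mult KZ_inv matrix_mul_assoc)+
qed

lemma coset_rep:
  assumes "x \<in> GL2"
  obtains \<kappa> where "\<kappa> \<in> KZ D" "coset_rep (coset x) = x ** \<kappa>"
proof -
  have "coset_rep (coset x) \<in> coset x"
    unfolding coset_rep_def by (rule someI[of "\<lambda>y. y \<in> coset x"]) (rule in_coset_self)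
  then show ?thesis using that by (auto simp: coset_def)
qed

lemma coset_eqD: "coset x = coset y \<Longrightarrow> \<exists>\<kappa>\<in>KZ D. x = y ** \<kappa>"
  using in_coset_self[of x] by (auto simp: coset_def)

lemma cosets_rep_GL2: "c \<in> cosets D \<Longrightarrow> coset_rep c \<in> GL2 \<and> coset (coset_rep c) = c"
proof -
  assume "c \<in> cosets D"
  then obtain x where x: "x \<in> GL2" "c = coset x" by (auto simp: cosets_eq)
  obtain \<kappa> where \<kappa>: "\<kappa> \<in> KZ D" "coset_rep c = x ** \<kappa>" using coset_rep[OF x(1)] x(2) by metis
  then show ?thesis using x coset_eqI[OF \<kappa>] GL2_mult[OF x(1) KZ_GL2[OF \<kappa>(1)]] by simp
qed

text \<open>At h only the coset of the inverse of h g contributes. The unknown element of KZ by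
  which \<open>coset_rep\<close> differs from this inverse cancels by equivariance of
  \<psi>.\<close>

lemma hecke_elem_eq:
  assumes g: "g \<in> GL2" and h: "h \<in> GL2" and P: "P \<in> Vk D k"
  shows "hecke_elem D k g P h = psi D k (h ** g) P"
proof -
  let ?t = "\<lambda>c. elem D k (g ** coset_rep c) (psi D k (matrix_inv (coset_rep c)) P) h"
  let ?z = "matrix_inv (h ** g)"
  have hg: "h ** g \<in> GL2" using g h by (rule GL2_mult[rotated])
  let ?cz = "coset ?z"
  have "?t c = 0" if c: "c \<in> cosets D - {?cz}" for c
  proof -
    let ?x = "coset_rep c"
    have x: "?x \<in> GL2" "coset ?x = c" using cosets_rep_GL2 c by auto
    have "h ** (g ** ?x) \<notin> KZ D"
    proof
      assume "h ** (g ** ?x) \<in> KZ D"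
      then have k: "h ** g ** ?x \<in> KZ D" by (simp add: matrix_mul_assoc)
      have "?x = ?z ** (h ** g ** ?x)" using mult_inv_cancel(2)[OF hg] by simp
      then have "coset ?x = ?cz" by (rule coset_eqI[OF k])
      then show False using x c by simp
    qed
    then show ?thesis by (simp add: elem_def)
  qed
  moreover have "?cz \<in> cosets D" using GL2_inv[OF hg] by (simp add: cosets_eq)
  ultimately have "hecke_elem D k g P h = ?t ?cz"
    unfolding hecke_elem_def by (subst fsum_eq[of "{?cz}"]) auto
  also obtain \<kappa> where \<kappa>: "\<kappa> \<in> KZ D" "coset_rep ?cz = ?z ** \<kappa>" using coset_rep[OF GL2_inv[OF hg]] by blast
  have hgx: "h ** (g ** (?z ** \<kappa>)) = \<kappa>" using mult_inv_cancel(1)[OF hg] by (simp add: matrix_mul_assoc)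
  have inv: "matrix_inv (?z ** \<kappa>) = matrix_inv \<kappa> ** (h ** g)"
    using matrix_inv_matrix_mult[OF GL2_inv[OF hg] KZ_GL2[OF \<kappa>(1)]] matrix_inv_inv[OF hg] by simp
  have "?t ?cz = rho D k \<kappa> (psi D k (matrix_inv \<kappa> ** (h ** g)) P)"
    unfolding elem_def \<kappa>(2) hgx inv using \<kappa>(1) by simp
  also have "\<dots> = psi D k (h ** g) P"
  proof (cases "h ** g \<in> double_coset")
    case True
    have "rho D k \<kappa> (rho D k (matrix_inv \<kappa> ** (h ** g)) P) = rho D k (h ** g) P"
      using rho_mult[OF KZ_GL2[OF \<kappa>(1)] GL2_mult[OF GL2_inv[OF KZ_GL2[OF \<kappa>(1)]] hg] P]
        mult_inv_cancel(1)[OF KZ_GL2[OF \<kappa>(1)]] by simp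
    then show ?thesis
      using True double_coset_mult_left[OF KZ_inv[OF \<kappa>(1)]] by (simp add: psi_eq[OF P] rho_Const_mult)
  next
    case False
    then show ?thesis
      using double_coset_mult_left[OF KZ_inv[OF \<kappa>(1)]] by (simp add: psi_eq[OF P])
  qed
  finally show ?thesis .
qed

lemma cindD:
  assumes "f \<in> cind D k W"
  shows "g \<notin> GL2 \<Longrightarrow> f g = 0" "g \<in> GL2 \<Longrightarrow> f g \<in> W"
    "\<kappa> \<in> KZ D \<Longrightarrow> g \<in> GL2 \<Longrightarrow> f (\<kappa> ** g) = rho D k \<kappa> (f g)"
  using assms by (auto simp: cind_def)

text \<open>As a function of g the summand is right invariant under KZ, so any representatives will
  do, and \<psi>(h g) can be nonzero only if h g lies in y KZ for a neighbour y.\<close>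

theorem hecke_eq:
  assumes f: "f \<in> cind D k (Vk D k)" and h: "h \<in> GL2"
  shows "hecke D k f h = Const (s ^ K) * (\<Sum>y\<in>neighbours. rho D k y (f (matrix_inv y ** h)))"
proof -
  define G where "G g = psi D k (h ** g) (f (matrix_inv g))" for g
  have fV: "f (matrix_inv g) \<in> Vk D k" if "g \<in> GL2" for g
    using cindD(2)[OF f GL2_inv[OF that]] .
  have G_inv: "G (g ** \<kappa>) = G g" if g: "g \<in> GL2" and \<kappa>: "\<kappa> \<in> KZ D" for g \<kappa>
  proof -
    note kg = KZ_GL2[OF \<kappa>]
    have "f (matrix_inv (g ** \<kappa>)) = rho D k (matrix_inv \<kappa>) (f (matrix_inv g))"
      using cindD(3)[OF f KZ_inv[OF \<kappa>] GL2_inv[OF g]] matrix_inv_matrix_mult[OF g kg] by simp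
    moreover have "rho D k (h ** g ** \<kappa>) (rho D k (matrix_inv \<kappa>) (f (matrix_inv g))) = rho D k (h ** g) (f (matrix_inv g))"
      using rho_mult[OF GL2_mult[OF GL2_mult[OF h g] kg] GL2_inv[OF kg] fV[OF g]] mult_inv_cancel(3)[OF kg] by simp
    ultimately show ?thesis
      using double_coset_mult_right[OF \<kappa>, of "h ** g"]
      by (simp add: G_def matrix_mul_assoc psi_eq fV[OF g] rho_Vk)
  qed
  have hecke_G: "hecke_elem D k (coset_rep c) (f (matrix_inv (coset_rep c))) h = G (coset_rep c)" if "c \<in> cosets D" for c
    using hecke_elem_eq[OF _ h fV] cosets_rep_GL2[OF that] by (simp add: G_def)
  define cy where "cy y = coset (matrix_inv h ** y)" for y
  have hy: "matrix_inv h ** y \<in> GL2" if "y \<in> neighbours" for y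
    using GL2_mult[OF GL2_inv[OF h] neighbours_GL2[OF that]] .
  have inj: "inj_on cy neighbours"
  proof (rule inj_onI)
    fix y y' assume y: "y \<in> neighbours" "y' \<in> neighbours" "cy y = cy y'"
    obtain \<kappa> where \<kappa>: "\<kappa> \<in> KZ D" "matrix_inv h ** y' = matrix_inv h ** y ** \<kappa>"
      using coset_eqD[of "matrix_inv h ** y'" "matrix_inv h ** y"] y(3) by (auto simp: cy_def)
    then have "h ** (matrix_inv h ** y') = h ** (matrix_inv h ** (y ** \<kappa>))" by (simp add: matrix_mul_assoc)
    then have "y' = y ** \<kappa>" by (simp only: mult_inv_cancel(1)[OF h])
    then have "matrix_inv y ** y' = \<kappa>" using mult_inv_cancel(2)[OF neighbours_GL2[OF y(1)]] by simp
    then show "y = y'" using neighbours_distinct y \<kappa>(1) by blast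
  qed
  have sub: "cy ` neighbours \<subseteq> cosets D" using hy by (auto simp: cy_def cosets_eq)
  have zero: "G (coset_rep c) = 0" if c: "c \<in> cosets D - cy ` neighbours" for c
  proof -
    have x: "coset_rep c \<in> GL2" "coset (coset_rep c) = c" using cosets_rep_GL2 c by auto
    have "h ** coset_rep c \<notin> double_coset"
    proof
      assume "h ** coset_rep c \<in> double_coset"
      then obtain y where y: "y \<in> neighbours" "same_coset (h ** coset_rep c) y" by (rule double_coset_cases)
      obtain \<kappa> where \<kappa>: "\<kappa> \<in> KZ D" "h ** coset_rep c = y ** \<kappa>" using y(2) by (auto simp: same_coset_def)
      then have "coset_rep c = matrix_inv h ** y ** \<kappa>"
        using mult_inv_cancel(2)[OF h, of "coset_rep c"] by (simp add: matrix_mul_assoc)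
      from coset_eqI[OF \<kappa>(1) this] show False using x(2) c y(1) by (auto simp: cy_def)
    qed
    then show ?thesis by (simp add: G_def psi_eq fV[OF x(1)])
  qed
  have "hecke D k f h = (\<Sum>c\<in>cy ` neighbours. hecke_elem D k (coset_rep c) (f (matrix_inv (coset_rep c))) h)"
    unfolding hecke_def
    by (rule fsum_eq) (use sub zero hecke_G finite_neighbours in auto)
  also have "\<dots> = (\<Sum>c\<in>cy ` neighbours. G (coset_rep c))"
    by (rule sum.cong) (use sub hecke_G in auto)
  also have "\<dots> = (\<Sum>y\<in>neighbours. G (coset_rep (cy y)))" by (rule sum.reindex[OF inj, unfolded comp_def])
  also have "\<dots> = (\<Sum>y\<in>neighbours. Const (s ^ K) * rho D k y (f (matrix_inv y ** h)))"
  proof (rule sum.cong[OF refl])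
    fix y assume y: "y \<in> neighbours"
    obtain \<kappa> where \<kappa>: "\<kappa> \<in> KZ D" "coset_rep (cy y) = matrix_inv h ** y ** \<kappa>"
      using coset_rep[OF hy[OF y]] unfolding cy_def by blast
    have "G (coset_rep (cy y)) = G (matrix_inv h ** y)" unfolding \<kappa>(2) by (rule G_inv[OF hy[OF y] \<kappa>(1)])
    also have "\<dots> = psi D k y (f (matrix_inv y ** h))"
      using mult_inv_cancel(1)[OF h] matrix_inv_matrix_mult[OF GL2_inv[OF h] neighbours_GL2[OF y]] matrix_inv_inv[OF h]
      by (simp add: G_def)
    also have "\<dots> = Const (s ^ K) * rho D k y (f (matrix_inv y ** h))"
      using psi_eq[OF cindD(2)[OF f GL2_mult[OF GL2_inv[OF neighbours_GL2[OF y]] h]]] neighbours_double_coset[OF y] by simp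
    finally show "G (coset_rep (cy y)) = Const (s ^ K) * rho D k y (f (matrix_inv y ** h))" .
  qed
  finally show ?thesis by (simp add: sum_distrib_left)
qed

end

section \<open>Descending along the tree\<close>

lemma pcompose_eq_sum:
  fixes p :: "'a::field poly"
  assumes "degree p \<le> n"
  shows "pcompose p r = (\<Sum>j\<le>n. smult (coeff p j) (r ^ j))"
proof -
  have "pcompose (monom c j) r = smult c (r ^ j)" for c :: 'a and j
    by (simp add: monom_altdef pcompose_smult pcompose_hom.hom_power pcompose_pCons)
  then show ?thesis
    by (subst sum_monoms[OF assms]) (simp add: pcompose_sum)
qed

context single_weight
begin

definition dehom :: "('f \<Rightarrow> 'c, 'c) mpoly \<Rightarrow> 'c poly" where
  "dehom P = (SOME p. P = homog \<sigma> K p \<and> degree p \<le> K)"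

lemma dehom:
  assumes "P \<in> Vk D k"
  shows "homog \<sigma> K (dehom P) = P" "degree (dehom P) \<le> K"
proof -
  have "P = homog \<sigma> K (dehom P) \<and> degree (dehom P) \<le> K"
    unfolding dehom_def by (rule someI_ex) (use assms in \<open>auto elim!: Vk_E\<close>)
  then show "homog \<sigma> K (dehom P) = P" "degree (dehom P) \<le> K" by auto
qed

lemma dehom_homog: "degree p \<le> K \<Longrightarrow> dehom (homog \<sigma> K p) = p"
  using hom_inject[OF dehom(1)[OF hom_Vk] dehom(2)[OF hom_Vk]] by blast

lemma hom_Vk0: "degree p \<le> K \<Longrightarrow> p \<in> C.pball 0 \<Longrightarrow> homog \<sigma> K p \<in> Vk0 D k"
  unfolding Vk0_eq by blast

lemma dehom_Vk0: "P \<in> Vk0 D k \<Longrightarrow> dehom P \<in> C.pball 0"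
  unfolding Vk0_eq using dehom_homog by auto

text \<open>The factor s^K in \<psi> cancels the twist of every neighbour, so no square root of
  \<pi> survives in the recursion.\<close>

lemma twist_unif: "val_F D (det g) = 1 \<Longrightarrow> s ^ K * twist g = 1"
  using s_nonzero by (simp add: twist_def power_int_minus)

lemma act_alpha:
  assumes "degree p \<le> K"
  shows "smult (s ^ K) (act (alpha D) p) = pcompose p [:0, \<sigma> \<pi>:]"
proof -
  have "s ^ K * twist (alpha D) = 1" by (rule twist_unif) (simp add: alpha_def unif)
  then show ?thesis
    unfolding act_def pcompose_eq_sum[OF assms] by (simp add: alpha_def poly_const_pow)
qed

lemma act_g0:
  assumes "degree p \<le> K"
  shows "smult (s ^ K) (act (g0 D 1 l) p) = (\<Sum>j\<le>K. smult (coeff p j * \<sigma> \<pi> ^ (K - j)) ([:\<sigma> l, 1:] ^ j))"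
proof -
  have "s ^ K * twist (g0 D 1 l) = 1" by (rule twist_unif) (simp add: g0_def unif)
  then show ?thesis
    unfolding act_def by (simp add: g0_def poly_const_pow)
qed

lemma act_unipotent:
  assumes "degree p \<le> K"
  shows "act (mat2 1 (- \<kappa>) 0 1) p = pcompose p [:- \<sigma> \<kappa>, 1:]"
  unfolding act_def pcompose_eq_sum[OF assms]
  by (simp add: twist_def val_one \<sigma>.hom_uminus poly_const_pow)

text \<open>Different levels m lie in different cosets of KZ, of which the support meets finitely
  many. In the applications w is 1 or \<open>swap\<close> and selects a half of the tree.\<close>

lemma vanish_far:
  assumes f: "f \<in> cind D k W" and w: "w \<in> GL2"
  obtains M where "\<And>m \<mu>. M \<le> m \<Longrightarrow> f (matrix_inv (g0 D m \<mu>) ** w) = 0"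
proof -
  define S where "S = {m. \<exists>\<mu>. f (matrix_inv (g0 D m \<mu>) ** w) \<noteq> 0}"
  have "\<forall>m\<in>S. \<exists>\<mu>. f (matrix_inv (g0 D m \<mu>) ** w) \<noteq> 0" by (simp add: S_def)
  from bchoice[OF this] obtain \<mu> where \<mu>: "\<forall>m\<in>S. f (matrix_inv (g0 D m (\<mu> m)) ** w) \<noteq> 0" ..
  define h where "h m = matrix_inv (g0 D m (\<mu> m)) ** w" for m
  have h: "h m \<in> GL2" for m unfolding h_def by (intro GL2_mult GL2_inv g0_GL2 w)
  let ?c = "\<lambda>g. (\<lambda>\<kappa>. \<kappa> ** g) ` KZ D"
  have 1: "inj_on (\<lambda>m. ?c (h m)) S"
  proof (rule inj_onI)
    fix m n assume "?c (h m) = ?c (h n)"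
    moreover have "h m \<in> ?c (h m)" by (rule image_eqI[OF _ KZ_one]) simp
    ultimately obtain \<kappa> where \<kappa>: "\<kappa> \<in> KZ D" "h m = \<kappa> ** h n" by auto
    then have "matrix_inv (g0 D m (\<mu> m)) ** w ** matrix_inv w ** g0 D n (\<mu> n)
        = \<kappa> ** (matrix_inv (g0 D n (\<mu> n)) ** w ** matrix_inv w ** g0 D n (\<mu> n))"
      by (simp add: h_def matrix_mul_assoc)
    then have "matrix_inv (g0 D m (\<mu> m)) ** g0 D n (\<mu> n) = \<kappa>"
      by (simp only: mult_inv_cancel(3)[OF w] matrix_inv_mult(2)[OF g0_GL2] matrix_mul_rid)
    then show "m = n" using g0_g0_KZ \<kappa>(1) by blast
  qed
  have 2: "(\<lambda>m. ?c (h m)) ` S \<subseteq> ?c ` {g \<in> GL2. f g \<noteq> 0}"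
    using \<mu> h by (auto simp: h_def)
  have 3: "finite (?c ` {g \<in> GL2. f g \<noteq> 0})" using f by (simp add: cind_def)
  have "finite S" by (rule finite_imageD[OF finite_subset[OF 2 3] 1])
  then obtain M where "\<forall>m\<in>S. m < M" unfolding finite_nat_set_iff_bounded ..
  then have "f (matrix_inv (g0 D m \<mu>) ** w) = 0" if "M \<le> m" for m \<mu>
  proof -
    have "m \<notin> S" using \<open>\<forall>m\<in>S. m < M\<close> that by auto
    then show ?thesis unfolding S_def by blast
  qed
  then show ?thesis using that by blast
qed

text \<open>The neighbour \<alpha> leads to the parent, up to the scalar 1 / \<pi> that acts
  trivially, and the neighbour with digit l leads to the child whose address has l at place m + 1.
  The parent keeps the unreduced address \<mu>.\<close>

lemma hecke_at_vertex:
  assumes f: "f \<in> cind D k (Vk D k)" and w: "w \<in> GL2"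
  shows "hecke D k f (matrix_inv (g0 D (Suc m) \<mu>) ** w) =
    homog \<sigma> K (pcompose (dehom (f (matrix_inv (g0 D m \<mu>) ** w))) [:0, \<sigma> \<pi>:]
      + (\<Sum>l\<in>digits D 1. \<Sum>j\<le>K. smult (coeff (dehom (f (matrix_inv (g0 D (Suc (Suc m)) (\<mu> + \<pi> ^ Suc m * l)) ** w))) j
           * \<sigma> \<pi> ^ (K - j)) ([:\<sigma> l, 1:] ^ j)))"
proof -
  let ?h = "matrix_inv (g0 D (Suc m) \<mu>) ** w"
  have h: "?h \<in> GL2" by (intro GL2_mult GL2_inv g0_GL2 w)
  have fV: "f (matrix_inv (g0 D m \<mu>) ** w) \<in> Vk D k" for m \<mu>
    by (intro cindD(2)[OF f] GL2_mult GL2_inv g0_GL2 w)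
  have rho_c: "Const (s ^ K) * rho D k y (f (matrix_inv (g0 D m \<mu>) ** w))
      = homog \<sigma> K (smult (s ^ K) (act y (dehom (f (matrix_inv (g0 D m \<mu>) ** w)))))" for y m \<mu>
    using rho_hom[of y "dehom (f (matrix_inv (g0 D m \<mu>) ** w))"] by (simp add: dehom(1)[OF fV] form_smult)
  have 1: "matrix_inv (g0 D 1 l) ** ?h = matrix_inv (g0 D (Suc (Suc m)) (\<mu> + \<pi> ^ Suc m * l)) ** w" for l
  proof -
    have "g0 D (Suc m) \<mu> ** g0 D 1 l = g0 D (Suc (Suc m)) (\<mu> + \<pi> ^ Suc m * l)"
      by (simp add: g0_def algebra_simps)
    then show ?thesis
      using matrix_inv_matrix_mult[OF g0_GL2 g0_GL2, of "Suc m" \<mu> 1 l] by (simp add: matrix_mul_assoc)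
  qed
  have 2: "f (matrix_inv (alpha D) ** ?h) = f (matrix_inv (g0 D m \<mu>) ** w)"
  proof -
    let ?z = "mat (inverse \<pi>) :: 'f ^ 2 ^ 2"
    have zKZ: "?z \<in> KZ D"
      by (rule KZ_I[of _ "- 1"]) (use unif in \<open>auto simp: mat_eq_mat2 val_mult val_inverse in_lattice_mat2 intro: F.ballI\<close>)
    have "matrix_inv (alpha D) ** matrix_inv (g0 D (Suc m) \<mu>) = ?z ** matrix_inv (g0 D m \<mu>)"
      unfolding inv_alpha inv_g0 using unif by (simp add: mat_eq_mat2 field_simps)
    then have "matrix_inv (alpha D) ** ?h = ?z ** (matrix_inv (g0 D m \<mu>) ** w)"
      by (simp add: matrix_mul_assoc)
    moreover have "rho D k ?z P = P" if "P \<in> Vk D k" for P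
    proof -
      have i: "\<sigma> (inverse \<pi>) * \<sigma> \<pi> = 1" using unif by (simp flip: \<sigma>.hom_mult)
      have "s powi (- 2 * val_F D (inverse \<pi>)) = \<sigma> \<pi>"
        using unif s_square by (simp add: val_inverse power2_eq_square)
      then show ?thesis using rho_scalar[of "inverse \<pi>" P] unif that i by simp
    qed
    ultimately show ?thesis
      using cindD(3)[OF f zKZ, of "matrix_inv (g0 D m \<mu>) ** w"] fV GL2_mult[OF GL2_inv[OF g0_GL2] w] by simp
  qed
  have inj: "inj_on (g0 D 1) (digits D 1)" by (rule inj_onI) (simp add: g0_def)
  have "alpha D \<notin> g0 D 1 ` digits D 1" using unif val_one by (auto simp: alpha_def g0_def)
  then have nb: "(\<Sum>y\<in>neighbours. H y) = H (alpha D) + (\<Sum>l\<in>digits D 1. H (g0 D 1 l))"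
    for H :: "'f ^ 2 ^ 2 \<Rightarrow> ('f \<Rightarrow> 'c, 'c) mpoly"
    unfolding neighbours_def using finite_digits sum.reindex[OF inj, of H] by (simp add: comp_def)
  have "hecke D k f ?h = Const (s ^ K) * rho D k (alpha D) (f (matrix_inv (alpha D) ** ?h))
      + (\<Sum>l\<in>digits D 1. Const (s ^ K) * rho D k (g0 D 1 l) (f (matrix_inv (g0 D 1 l) ** ?h)))"
    unfolding hecke_eq[OF f h] nb by (simp only: sum_distrib_left distrib_left)
  also have "\<dots> = homog \<sigma> K (pcompose (dehom (f (matrix_inv (g0 D m \<mu>) ** w))) [:0, \<sigma> \<pi>:])
      + (\<Sum>l\<in>digits D 1. homog \<sigma> K (\<Sum>j\<le>K. smult (coeff (dehom (f (matrix_inv (g0 D (Suc (Suc m)) (\<mu> + \<pi> ^ Suc m * l)) ** w))) j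
           * \<sigma> \<pi> ^ (K - j)) ([:\<sigma> l, 1:] ^ j)))"
    unfolding 1 2 rho_c by (simp only: act_alpha[OF dehom(2)[OF fV]] act_g0[OF dehom(2)[OF fV]])
  finally show ?thesis by (simp only: form_add form_sum)
qed

text \<open>Addresses are not reduced modulo \<pi>^m, and renaming a vertex translates its
  polynomial. Taking the new digit for \<kappa>, this changes p(\<pi> z) for the parent in
  \<open>hecke_at_vertex\<close> into p(\<pi> z - l), which is \<open>down l\<close>.\<close>

lemma dehom_shift:
  assumes f: "f \<in> cind D k (Vk D k)" and w: "w \<in> GL2" and \<kappa>: "\<kappa> \<in> F.vball 0"
  shows "dehom (f (matrix_inv (g0 D m (\<mu> + \<pi> ^ m * \<kappa>)) ** w))
    = pcompose (dehom (f (matrix_inv (g0 D m \<mu>) ** w))) [:- \<sigma> \<kappa>, 1:]"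
proof -
  let ?g = "matrix_inv (g0 D m \<mu>) ** w" and ?u = "mat2 1 (- \<kappa>) 0 1"
  have g: "?g \<in> GL2" by (intro GL2_mult GL2_inv g0_GL2 w)
  have fV: "f ?g \<in> Vk D k" by (rule cindD(2)[OF f g])
  have u: "?u \<in> KZ D" by (rule KZ_I[of _ 0]) (use \<kappa> in \<open>auto simp: val_one in_lattice_mat2\<close>)
  have "matrix_inv (g0 D m (\<mu> + \<pi> ^ m * \<kappa>)) = ?u ** matrix_inv (g0 D m \<mu>)"
    unfolding inv_g0 using unif by (simp add: field_simps)
  then have "matrix_inv (g0 D m (\<mu> + \<pi> ^ m * \<kappa>)) ** w = ?u ** ?g" by (simp add: matrix_mul_assoc)
  then have "f (matrix_inv (g0 D m (\<mu> + \<pi> ^ m * \<kappa>)) ** w) = rho D k ?u (f ?g)"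
    using cindD(3)[OF f u g] by simp
  also have "\<dots> = homog \<sigma> K (act ?u (dehom (f ?g)))" using rho_hom[of ?u "dehom (f ?g)"] dehom(1)[OF fV] by simp
  finally have eq: "f (matrix_inv (g0 D m (\<mu> + \<pi> ^ m * \<kappa>)) ** w) = homog \<sigma> K (act ?u (dehom (f ?g)))" .
  show ?thesis unfolding eq dehom_homog[OF degree_act] by (rule act_unipotent[OF dehom(2)[OF fV]])
qed

lemma val_C_powi: "\<tau> \<in> Emb D \<Longrightarrow> \<tau> \<pi> powi m \<noteq> 0 \<and> val_C D (\<tau> \<pi> powi m) = real_of_int m"
proof -
  assume \<tau>: "\<tau> \<in> Emb D"
  have nz: "\<tau> \<pi> \<noteq> 0" and v: "val_C D (\<tau> \<pi>) = 1"
    using unif val_C_Emb[OF \<tau>] Emb_eq_0_iff[OF \<tau>] by auto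
  then show ?thesis
    using C.v_power[OF nz] C.v_power[of "inverse (\<tau> \<pi>)"] C.v_inverse[OF nz] by (auto simp: power_int_def)
qed

text \<open>Division by the image c of \<varpi>^n turns congruences modulo \<varpi>^n into
  congruences modulo integral polynomials. The tree bound therefore does not see n, and its exponent
  d + 1 is the loss.\<close>

lemma descend:
  assumes f: "f \<in> cind D k (Vk D k)" and w: "w \<in> GL2" and \<tau>: "\<tau> \<in> Emb D"
    and d: "1 \<le> d" "2 * d < q" "K = d * q"
    and a: "a \<noteq> 0" "0 < val_C D a" "val_C D a \<le> 1"
    and eqn: "\<And>m \<mu>. N < m \<Longrightarrow> \<mu> - \<mu>0 \<in> F.vball (real N) \<Longrightarrow>
      \<exists>r\<in>Vk0 D k. hecke D k f (matrix_inv (g0 D m \<mu>) ** w) - Const a * f (matrix_inv (g0 D m \<mu>) ** w)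
        = Const (\<tau> \<pi> powi int n) * r"
  shows "\<exists>r\<in>Vk0 D k. f (matrix_inv (g0 D N \<mu>0) ** w) = Const (\<tau> \<pi> powi (int n - int (d + 1))) * r"
proof -
  define c where "c = \<tau> \<pi> powi int n"
  have c: "c \<noteq> 0" "val_C D c = real n" using val_C_powi[OF \<tau>, of "int n"] by (auto simp: c_def)
  define p where "p m \<mu> = dehom (f (matrix_inv (g0 D m \<mu>) ** w))" for m \<mu>
  have fV: "f (matrix_inv (g0 D m \<mu>) ** w) \<in> Vk D k" for m \<mu>
    by (intro cindD(2)[OF f] GL2_mult GL2_inv g0_GL2 w)
  have f_p: "f (matrix_inv (g0 D m \<mu>) ** w) = homog \<sigma> K (p m \<mu>)" and dp: "degree (p m \<mu>) \<le> K" for m \<mu>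
    using dehom[OF fV] by (auto simp: p_def)
  define \<Lambda> where "\<Lambda> = \<sigma> ` digits D 1"
  define dig where "dig l = inv_into (digits D 1) \<sigma> l" for l
  have dig: "dig l \<in> digits D 1" "\<sigma> (dig l) = l" if "l \<in> \<Lambda>" for l
    using that inv_into_into[of l \<sigma> "digits D 1"] f_inv_into_f[of l \<sigma> "digits D 1"] by (auto simp: \<Lambda>_def dig_def)
  have inj: "inj_on \<sigma> (digits D 1)"
  proof (rule inj_onI)
    fix x y assume "\<sigma> x = \<sigma> y"
    then have "\<sigma> (x - y) = 0" by (simp add: \<sigma>.hom_minus)
    then show "x = y" by (simp add: Emb_eq_0_iff[OF \<sigma>_Emb])
  qed
  \<comment> \<open>The letter added last occupies the digit place N plus the length of the
    remaining word. Letters live in C, so \<open>dig\<close> takes them back to F.\<close>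
  define addr where "addr = rec_list \<mu>0 (\<lambda>l xs \<mu>. \<mu> + \<pi> ^ (N + length xs) * dig l)"
  have addr_Nil: "addr [] = \<mu>0" and addr_Cons: "addr (l # xs) = addr xs + \<pi> ^ (N + length xs) * dig l" for l xs
    by (auto simp: addr_def)
  have addr_ball: "addr xs - \<mu>0 \<in> F.vball (real N)" if "xs \<in> lists \<Lambda>" for xs
    using that
  proof (induction xs)
    case (Cons l xs)
    have "\<pi> ^ (N + length xs) * dig l \<in> F.vball (real N)"
      unfolding unif_power_ball_iff
      by (rule F.ball_mono[OF digits_integral[OF dig(1)]]) (use Cons in auto)
    from F.ball_add[OF Cons.IH this] Cons.prems show ?case by (simp add: addr_Cons algebra_simps)
  qed (simp add: addr_Nil)
  define W where "W xs = smult (inverse c) (p (N + length xs) (addr xs))" for xs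
  define up where "up l r = (\<Sum>j\<le>d * card \<Lambda>. smult (coeff r j * \<sigma> \<pi> ^ (d * card \<Lambda> - j)) ([:l, 1:] ^ j))" for l r
  have card: "card \<Lambda> = q" unfolding \<Lambda>_def by (rule residue_system_C(2)[OF \<sigma>_Emb])
  have up_smult: "up l (smult x r) = smult x (up l r)" for l x r
    by (simp add: up_def smult_sum2 mult.assoc)
  have degree_up: "degree (up l r) \<le> K" for l r
  proof -
    have dl: "degree ([:l, 1:] ^ j) \<le> j * 1" for j by (rule degree_power_le') simp
    show ?thesis
      unfolding up_def card d(3)[symmetric]
    proof (rule degree_sum_le)
      fix j assume j: "j \<in> {..K}"
      show "degree (smult (coeff r j * \<sigma> \<pi> ^ (K - j)) ([:l, 1:] ^ j)) \<le> K"
        by (rule order.trans[OF degree_smult_le], rule order.trans[OF dl]) (use j in simp)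
    qed simp
  qed
  obtain M where M: "\<And>m \<mu>. M \<le> m \<Longrightarrow> f (matrix_inv (g0 D m \<mu>) ** w) = 0" using vanish_far[OF f w] by blast
  interpret RC: residue_system "val_C D" "\<sigma> \<pi>" "\<sigma> ` F.vball 0" \<Lambda>
    unfolding \<Lambda>_def by (rule residue_system_C(1)[OF \<sigma>_Emb])
  interpret T: hecke_tree "val_C D" "\<sigma> \<pi>" "\<sigma> ` F.vball 0" \<Lambda> d a W up M
  proof unfold_locales
    show "1 \<le> d" "a \<noteq> 0" "0 < val_C D a" "val_C D a \<le> 1" by (fact d a)+
    show "2 * d < card \<Lambda>" using d card by simp
    show "up l p = (\<Sum>j\<le>d * card \<Lambda>. smult (coeff p j * \<sigma> \<pi> ^ (d * card \<Lambda> - j)) ([:l, 1:] ^ j))" for l p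
      by (simp add: up_def)
    show "degree (W xs) \<le> d * card \<Lambda>" for xs
      unfolding W_def card d(3)[symmetric] by (rule order.trans[OF degree_smult_le dp])
    show "W xs = 0" if "xs \<in> lists \<Lambda>" "M \<le> length xs" for xs
    proof -
      have "homog \<sigma> K (p (N + length xs) (addr xs)) = homog \<sigma> K 0"
        using M[of "N + length xs" "addr xs"] that f_p by simp
      from hom_inject[OF this dp] show ?thesis by (simp add: W_def)
    qed
    fix xs l assume xs: "xs \<in> lists \<Lambda>" and l: "l \<in> \<Lambda>"
    let ?m = "N + length xs" and ?\<mu> = "addr (l # xs)"
    let ?Q = "RC.down l (p ?m (addr xs)) - smult a (p (Suc ?m) ?\<mu>)
      + (\<Sum>l'\<in>\<Lambda>. up l' (p (Suc (Suc ?m)) (addr (l' # l # xs))))"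
    have "?\<mu> - \<mu>0 \<in> F.vball (real N)" by (rule addr_ball) (use xs l in auto)
    then obtain r where r: "r \<in> Vk0 D k"
      "hecke D k f (matrix_inv (g0 D (Suc ?m) ?\<mu>) ** w) - Const a * f (matrix_inv (g0 D (Suc ?m) ?\<mu>) ** w) = Const c * r"
      using eqn[of "Suc ?m" ?\<mu>] by (auto simp: c_def)
    have rV: "r \<in> Vk D k" using r(1) Vk0_sub_Vk by blast
    have par: "pcompose (p ?m ?\<mu>) [:0, \<sigma> \<pi>:] = RC.down l (p ?m (addr xs))"
    proof -
      have e: "p ?m ?\<mu> = pcompose (p ?m (addr xs)) [:- l, 1:]"
        unfolding p_def addr_Cons using dehom_shift[OF f w digits_integral[OF dig(1)[OF l]]] dig(2)[OF l] by simp
      show ?thesis unfolding e RC.down_def by (rule C.pcompose_shift_scale[symmetric])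
    qed
    have chi: "(\<Sum>l\<in>digits D 1. \<Sum>j\<le>K. smult (coeff (p (Suc (Suc ?m)) (?\<mu> + \<pi> ^ Suc ?m * l)) j * \<sigma> \<pi> ^ (K - j)) ([:\<sigma> l, 1:] ^ j))
        = (\<Sum>l'\<in>\<Lambda>. up l' (p (Suc (Suc ?m)) (addr (l' # l # xs))))"
    proof -
      have "(\<Sum>l'\<in>\<Lambda>. up l' (p (Suc (Suc ?m)) (addr (l' # l # xs))))
          = (\<Sum>x\<in>digits D 1. up (\<sigma> x) (p (Suc (Suc ?m)) (addr (\<sigma> x # l # xs))))"
        unfolding \<Lambda>_def by (rule sum.reindex[OF inj, unfolded comp_def])
      moreover have "addr (\<sigma> x # l # xs) = ?\<mu> + \<pi> ^ Suc ?m * x" if "x \<in> digits D 1" for x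
        using inv_into_f_f[OF inj that] by (simp only: addr_Cons[of "\<sigma> x"] dig_def) simp
      ultimately show ?thesis
        unfolding up_def card d(3)[symmetric] by simp
    qed
    have "hecke D k f (matrix_inv (g0 D (Suc ?m) ?\<mu>) ** w) =
        homog \<sigma> K (RC.down l (p ?m (addr xs)) + (\<Sum>l'\<in>\<Lambda>. up l' (p (Suc (Suc ?m)) (addr (l' # l # xs)))))"
      unfolding hecke_at_vertex[OF f w] p_def[symmetric] par chi ..
    then have "homog \<sigma> K ?Q = homog \<sigma> K (smult c (dehom r))"
      using r(2) dehom(1)[OF rV] by (simp add: f_p form_add form_diff form_smult diff_add_eq)
    moreover have "degree ?Q \<le> K"
    proof -
      have "degree (RC.down l (p ?m (addr xs))) \<le> K"
        unfolding par[symmetric] act_alpha[OF dp, symmetric] by (rule order.trans[OF degree_smult_le degree_act])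
      moreover have "degree (smult a (p (Suc ?m) ?\<mu>)) \<le> K" by (rule order.trans[OF degree_smult_le dp])
      moreover have "degree (\<Sum>l'\<in>\<Lambda>. up l' (p (Suc (Suc ?m)) (addr (l' # l # xs)))) \<le> K"
        by (rule degree_sum_le[OF RC.reps_finite degree_up])
      ultimately show ?thesis by (intro degree_add_le degree_diff_le)
    qed
    moreover have "degree (smult c (dehom r)) \<le> K" by (rule order.trans[OF degree_smult_le dehom(2)[OF rV]])
    ultimately have Q: "?Q = smult c (dehom r)" by (rule hom_inject)
    have "RC.down l (W xs) - smult a (W (l # xs)) + (\<Sum>l'\<in>\<Lambda>. up l' (W (l' # l # xs))) = smult (inverse c) ?Q"
      by (simp add: W_def RC.down_smult up_smult smult_diff_right smult_add_right smult_sum2 mult.commute)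
    also have "\<dots> = dehom r" unfolding Q using c by simp
    finally show "RC.down l (W xs) - smult a (W (l # xs)) + (\<Sum>l'\<in>\<Lambda>. up l' (W (l' # l # xs))) \<in> C.pball 0"
      using dehom_Vk0[OF r(1)] by simp
  qed
  have "smult (inverse c) (p N \<mu>0) \<in> C.pball (- real d - 1)"
    using T.bound[of "[]"] by (simp add: W_def addr_Nil)
  define e where "e = \<tau> \<pi> powi (int n - int (d + 1))"
  have e: "e \<noteq> 0" "val_C D e = real n - real d - 1" using val_C_powi[OF \<tau>, of "int n - int (d + 1)"] by (simp_all add: e_def)
  have "inverse e * c \<in> C.vball (real d + 1)"
    using c e by (intro C.ballI) (simp add: C.v_mult C.v_inverse)
  from C.pball_smult[OF this \<open>smult (inverse c) (p N \<mu>0) \<in> _\<close>, of 0]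
  have "smult (inverse e) (p N \<mu>0) \<in> C.pball 0" using c by (simp add: mult.assoc)
  then have "homog \<sigma> K (smult (inverse e) (p N \<mu>0)) \<in> Vk0 D k"
    by (rule hom_Vk0[OF order.trans[OF degree_smult_le dp]])
  moreover have "f (matrix_inv (g0 D N \<mu>0) ** w) = Const e * homog \<sigma> K (smult (inverse e) (p N \<mu>0))"
    unfolding f_p form_smult[symmetric] using e by simp
  ultimately show ?thesis unfolding e_def by blast
qed

end

section \<open>Expansions and the theorem\<close>

context single_weight
begin

section \<open>The vertex of a group element\<close>

lemma KZ_quotient:
  assumes "g \<in> GL2" "y \<in> GL2" "g ** y \<in> KZ D" "g ** y' \<in> KZ D"
  shows "matrix_inv y ** y' \<in> KZ D"
proof -
  have "matrix_inv (g ** y) ** (g ** y') = matrix_inv y ** (matrix_inv g ** (g ** y'))"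
    by (simp add: matrix_inv_matrix_mult[OF assms(1,2)] matrix_mul_assoc)
  then have "matrix_inv (g ** y) ** (g ** y') = matrix_inv y ** y'"
    by (simp only: mult_inv_cancel(2)[OF assms(1)])
  then show ?thesis using KZ_mult[OF KZ_inv[OF assms(3)] assms(4)] by simp
qed

lemma not_KZ_outside: "g \<notin> GL2 \<Longrightarrow> g ** y \<notin> KZ D"
  by (auto simp: KZ_iff GL2_iff det_mul)

lemma g0_unique:
  assumes "g \<in> GL2" "g ** g0 D n \<mu> \<in> KZ D" "g ** g0 D m \<nu> \<in> KZ D"
  shows "n = m" "\<mu> \<in> digits D n \<Longrightarrow> \<nu> \<in> digits D m \<Longrightarrow> \<mu> = \<nu>"
proof -
  have *: "n = m \<and> \<nu> - \<mu> \<in> F.vball (real n)"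
    by (rule g0_g0_KZ[OF KZ_quotient[OF assms(1) g0_GL2 assms(2,3)]])
  then show "n = m" by simp
  assume "\<mu> \<in> digits D n" "\<nu> \<in> digits D m"
  then show "\<mu> = \<nu>" using digits_unique[of \<nu> n \<mu>] conjunct1[OF *] conjunct2[OF *] by blast
qed

lemma g1_KZ_iff: "g ** g1 D n \<mu> \<in> KZ D \<longleftrightarrow> g ** swap ** g0 D (Suc n) (\<pi> * \<mu>) \<in> KZ D"
  unfolding g1_eq using KZ_mult_right_iff[OF swap_KZ, of "g ** swap ** g0 D (Suc n) (\<pi> * \<mu>)"]
  by (simp add: matrix_mul_assoc)

lemma g1_unique:
  assumes "g \<in> GL2" "g ** g1 D n \<mu> \<in> KZ D" "g ** g1 D m \<nu> \<in> KZ D"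
  shows "n = m" "\<mu> \<in> digits D n \<Longrightarrow> \<nu> \<in> digits D m \<Longrightarrow> \<mu> = \<nu>"
proof -
  have "matrix_inv (g0 D (Suc n) (\<pi> * \<mu>)) ** g0 D (Suc m) (\<pi> * \<nu>) \<in> KZ D"
    by (rule KZ_quotient[OF GL2_mult[OF assms(1) swap_GL2] g0_GL2]) (use assms g1_KZ_iff in auto)
  from g0_g0_KZ[OF this] have *: "n = m" "\<pi> * (\<nu> - \<mu>) \<in> F.vball (real (Suc n))"
    by (auto simp: algebra_simps)
  show "n = m" by (rule *)
  have "\<nu> - \<mu> \<in> F.vball (real n)" using *(2) unfolding R.pi_mult_ball by simp
  then show "\<mu> = \<nu>" if "\<mu> \<in> digits D n" "\<nu> \<in> digits D m"
    using digits_unique[of \<nu> n \<mu>] that *(1) by simp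
qed

lemma g0_g1_exclusive:
  assumes "g \<in> GL2" "g ** g0 D n \<mu> \<in> KZ D" "\<mu> \<in> F.vball 0" "\<nu> \<in> F.vball 0"
  shows "g ** g1 D m \<nu> \<notin> KZ D"
proof
  assume "g ** g1 D m \<nu> \<in> KZ D"
  then have "g ** (swap ** g0 D (Suc m) (\<pi> * \<nu>)) \<in> KZ D" by (simp add: g1_KZ_iff matrix_mul_assoc)
  from KZ_quotient[OF assms(1) g0_GL2 assms(2) this]
  have "matrix_inv (g0 D n \<mu>) ** swap ** g0 D (Suc m) (\<pi> * \<nu>) \<in> KZ D" by (simp add: matrix_mul_assoc)
  moreover have "\<pi> * \<nu> \<in> F.vball 1" using F.ball_mult[OF unif_ball assms(4)] by simp
  ultimately show False using g0_swap_g0_KZ[OF assms(3), of "\<pi> * \<nu>" "Suc m" n] by simp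
qed

lemma vertex_cases:
  assumes "g \<in> GL2"
  obtains (zero) n \<mu> where "\<mu> \<in> digits D n" "g ** g0 D n \<mu> \<in> KZ D"
    | (one) n \<mu> where "\<mu> \<in> digits D n" "g ** g1 D n \<mu> \<in> KZ D"
proof -
  have KZ: "g ** y \<in> KZ D" if c: "same_coset (matrix_inv g) y" and y: "y \<in> GL2" for y
  proof -
    obtain \<kappa> where \<kappa>: "\<kappa> \<in> KZ D" "matrix_inv g = y ** \<kappa>" using c by (auto simp: same_coset_def)
    have "g ** y ** \<kappa> = mat 1" using \<kappa>(2) matrix_inv_mult(1)[OF assms] by (simp add: matrix_mul_assoc[symmetric])
    then have "g ** y = matrix_inv \<kappa>" using mult_inv_cancel(3)[OF KZ_GL2[OF \<kappa>(1)], of "g ** y"] by simp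
    then show ?thesis using KZ_inv[OF \<kappa>(1)] by simp
  qed
  from GL2_inv[OF assms] show ?thesis
  proof (cases rule: coset_cases)
    case (zero n \<mu>)
    then show ?thesis using that(1) KZ g0_GL2 by blast
  next
    case (one n \<mu>)
    then show ?thesis using that(2) KZ g1_GL2 by blast
  qed
qed

lemma cind_at_vertex:
  assumes "f \<in> cind D k W" "y \<in> GL2" "g ** y \<in> KZ D"
  shows "f g = rho D k (g ** y) (f (matrix_inv y))"
  using cindD(3)[OF assms(1,3) GL2_inv[OF assms(2)]] mult_inv_cancel(3)[OF assms(2)] by simp

section \<open>Functions supported on a ball of the tree\<close>

definition J :: "(nat \<times> 'f) set" where
  "J = (SIGMA n:UNIV. digits D n)"

lemma fsum_J_unique:
  assumes "(n, \<mu>) \<in> J" "\<And>m \<nu>. (m, \<nu>) \<in> J \<Longrightarrow> (m, \<nu>) \<noteq> (n, \<mu>) \<Longrightarrow> t (m, \<nu>) = 0"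
  shows "fsum J t = t (n, \<mu>)"
  using fsum_eq[of "{(n, \<mu>)}" J t] assms by auto

lemma fsum_zero: "(\<And>i. i \<in> A \<Longrightarrow> t i = 0) \<Longrightarrow> fsum A t = 0"
  using fsum_eq[of "{}" A t] by auto

text \<open>A group element \<open>g\<close> stands for the vertex $g^{-1} KZ$ of the tree, since functions in the compact
  induction are equivariant on the left.\<close>

definition core :: "int \<Rightarrow> ('f ^ 2 ^ 2) set" where
  "core N = {g \<in> GL2. \<exists>(n, \<mu>)\<in>J. (int n \<le> N \<and> g ** g0 D n \<mu> \<in> KZ D) \<or> (int n \<le> N - 1 \<and> g ** g1 D n \<mu> \<in> KZ D)}"

lemma core_zero:
  assumes g: "g \<in> GL2" "\<mu> \<in> digits D n" "g ** g0 D n \<mu> \<in> KZ D"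
  shows "g \<in> core N \<longleftrightarrow> int n \<le> N"
proof
  assume "g \<in> core N"
  then obtain m \<nu> where m: "\<nu> \<in> digits D m"
    "(int m \<le> N \<and> g ** g0 D m \<nu> \<in> KZ D) \<or> (int m \<le> N - 1 \<and> g ** g1 D m \<nu> \<in> KZ D)"
    by (auto simp: core_def J_def)
  have "g ** g1 D m \<nu> \<notin> KZ D"
    by (rule g0_g1_exclusive[OF g(1,3) digits_integral[OF g(2)] digits_integral[OF m(1)]])
  then show "int n \<le> N" using m(2) g0_unique(1)[OF g(1,3)] by auto
next
  assume "int n \<le> N"
  then show "g \<in> core N" unfolding core_def J_def using g by blast
qed

lemma core_one:
  assumes g: "g \<in> GL2" "\<mu> \<in> digits D n" "g ** g1 D n \<mu> \<in> KZ D"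
  shows "g \<in> core N \<longleftrightarrow> int n \<le> N - 1"
proof
  assume "g \<in> core N"
  then obtain m \<nu> where m: "\<nu> \<in> digits D m"
    "(int m \<le> N \<and> g ** g0 D m \<nu> \<in> KZ D) \<or> (int m \<le> N - 1 \<and> g ** g1 D m \<nu> \<in> KZ D)"
    by (auto simp: core_def J_def)
  have "g ** g0 D m \<nu> \<notin> KZ D"
    using g0_g1_exclusive[OF g(1) _ digits_integral[OF m(1)] digits_integral[OF g(2)]] g(3) by blast
  then show "int n \<le> N - 1" using m(2) g1_unique(1)[OF g(1,3)] by auto
next
  assume "int n \<le> N - 1"
  then show "g \<in> core N" unfolding core_def J_def using g by blast
qed

lemma core_KZ: "\<kappa> \<in> KZ D \<Longrightarrow> g \<in> GL2 \<Longrightarrow> \<kappa> ** g \<in> core N \<longleftrightarrow> g \<in> core N"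
  unfolding core_def using GL2_mult[OF KZ_GL2] KZ_mult_left_iff
  by (simp add: matrix_mul_assoc[symmetric])

lemma B_supp_vanish:
  assumes b: "b \<in> B_supp D k N" and g: "g \<in> GL2" "g \<notin> core N"
  shows "b g = 0"
proof -
  obtain v0 v1 where ex: "expansion D k b v0 v1"
    and v: "\<And>n \<mu>. \<mu> \<in> digits D n \<Longrightarrow> int n > N \<Longrightarrow> v0 (n, \<mu>) = 0"
      "\<And>n \<mu>. \<mu> \<in> digits D n \<Longrightarrow> int n > N - 1 \<Longrightarrow> v1 (n, \<mu>) = 0"
    using b unfolding B_supp_def by blast
  have bg: "b g = fsum J (\<lambda>(n, \<mu>). elem D k (g0 D n \<mu>) (v0 (n, \<mu>)) g)
        + fsum J (\<lambda>(n, \<mu>). elem D k (g1 D n \<mu>) (v1 (n, \<mu>)) g)"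
    using ex unfolding expansion_def Let_def J_def by blast
  have 0: "elem D k (g0 D n \<mu>) (v0 (n, \<mu>)) g = 0" if \<mu>: "\<mu> \<in> digits D n" for n \<mu>
    using core_zero[OF g(1) \<mu>, of N] g(2) v(1)[OF \<mu>] by (auto simp: elem_def)
  have 1: "elem D k (g1 D n \<mu>) (v1 (n, \<mu>)) g = 0" if \<mu>: "\<mu> \<in> digits D n" for n \<mu>
    using core_one[OF g(1) \<mu>, of N] g(2) v(2)[OF \<mu>] by (auto simp: elem_def)
  have "fsum J (\<lambda>(n, \<mu>). elem D k (g0 D n \<mu>) (v0 (n, \<mu>)) g) = 0"
    by (rule fsum_zero) (use 0 in \<open>auto simp: J_def\<close>)
  moreover have "fsum J (\<lambda>(n, \<mu>). elem D k (g1 D n \<mu>) (v1 (n, \<mu>)) g) = 0"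
    by (rule fsum_zero) (use 1 in \<open>auto simp: J_def\<close>)
  ultimately show ?thesis using bg by simp
qed

text \<open>Needed with c = 1 for the part of f on a core, and with the inverse of a power of
  \<varpi> and integral values for the part outside.\<close>

lemma restrict_cind:
  assumes f: "f \<in> cind D k W" and W: "0 \<in> W'"
    and vals: "\<And>g. g \<in> GL2 \<Longrightarrow> Q g \<Longrightarrow> Const c * f g \<in> W'"
    and Q: "\<And>\<kappa> g. \<kappa> \<in> KZ D \<Longrightarrow> g \<in> GL2 \<Longrightarrow> Q (\<kappa> ** g) \<longleftrightarrow> Q g"
  shows "(\<lambda>g. if Q g then Const c * f g else 0) \<in> cind D k W'"
  unfolding cind_def mem_Collect_eq
proof (intro conjI allI impI ballI)
  let ?f = "\<lambda>g. if Q g then Const c * f g else 0"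
  show "?f g = 0" if "g \<notin> GL2" for g using cindD(1)[OF f that] by simp
  show "?f g \<in> W'" if "g \<in> GL2" for g using vals[OF that] W by simp
  show "?f (\<kappa> ** g) = rho D k \<kappa> (?f g)" if "\<kappa> \<in> KZ D" "g \<in> GL2" for \<kappa> g
    using Q[OF that] cindD(3)[OF f that] by (simp add: rho_Const_mult)
  have "finite ((\<lambda>g. (\<lambda>\<kappa>. \<kappa> ** g) ` KZ D) ` {g \<in> GL2. f g \<noteq> 0})" using f by (simp add: cind_def)
  then show "finite ((\<lambda>g. (\<lambda>\<kappa>. \<kappa> ** g) ` KZ D) ` {g \<in> GL2. ?f g \<noteq> 0})"
    by (rule finite_subset[rotated]) auto
qed

text \<open>The coordinates are the values of f at the inverses of the vertex representatives. At a
  given g at most one term of the expansion is nonzero, because the representatives lie in different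
  cosets.\<close>

lemma core_part_B_supp:
  assumes f: "f \<in> cind D k (Vk D k)"
  shows "(\<lambda>g. if g \<in> core N then f g else 0) \<in> B_supp D k N"
proof -
  let ?b = "\<lambda>g. if g \<in> core N then f g else 0"
  have "(\<lambda>g. if g \<in> core N then Const 1 * f g else 0) \<in> cind D k (Vk D k)"
    by (rule restrict_cind[OF f]) (use Vk_zero cindD(2)[OF f] core_KZ in auto)
  then have b: "?b \<in> cind D k (Vk D k)" unfolding Const_1 mult_1_left .
  define v0 where "v0 = (\<lambda>(n, \<mu>). if int n \<le> N then f (matrix_inv (g0 D n \<mu>)) else 0)"
  define v1 where "v1 = (\<lambda>(n, \<mu>). if int n \<le> N - 1 then f (matrix_inv (g1 D n \<mu>)) else 0)"
  have "expansion D k ?b v0 v1"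
    unfolding expansion_def Let_def J_def[symmetric]
  proof (intro conjI ballI allI)
    fix x assume "x \<in> J"
    show "v0 x \<in> Vk D k" "v1 x \<in> Vk D k"
      using cindD(2)[OF f GL2_inv[OF g0_GL2]] cindD(2)[OF f GL2_inv[OF g1_GL2]] Vk_zero
      by (auto simp: v0_def v1_def split: prod.splits)
  next
    have fin: "finite (SIGMA n:{..nat N}. digits D n)" by (intro finite_SigmaI finite_digits) simp
    show "finite {x \<in> J. v0 x \<noteq> 0}"
      by (rule finite_subset[OF _ fin]) (auto simp: J_def v0_def split: if_splits)
    show "finite {x \<in> J. v1 x \<noteq> 0}"
      by (rule finite_subset[OF _ fin]) (auto simp: J_def v1_def split: if_splits)
  next
    fix g
    let ?t0 = "\<lambda>(n, \<mu>). elem D k (g0 D n \<mu>) (v0 (n, \<mu>)) g"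
    let ?t1 = "\<lambda>(n, \<mu>). elem D k (g1 D n \<mu>) (v1 (n, \<mu>)) g"
    show "?b g = fsum J ?t0 + fsum J ?t1"
    proof (cases "g \<in> GL2")
      case False
      then have "fsum J ?t0 = 0" "fsum J ?t1 = 0"
        by (auto intro!: fsum_zero simp: elem_def not_KZ_outside split: prod.splits)
      then show ?thesis using False cindD(1)[OF f] by simp
    next
      case True
      then show ?thesis
      proof (cases rule: vertex_cases)
        case (zero n \<mu>)
        have "?t1 (m, \<nu>) = 0" if "(m, \<nu>) \<in> J" for m \<nu>
        proof -
          have "\<nu> \<in> digits D m" using that by (simp add: J_def)
          then show ?thesis
            using g0_g1_exclusive[OF True zero(2) digits_integral[OF zero(1)] digits_integral] by (simp add: elem_def)
        qed
        then have "fsum J ?t1 = 0" by (intro fsum_zero) auto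
        moreover have "fsum J ?t0 = ?t0 (n, \<mu>)"
        proof (rule fsum_J_unique)
          show "(n, \<mu>) \<in> J" using zero by (simp add: J_def)
          show "?t0 (m, \<nu>) = 0" if "(m, \<nu>) \<in> J" "(m, \<nu>) \<noteq> (n, \<mu>)" for m \<nu>
          proof -
            have "g ** g0 D m \<nu> \<notin> KZ D"
              using g0_unique[OF True zero(2), of m \<nu>] zero(1) that by (auto simp: J_def)
            then show ?thesis by (simp add: elem_def)
          qed
        qed
        moreover have "?t0 (n, \<mu>) = ?b g"
          using core_zero[OF True zero, of N] cind_at_vertex[OF f g0_GL2 zero(2)] zero(2)
          by (simp add: elem_def v0_def)
        ultimately show ?thesis by simp
      next
        case (one n \<mu>)
        have "?t0 (m, \<nu>) = 0" if "(m, \<nu>) \<in> J" for m \<nu>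
        proof -
          have "\<nu> \<in> digits D m" using that by (simp add: J_def)
          then have "g ** g0 D m \<nu> \<notin> KZ D"
            using g0_g1_exclusive[OF True _ digits_integral digits_integral[OF one(1)]] one(2) by blast
          then show ?thesis by (simp add: elem_def)
        qed
        then have "fsum J ?t0 = 0" by (intro fsum_zero) auto
        moreover have "fsum J ?t1 = ?t1 (n, \<mu>)"
        proof (rule fsum_J_unique)
          show "(n, \<mu>) \<in> J" using one by (simp add: J_def)
          show "?t1 (m, \<nu>) = 0" if "(m, \<nu>) \<in> J" "(m, \<nu>) \<noteq> (n, \<mu>)" for m \<nu>
          proof -
            have "g ** g1 D m \<nu> \<notin> KZ D"
              using g1_unique[OF True one(2), of m \<nu>] one(1) that by (auto simp: J_def)
            then show ?thesis by (simp add: elem_def)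
          qed
        qed
        moreover have "?t1 (n, \<mu>) = ?b g"
          using core_one[OF True one, of N] cind_at_vertex[OF f g1_GL2 one(2)] one(2)
          by (simp add: elem_def v1_def)
        ultimately show ?thesis by simp
      qed
    qed
  qed
  moreover have "\<forall>n. \<forall>\<mu>\<in>digits D n. (int n > N \<longrightarrow> v0 (n, \<mu>) = 0) \<and> (int n > N - 1 \<longrightarrow> v1 (n, \<mu>) = 0)"
    by (simp add: v0_def v1_def)
  ultimately show ?thesis unfolding B_supp_def using b by blast
qed

text \<open>Here \<mu> is any integral element and not just a digit expansion, since the addresses
  of the descent are not reduced.\<close>

lemma outside_core_g0:
  assumes "int m > N" "\<mu> \<in> F.vball 0"
  shows "matrix_inv (g0 D m \<mu>) \<notin> core N"
proof
  assume "matrix_inv (g0 D m \<mu>) \<in> core N"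
  then obtain n \<nu> where n: "\<nu> \<in> digits D n" "(int n \<le> N \<and> matrix_inv (g0 D m \<mu>) ** g0 D n \<nu> \<in> KZ D) \<or>
      (int n \<le> N - 1 \<and> matrix_inv (g0 D m \<mu>) ** g1 D n \<nu> \<in> KZ D)"
    by (auto simp: core_def J_def)
  have "matrix_inv (g0 D m \<mu>) ** g0 D m \<mu> \<in> KZ D" using matrix_inv_mult(2)[OF g0_GL2] KZ_one by simp
  from g0_g1_exclusive[OF GL2_inv[OF g0_GL2] this assms(2) digits_integral[OF n(1)]]
  show False using n(2) g0_g0_KZ[of m \<mu> n \<nu>] assms(1) by auto
qed

text \<open>The vertex in question is that of \<open>g1\<close> with level m - 1, which matches the
  bound N - 1 for this family.\<close>

lemma outside_core_g1:
  assumes "int m > N" "1 \<le> m" "\<mu> \<in> F.vball 1"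
  shows "matrix_inv (g0 D m \<mu>) ** swap \<notin> core N"
proof
  let ?g = "matrix_inv (g0 D m \<mu>) ** swap"
  assume "?g \<in> core N"
  then obtain n \<nu> where n: "\<nu> \<in> digits D n" "(int n \<le> N \<and> ?g ** g0 D n \<nu> \<in> KZ D) \<or>
      (int n \<le> N - 1 \<and> ?g ** g1 D n \<nu> \<in> KZ D)"
    by (auto simp: core_def J_def)
  define \<rho> where "\<rho> = \<mu> / \<pi>"
  have \<rho>: "\<mu> = \<pi> * \<rho>" using unif by (simp add: \<rho>_def)
  then have \<rho>b: "\<rho> \<in> F.vball 0" using assms(3) R.pi_mult_ball[of \<rho> 1] by simp
  have m: "m = Suc (m - 1)" using assms(2) by simp
  have g: "?g \<in> GL2" by (intro GL2_mult GL2_inv g0_GL2 swap_GL2)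
  have "?g ** swap ** g0 D m \<mu> = mat 1"
    using mult_inv_cancel(3)[OF swap_GL2, of "matrix_inv (g0 D m \<mu>)"] matrix_inv_mult(2)[OF g0_GL2] by (simp add: inv_swap)
  then have one: "?g ** g1 D (m - 1) \<rho> \<in> KZ D"
    unfolding g1_KZ_iff using m \<rho> KZ_one by simp
  have "?g ** g0 D n \<nu> \<notin> KZ D"
    using g0_g1_exclusive[OF g _ digits_integral[OF n(1)] \<rho>b] one by blast
  then show False using n(2) g1_unique(1)[OF g one, of n \<nu>] assms(1,2) by auto
qed

text \<open>The loss of one in the radius: outside the core of radius N - 1, vertices have level at
  least N in the numbering of \<open>g0\<close>, so everything strictly below them lies outside the
  core of radius N, where (T - a) f is divisible by \<varpi>^n.\<close>

lemma outside_core_bound: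
  assumes \<tau>: "\<tau> \<in> Emb D"
    and d: "1 \<le> d" "2 * d < q" "K = d * q"
    and a: "a \<noteq> 0" "0 < val_C D a" "val_C D a \<le> 1"
    and N: "N > 0" and f: "f \<in> cind D k (Vk0 D k)"
    and Tf: "(\<lambda>g. hecke D k f g - Const a * f g) \<in> B_plus D k \<tau> N (int n)"
  shows "f \<in> B_plus D k \<tau> (N - 1) (int n - int (d + 1))"
proof -
  define e where "e = \<tau> \<pi> powi (int n - int (d + 1))"
  have e: "e \<noteq> 0" using val_C_powi[OF \<tau>, of "int n - int (d + 1)"] by (simp add: e_def)
  have fV: "f \<in> cind D k (Vk D k)" using f Vk0_sub_Vk by (auto simp: cind_def)
  obtain b h where b: "b \<in> B_supp D k N" and h: "h \<in> cind D k (Vk0 D k)"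
    and bh: "(\<lambda>g. hecke D k f g - Const a * f g) = (\<lambda>g. b g + Const (\<tau> \<pi> powi int n) * h g)"
    using Tf unfolding B_plus_def by blast
  have bh': "hecke D k f g - Const a * f g = b g + Const (\<tau> \<pi> powi int n) * h g" for g
    using fun_cong[OF bh, of g] .
  have out: "\<exists>r\<in>Vk0 D k. hecke D k f g - Const a * f g = Const (\<tau> \<pi> powi int n) * r"
    if "g \<in> GL2" "g \<notin> core N" for g
    using bh'[of g] B_supp_vanish[OF b that] cindD(2)[OF h that(1)] by auto
  have w1: "mat 1 \<in> (GL2 :: ('f ^ 2 ^ 2) set)" by (rule GL2_one)
  have zero: "\<exists>r\<in>Vk0 D k. f (matrix_inv (g0 D m \<mu>)) = Const e * r"
    if m: "int m > N - 1" and \<mu>: "\<mu> \<in> F.vball 0" for m \<mu>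
  proof -
    have "\<exists>r\<in>Vk0 D k. f (matrix_inv (g0 D m \<mu>) ** mat 1) = Const e * r"
      unfolding e_def
    proof (rule descend[OF fV w1 \<tau> d a])
      fix m' \<mu>' assume m': "m < m'" and \<mu>': "\<mu>' - \<mu> \<in> F.vball (real m)"
      have "\<mu>' - \<mu> \<in> F.vball 0" by (rule F.ball_mono[OF \<mu>']) simp
      then have "\<mu>' \<in> F.vball 0" using F.ball_cong_diff \<mu> by blast
      then have "matrix_inv (g0 D m' \<mu>') \<notin> core N" by (intro outside_core_g0) (use m m' in auto)
      from out[OF GL2_inv[OF g0_GL2] this]
      show "\<exists>r\<in>Vk0 D k. hecke D k f (matrix_inv (g0 D m' \<mu>') ** mat 1) - Const a * f (matrix_inv (g0 D m' \<mu>') ** mat 1)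
          = Const (\<tau> \<pi> powi int n) * r" by simp
    qed
    then show ?thesis by simp
  qed
  have one: "\<exists>r\<in>Vk0 D k. f (matrix_inv (g0 D m \<mu>) ** swap) = Const e * r"
    if m: "int m > N - 1" and \<mu>: "\<mu> \<in> F.vball 1" for m \<mu>
    unfolding e_def
  proof (rule descend[OF fV swap_GL2 \<tau> d a])
    fix m' \<mu>' assume m': "m < m'" and \<mu>': "\<mu>' - \<mu> \<in> F.vball (real m)"
    \<comment> \<open>Since N > 0, the level m is at least 1. This keeps all addresses below the
      vertex in the maximal ideal, that is, in the half of the tree reached through
      \<open>swap\<close>.\<close>
    have "\<mu>' - \<mu> \<in> F.vball 1" by (rule F.ball_mono[OF \<mu>']) (use m N in linarith)
    then have "\<mu>' \<in> F.vball 1" using F.ball_cong_diff \<mu> by blast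
    then have "matrix_inv (g0 D m' \<mu>') ** swap \<notin> core N" by (intro outside_core_g1) (use m m' in auto)
    from out[OF GL2_mult[OF GL2_inv[OF g0_GL2] swap_GL2] this]
    show "\<exists>r\<in>Vk0 D k. hecke D k f (matrix_inv (g0 D m' \<mu>') ** swap) - Const a * f (matrix_inv (g0 D m' \<mu>') ** swap)
        = Const (\<tau> \<pi> powi int n) * r" .
  qed
  have KZ_e: "\<exists>r\<in>Vk0 D k. rho D k \<kappa> P = Const e * r" if "\<kappa> \<in> KZ D" "\<exists>r\<in>Vk0 D k. P = Const e * r" for \<kappa> P
    using that rho_KZ_Vk0 rho_Const_mult by metis
  have outer: "Const (inverse e) * f g \<in> Vk0 D k" if g: "g \<in> GL2" "g \<notin> core (N - 1)" for g
  proof -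
    have "\<exists>r\<in>Vk0 D k. f g = Const e * r"
      using g(1)
    proof (cases rule: vertex_cases)
      case (zero m \<mu>)
      then have "int m > N - 1" using core_zero[OF g(1) zero, of "N - 1"] g(2) by simp
      from \<open>\<And>m \<mu>. _ \<Longrightarrow> _ \<Longrightarrow> \<exists>r\<in>_. f (matrix_inv (g0 D m \<mu>)) = _\<close>[OF this digits_integral[OF zero(1)]]
      show ?thesis unfolding cind_at_vertex[OF f g0_GL2 zero(2)] by (rule KZ_e[OF zero(2)])
    next
      case (one m \<mu>)
      have m: "int (Suc m) > N - 1" using core_one[OF g(1) one, of "N - 1"] g(2) by simp
      have "\<pi> * \<mu> \<in> F.vball 1" using F.ball_mult[OF unif_ball digits_integral[OF one(1)]] by simp
      from \<open>\<And>m \<mu>. _ \<Longrightarrow> _ \<Longrightarrow> \<exists>r\<in>_. f (matrix_inv (g0 D m \<mu>) ** swap) = _\<close>[OF m this]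
      have 1: "\<exists>r\<in>Vk0 D k. rho D k swap (f (matrix_inv (g0 D (Suc m) (\<pi> * \<mu>)) ** swap)) = Const e * r"
        by (rule KZ_e[OF swap_KZ])
      have "f (matrix_inv (g1 D m \<mu>)) = rho D k swap (f (matrix_inv (g0 D (Suc m) (\<pi> * \<mu>)) ** swap))"
        unfolding inv_g1 using cindD(3)[OF f swap_KZ GL2_mult[OF GL2_inv[OF g0_GL2] swap_GL2]]
        by (simp add: matrix_mul_assoc)
      then show ?thesis
        unfolding cind_at_vertex[OF f g1_GL2 one(2)] using 1 by (intro KZ_e[OF one(2)]) simp
    qed
    then obtain r where r: "r \<in> Vk0 D k" "f g = Const e * r" by blast
    have "Const (inverse e) * f g = Const (inverse e * e) * r" by (simp only: r(2) Const_mult mult.assoc)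
    then show ?thesis using r(1) e by simp
  qed
  let ?h = "\<lambda>g. if g \<notin> core (N - 1) then Const (inverse e) * f g else 0"
  have h': "?h \<in> cind D k (Vk0 D k)"
    by (rule restrict_cind[OF f Vk0_zero outer]) (use core_KZ in auto)
  have "f = (\<lambda>g. (if g \<in> core (N - 1) then f g else 0) + Const e * ?h g)"
  proof
    fix g
    have "Const e * (Const (inverse e) * f g) = Const (e * inverse e) * f g" by (simp only: Const_mult mult.assoc)
    then show "f g = (if g \<in> core (N - 1) then f g else 0) + Const e * ?h g" using e by simp
  qed
  then have "\<exists>b h. f = (\<lambda>g. b g + Const e * h g) \<and> b \<in> B_supp D k (N - 1) \<and> h \<in> cind D k (Vk0 D k)"
    by (intro exI[of _ "\<lambda>g. if g \<in> core (N - 1) then f g else 0"] exI[of _ ?h] conjI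
        core_part_B_supp[OF fV] h')
  then show ?thesis unfolding B_plus_def e_def mem_Collect_eq .
qed

end

theorem theorem4p21:
  fixes D :: "('p::prime_card, 'f::field, 'c::field) padic_data"
    and k :: "('f \<Rightarrow> 'c) \<Rightarrow> nat"
    and \<sigma> \<tau> :: "'f \<Rightarrow> 'c"
    and d :: nat and a :: 'c and N :: int
  assumes "padic_setting D"
    and "\<tau> \<in> Emb D"
    and "\<sigma> \<in> Emb D" and "k \<sigma> = d * residue_card D"
    and "\<forall>\<sigma>'\<in>Emb D. \<sigma>' \<noteq> \<sigma> \<longrightarrow> k \<sigma>' = 0"
    and "1 \<le> d" and "real d < real (residue_card D) / 2"
    and "a \<in> O_C D" and "a \<noteq> 0" and "0 < val_C D a" and "val_C D a \<le> 1"
    and "N > 0"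
  shows "\<exists>\<epsilon>::nat. \<forall>n::nat. \<forall>f \<in> cind D k (Vk0 D k).
           (\<lambda>g. hecke D k f g - Const a * f g) \<in> B_plus D k \<tau> N (int n) \<longrightarrow>
           f \<in> B_plus D k \<tau> (N - 1) (int n - int \<epsilon>)"
proof -
  have d: "2 * d < residue_card D" using assms(7) by linarith
  interpret single_weight D k \<sigma>
    by unfold_locales (use assms d in auto)
  show ?thesis
    by (intro exI[of _ "d + 1"] allI ballI impI outside_core_bound[OF assms(2,6) d assms(4,9,10,11,12)])
qed

end
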